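(* Let $G$ be a finitely generated group. Suppose that $G$ contains a free, normal subgroup $N$ such that $G/N$ is infinite cyclic. If $G/\gamma_2(N)$ is residually torsion-free nilpotent, then $G$ is residually torsion-free nilpotent.
   Context: For subgroups $H,K$ of a group, $[H,K]$ denotes the subgroup generated by all commutators $h^{-1}k^{-1}hk$ with $h\in H$, $k\in K$. The lower central series of a group $G$ is defined by $\gamma_1(G)=G$ and $\gamma_{n+1}(G)=[\gamma_n(G),G]$; thus $\gamma_2(N)=[N,N]$ is the derived subgroup of $N$. A group $G$ is nilpotent if $\gamma_{c+1}(G)=1$ for some $c$. For a property $\mathcal{P}$ of groups, a group $G$ is residually a $\mathcal{P}$-group if for each $g\in G$ with $g\neq 1$ there exists a normal subgroup $K$ of $G$ such that $g\notin K$ and $G/K$ has $\mathcal{P}$. "Residually torsion-free nilpotent" is this notion with $\mathcal{P}$ the property of being both torsion-free and nilpotent. The free group $N$ is not assumed to be finitely generated. *)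

theory Defs
  imports "HOL-Algebra.Algebra"
begin

definition finitely_generated :: "('a, 'b) monoid_scheme \<Rightarrow> bool" where
  "finitely_generated G \<longleftrightarrow> (\<exists>S. finite S \<and> S \<subseteq> carrier G \<and> generate G S = carrier G)"

definition commutator_subgroup :: "('a, 'b) monoid_scheme \<Rightarrow> 'a set \<Rightarrow> 'a set \<Rightarrow> 'a set" where
  "commutator_subgroup G H K =
     generate G {inv\<^bsub>G\<^esub> h \<otimes>\<^bsub>G\<^esub> inv\<^bsub>G\<^esub> k \<otimes>\<^bsub>G\<^esub> h \<otimes>\<^bsub>G\<^esub> k | h k. h \<in> H \<and> k \<in> K}"

text \<open>The indexing starts at 1; the value at 0 is a dummy.\<close>

fun lower_central :: "('a, 'b) monoid_scheme \<Rightarrow> nat \<Rightarrow> 'a set" where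
  "lower_central G 0 = carrier G"
| "lower_central G (Suc 0) = carrier G"
| "lower_central G (Suc (Suc n)) = commutator_subgroup G (lower_central G (Suc n)) (carrier G)"

definition nilpotent_group :: "('a, 'b) monoid_scheme \<Rightarrow> bool" where
  "nilpotent_group G \<longleftrightarrow> (\<exists>c. lower_central G (c + 1) = {\<one>\<^bsub>G\<^esub>})"

definition torsion_free_group :: "('a, 'b) monoid_scheme \<Rightarrow> bool" where
  "torsion_free_group G \<longleftrightarrow>
     (\<forall>x \<in> carrier G. \<forall>n::nat. n > 0 \<longrightarrow> x [^]\<^bsub>G\<^esub> n = \<one>\<^bsub>G\<^esub> \<longrightarrow> x = \<one>\<^bsub>G\<^esub>)"

definition residually :: "('a set monoid \<Rightarrow> bool) \<Rightarrow> ('a, 'b) monoid_scheme \<Rightarrow> bool" where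
  "residually P G \<longleftrightarrow>
     (\<forall>g \<in> carrier G. g \<noteq> \<one>\<^bsub>G\<^esub> \<longrightarrow> (\<exists>K. K \<lhd> G \<and> g \<notin> K \<and> P (G Mod K)))"

definition residually_torsion_free_nilpotent :: "('a, 'b) monoid_scheme \<Rightarrow> bool" where
  "residually_torsion_free_nilpotent G \<longleftrightarrow>
     residually (\<lambda>Q. torsion_free_group Q \<and> nilpotent_group Q) G"

text \<open>A word over \<open>B\<close> is a list of letters \<open>(x, b)\<close> with \<open>x \<in> B\<close>; the letter \<open>(x, True)\<close> stands
  for \<open>x\<close> and \<open>(x, False)\<close> for its inverse.  A set \<open>B\<close> is a basis of \<open>G\<close> if every element of \<open>G\<close> is the
  value of exactly one reduced word over \<open>B\<close>; the lemma \<open>free_basis_extends\<close> below is the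
  corresponding mapping property.\<close>

definition letter_value :: "('a, 'b) monoid_scheme \<Rightarrow> 'a \<times> bool \<Rightarrow> 'a" where
  "letter_value G l = (if snd l then fst l else inv\<^bsub>G\<^esub> (fst l))"

definition word_value :: "('a, 'b) monoid_scheme \<Rightarrow> ('a \<times> bool) list \<Rightarrow> 'a" where
  "word_value G w = foldr (\<lambda>l y. letter_value G l \<otimes>\<^bsub>G\<^esub> y) w \<one>\<^bsub>G\<^esub>"

definition reduced_word :: "('a \<times> bool) list \<Rightarrow> bool" where
  "reduced_word = successively (\<lambda>k l. \<not> (fst k = fst l \<and> snd k \<noteq> snd l))"

definition free_basis :: "('a, 'b) monoid_scheme \<Rightarrow> 'a set \<Rightarrow> bool" where
  "free_basis G B \<longleftrightarrow> B \<subseteq> carrier G \<and>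
     bij_betw (word_value G) {w. set w \<subseteq> B \<times> UNIV \<and> reduced_word w} (carrier G)"

definition free_group :: "('a, 'b) monoid_scheme \<Rightarrow> bool" where
  "free_group G \<longleftrightarrow> group G \<and> (\<exists>B. free_basis G B)"

lemma letter_value_closed:
  assumes "group G" "fst l \<in> carrier G"
  shows "letter_value G l \<in> carrier G"
  using assms by (simp add: letter_value_def group.inv_closed)

lemma word_value_Nil [simp]: "word_value G [] = \<one>\<^bsub>G\<^esub>"
  by (simp add: word_value_def)

lemma word_value_Cons [simp]: "word_value G (l # w) = letter_value G l \<otimes>\<^bsub>G\<^esub> word_value G w"
  by (simp add: word_value_def)

lemma word_value_closed:
  assumes "group G" "set w \<subseteq> carrier G \<times> UNIV"
  shows "word_value G w \<in> carrier G"
proof -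
  interpret group G by fact
  show ?thesis
    using assms(2) by (induction w) (auto intro!: letter_value_closed assms(1))
qed

lemma word_value_append:
  assumes "group G" "set u \<subseteq> carrier G \<times> UNIV" "set v \<subseteq> carrier G \<times> UNIV"
  shows "word_value G (u @ v) = word_value G u \<otimes>\<^bsub>G\<^esub> word_value G v"
proof -
  interpret group G by fact
  show ?thesis
    using assms(2)
  proof (induction u)
    case Nil
    then show ?case using word_value_closed[OF assms(1,3)] by simp
  next
    case (Cons l u)
    then have "letter_value G l \<in> carrier G" "word_value G u \<in> carrier G"
      by (auto intro!: letter_value_closed word_value_closed assms(1))
    with Cons word_value_closed[OF assms(1,3)] show ?case
      by (simp add: m_assoc)
  qed
qed

lemma letter_value_cancel:
  assumes "group G" "fst k \<in> carrier G" "fst k = fst l" "snd k \<noteq> snd l" "y \<in> carrier G"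
  shows "letter_value G k \<otimes>\<^bsub>G\<^esub> (letter_value G l \<otimes>\<^bsub>G\<^esub> y) = y"
proof -
  interpret group G by fact
  have "letter_value G k \<otimes>\<^bsub>G\<^esub> letter_value G l = \<one>\<^bsub>G\<^esub>"
    using assms by (auto simp: letter_value_def)
  moreover have "letter_value G k \<in> carrier G" "letter_value G l \<in> carrier G"
    using assms by (auto intro!: letter_value_closed)
  ultimately show ?thesis
    using assms(5) by (simp flip: m_assoc)
qed

lemma word_reduce:
  assumes G: "group G" and H: "group H"
    and B: "B \<subseteq> carrier G" and f: "f ` B \<subseteq> carrier H" and w: "set w \<subseteq> B \<times> UNIV"
  shows "\<exists>v. set v \<subseteq> B \<times> UNIV \<and> reduced_word v \<and> word_value G v = word_value G w \<and>
    word_value H (map (apfst f) v) = word_value H (map (apfst f) w)"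
  using w
proof (induction w)
  case Nil
  then show ?case by (intro exI[of _ "[]"]) (simp add: reduced_word_def)
next
  case (Cons k w)
  then have "set w \<subseteq> B \<times> UNIV" by simp
  from Cons.IH[OF this] obtain v where v: "set v \<subseteq> B \<times> UNIV" "reduced_word v" "word_value G v = word_value G w"
    "word_value H (map (apfst f) v) = word_value H (map (apfst f) w)"
    by blast
  have k: "fst k \<in> B" using Cons.prems by auto
  show ?case
  proof (cases "reduced_word (k # v)")
    case True
    then show ?thesis using v k by (intro exI[of _ "k # v"]) (auto simp: mem_Times_iff)
  next
    case False
    then obtain l u where lu: "v = l # u" "fst k = fst l" "snd k \<noteq> snd l"
      using v(2) by (cases v) (auto simp: reduced_word_def)
    have u: "set u \<subseteq> B \<times> UNIV" "reduced_word u"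
      using v lu by (cases u; auto simp: reduced_word_def)+
    have "word_value G u \<in> carrier G"
      using u B by (intro word_value_closed G) auto
    then have 1: "word_value G (k # v) = word_value G u"
      using letter_value_cancel[OF G _ lu(2,3)] k B lu(1) by auto
    have "word_value H (map (apfst f) u) \<in> carrier H"
      using u f by (intro word_value_closed H) (auto simp: image_subset_iff dest!: subsetD)
    then have 2: "word_value H (map (apfst f) (k # v)) = word_value H (map (apfst f) u)"
      using letter_value_cancel[OF H, of "apfst f k" "apfst f l"] k f lu by auto
    show ?thesis
      using u 1 2 v(3,4) by (intro exI[of _ u]) auto
  qed
qed

lemma free_basis_extends:
  assumes G: "group G" and BB: "free_basis G B" and H: "group H" and f: "f ` B \<subseteq> carrier H"
  shows "\<exists>h \<in> hom G H. \<forall>x \<in> B. h x = f x"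
proof -
  interpret G: group G by fact
  interpret H: group H by fact
  define R where "R = {w. set w \<subseteq> B \<times> (UNIV::bool set) \<and> reduced_word w}"
  have B: "B \<subseteq> carrier G" and bij: "bij_betw (word_value G) R (carrier G)"
    using BB by (auto simp: free_basis_def R_def)
  define val where "val w = word_value H (map (apfst f) w)" for w :: "('a \<times> bool) list"
  define h where "h g = val (the_inv_into R (word_value G) g)" for g
  have val_closed: "val w \<in> carrier H" if "set w \<subseteq> B \<times> UNIV" for w
    unfolding val_def using that f by (intro word_value_closed H) (auto simp: image_subset_iff dest!: subsetD)
  have h: "h (word_value G w) = val w" if w: "set w \<subseteq> B \<times> UNIV" for w
  proof -
    obtain v where v: "v \<in> R" "word_value G v = word_value G w" "val v = val w"
      using word_reduce[OF G H B f w] by (auto simp: R_def val_def)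
    then have "the_inv_into R (word_value G) (word_value G w) = v"
      using bij by (metis bij_betw_def the_inv_into_f_f)
    then show ?thesis by (simp add: h_def v)
  qed
  have ex: "\<exists>w. set w \<subseteq> B \<times> UNIV \<and> word_value G w = g" if "g \<in> carrier G" for g
  proof -
    have "g \<in> word_value G ` R" using that bij by (simp add: bij_betw_def)
    then show ?thesis by (auto simp: R_def)
  qed
  have "h \<in> hom G H"
  proof (rule homI)
    fix x assume "x \<in> carrier G"
    then show "h x \<in> carrier H" using ex h val_closed by metis
  next
    fix x y assume "x \<in> carrier G" "y \<in> carrier G"
    then obtain u v where u: "set u \<subseteq> B \<times> UNIV" "word_value G u = x"
      and v: "set v \<subseteq> B \<times> UNIV" "word_value G v = y"
      using ex by metis
    have "word_value G (u @ v) = x \<otimes>\<^bsub>G\<^esub> y"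
      using word_value_append[OF G, of u v] u v B by blast
    moreover have "val (u @ v) = val u \<otimes>\<^bsub>H\<^esub> val v"
      unfolding val_def map_append using u v f by (intro word_value_append H) (auto simp: image_subset_iff dest!: subsetD)
    moreover have "h (word_value G (u @ v)) = val (u @ v)"
      using u v by (intro h) auto
    ultimately show "h (x \<otimes>\<^bsub>G\<^esub> y) = h x \<otimes>\<^bsub>H\<^esub> h y"
      using h u v by metis
  qed
  moreover have "h x = f x" if "x \<in> B" for x
    using h[of "[(x, True)]"] that B f by (auto simp: val_def letter_value_def subset_iff)
  ultimately show ?thesis by blast
qed

end

theory Submission
  imports Defs "HOL-Computational_Algebra.Polynomial"
begin

text \<open>Call \<open>f : G \<rightarrow> \<rat>\<close> polynomial if it is annihilated by all products of \<open>k\<close> left difference operators,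
  for some \<open>k\<close>.  Left translation acts on the functions of degree \<open>< k\<close> through a torsion-free
  nilpotent group, so it suffices to find polynomial functions on \<open>G\<close> that separate a given element
  from \<open>1\<close>.  For elements outside \<open>N\<close> the projection to \<open>G / N\<close> does this.

  Let \<open>t\<close> be a lift of a generator of \<open>G / N\<close>; functions on \<open>N\<close> are identified with functions on
  \<open>G\<close> that are invariant under right multiplication by \<open>t\<close>.  By hypothesis the homomorphisms
  \<open>e : N \<rightarrow> \<rat>\<close> that are polynomial on \<open>G\<close> separate the points of \<open>N / \<gamma>\<^sub>2(N)\<close>.  Since \<open>G\<close> is finitely generated, the \<open>t\<close>-fixed part of \<open>N\<^sup>a\<^sup>b \<otimes> \<rat>\<close> is
  finite-dimensional, hence every functional on it is induced by such an \<open>e\<close>, and every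
  homomorphism \<open>r : N \<rightarrow> \<rat>\<close> has the form \<open>(t - 1) h + e\<close>.  Together with the freeness of \<open>N\<close> this
  makes \<open>\<partial> h = c\<close> solvable with polynomial \<open>h\<close> for polynomial 2-cocycles \<open>c\<close> on which \<open>t\<close> is
  unipotent, which gives iterated integrals \<open>\<integral> a\<^sub>1 \<dots> a\<^sub>n\<close> of polynomial homomorphisms.
  On the subgroup generated by finitely many basis elements these span all polynomial functions,
  and polynomial functions separate the points of a free group by Magnus' argument.\<close>

text \<open>The obstacle is that \<open>N\<close> may have infinite rank and that \<open>t\<close>
  need not act unipotently on its rational abelianization. A homomorphism
  \<open>N \<rightarrow> \<rat>\<close> is polynomial on \<open>G\<close> exactly when some power of
  \<open>t - 1\<close> kills it, so a Magnus coefficient, although polynomial on \<open>N\<close>,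
  is in general not the restriction of a polynomial function on \<open>G\<close>. Only its
  restriction to a finitely generated subgroup of \<open>N\<close> is extended to \<open>G\<close>.
  The form \<open>(t - 1) h + e\<close> is duality: if \<open>r - e\<close> vanishes on the kernel
  of \<open>t - 1\<close>, it factors through the image of \<open>t - 1\<close>, and the factor
  extends to a functional \<open>h\<close> because \<open>\<rat>\<close> is divisible. It is needed
  because freeness only yields some cochain with a prescribed coboundary, unique up to a
  homomorphism; its \<open>t\<close>-difference is off by a homomorphism \<open>r\<close>, and
  subtracting \<open>h\<close> from the cochain leaves only the polynomial part \<open>e\<close>.
  Everything is done with functions, on the dual side, so that neither the group algebra nor a
  tensor product with \<open>\<rat>\<close> is formed.\<close>

primrec polynomial_fun :: "('a, 'b) monoid_scheme \<Rightarrow> nat \<Rightarrow> ('a \<Rightarrow> rat) \<Rightarrow> bool" where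
  "polynomial_fun G 0 f \<longleftrightarrow> (\<forall>x \<in> carrier G. f x = 0)"
| "polynomial_fun G (Suc k) f \<longleftrightarrow>
     (\<forall>g \<in> carrier G. polynomial_fun G k (\<lambda>x. f (g \<otimes>\<^bsub>G\<^esub> x) - f x))"

section \<open>Closure properties of polynomial functions\<close>

context group
begin

lemma inv_cancel:
  assumes "x \<in> carrier G" "y \<in> carrier G"
  shows "inv x \<otimes> (x \<otimes> y) = y" "x \<otimes> (inv x \<otimes> y) = y"
  using assms by (simp_all add: m_assoc[symmetric])

lemma polynomial_fun_cong:
  assumes "polynomial_fun G k f" "\<And>x. x \<in> carrier G \<Longrightarrow> f x = f' x"
  shows "polynomial_fun G k f'"
  using assms
proof (induction k arbitrary: f f')
  case (Suc k)
  show ?case unfolding polynomial_fun.simps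
  proof
    fix g assume g: "g \<in> carrier G"
    show "polynomial_fun G k (\<lambda>x. f' (g \<otimes> x) - f' x)"
      by (rule Suc.IH[of "\<lambda>x. f (g \<otimes> x) - f x"]) (use Suc.prems g in auto)
  qed
qed auto

lemma polynomial_fun_lincomb:
  assumes "polynomial_fun G k f" "polynomial_fun G k f'"
  shows "polynomial_fun G k (\<lambda>x. a * f x + b * f' x)"
  using assms
proof (induction k arbitrary: f f')
  case (Suc k)
  show ?case unfolding polynomial_fun.simps
  proof
    fix g assume g: "g \<in> carrier G"
    show "polynomial_fun G k (\<lambda>x. a * f (g \<otimes> x) + b * f' (g \<otimes> x) - (a * f x + b * f' x))"
      by (rule polynomial_fun_cong[OF Suc.IH[of "\<lambda>x. f (g \<otimes> x) - f x" "\<lambda>x. f' (g \<otimes> x) - f' x"]])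
        (use Suc.prems g in \<open>auto simp: algebra_simps\<close>)
  qed
qed auto

lemma polynomial_fun_zero: "polynomial_fun G k (\<lambda>x. 0)"
  by (induction k) auto

lemma polynomial_fun_add:
  "polynomial_fun G k f \<Longrightarrow> polynomial_fun G k f' \<Longrightarrow> polynomial_fun G k (\<lambda>x. f x + f' x)"
  using polynomial_fun_lincomb[of k f f' 1 1] by simp

lemma polynomial_fun_diff:
  "polynomial_fun G k f \<Longrightarrow> polynomial_fun G k f' \<Longrightarrow> polynomial_fun G k (\<lambda>x. f x - f' x)"
  using polynomial_fun_lincomb[of k f f' 1 "-1"] by simp

lemma polynomial_fun_scale: "polynomial_fun G k f \<Longrightarrow> polynomial_fun G k (\<lambda>x. a * f x)"
  using polynomial_fun_lincomb[of k f f a 0] by simp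

lemma polynomial_fun_uminus: "polynomial_fun G k f \<Longrightarrow> polynomial_fun G k (\<lambda>x. - f x)"
  using polynomial_fun_scale[of k f "-1"] by simp

lemma polynomial_fun_sum:
  "(\<And>i. i \<in> I \<Longrightarrow> polynomial_fun G k (f i)) \<Longrightarrow> polynomial_fun G k (\<lambda>x. \<Sum>i\<in>I. f i x)"
  by (induction I rule: infinite_finite_induct) (auto intro: polynomial_fun_zero polynomial_fun_add)

lemma polynomial_fun_Suc: "polynomial_fun G k f \<Longrightarrow> polynomial_fun G (Suc k) f"
proof (induction k arbitrary: f)
  case (Suc k)
  then show ?case by (auto simp only: polynomial_fun.simps(2)[of G "Suc k"] polynomial_fun.simps(2)[of G k])
qed simp

lemma polynomial_fun_mono: "polynomial_fun G k f \<Longrightarrow> k \<le> l \<Longrightarrow> polynomial_fun G l f"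
  by (induction l) (auto simp: le_Suc_eq simp del: polynomial_fun.simps intro: polynomial_fun_Suc)

lemma polynomial_fun_const: "polynomial_fun G (Suc k) (\<lambda>x. a)"
  using polynomial_fun_zero by simp

text \<open>Differencing a translate is translating a difference, with the direction conjugated:
  \<open>h \<otimes> g = (h \<otimes> g \<otimes> inv h) \<otimes> h\<close>.\<close>

lemma polynomial_fun_translate:
  assumes "polynomial_fun G k f" "h \<in> carrier G"
  shows "polynomial_fun G k (\<lambda>x. f (h \<otimes> x))"
  using assms
proof (induction k arbitrary: f)
  case (Suc k)
  show ?case unfolding polynomial_fun.simps
  proof
    fix g assume g: "g \<in> carrier G"
    have "polynomial_fun G k (\<lambda>x. f ((h \<otimes> g \<otimes> inv h) \<otimes> x) - f x)"
      using Suc.prems g by auto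
    from Suc.IH[OF this \<open>h \<in> carrier G\<close>]
    show "polynomial_fun G k (\<lambda>x. f (h \<otimes> (g \<otimes> x)) - f (h \<otimes> x))"
      by (rule polynomial_fun_cong) (use Suc.prems g in \<open>simp add: m_assoc inv_cancel\<close>)
  qed
qed auto

text \<open>The difference along a product is the difference along \<open>h2\<close> plus a
  translate of the one along \<open>h1\<close>, so degrees can be checked on generators.\<close>

lemma polynomial_fun_generate:
  assumes S: "S \<subseteq> carrier G" and g: "g \<in> generate G S"
    and f: "\<And>g. g \<in> S \<Longrightarrow> polynomial_fun G k (\<lambda>x. f (g \<otimes> x) - f x)"
  shows "polynomial_fun G k (\<lambda>x. f (g \<otimes> x) - f x)"
  using g
proof induction
  case one
  show ?case by (rule polynomial_fun_cong[OF polynomial_fun_zero]) auto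
next
  case (incl h)
  then show ?case by (rule f)
next
  case (inv h)
  then have h: "h \<in> carrier G" using S by auto
  have "polynomial_fun G k (\<lambda>x. - (f (h \<otimes> (inv h \<otimes> x)) - f (inv h \<otimes> x)))"
    using polynomial_fun_uminus[OF polynomial_fun_translate[OF f[OF inv], of "inv h"]] h by simp
  then show ?case
    by (rule polynomial_fun_cong) (use h in \<open>simp add: inv_cancel\<close>)
next
  case (eng h1 h2)
  then have h: "h1 \<in> carrier G" "h2 \<in> carrier G" using generate_incl[OF S] by auto
  have "polynomial_fun G k (\<lambda>x. (f (h1 \<otimes> (h2 \<otimes> x)) - f (h2 \<otimes> x)) + (f (h2 \<otimes> x) - f x))"
    using polynomial_fun_add[OF polynomial_fun_translate[OF eng.IH(1) h(2)] eng.IH(2)] .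
  then show ?case
    by (rule polynomial_fun_cong) (use h in \<open>simp add: m_assoc\<close>)
qed

lemma polynomial_fun_SucI:
  assumes "S \<subseteq> carrier G" "generate G S = carrier G"
    and "\<And>g. g \<in> S \<Longrightarrow> polynomial_fun G k (\<lambda>x. f (g \<otimes> x) - f x)"
  shows "polynomial_fun G (Suc k) f"
  using polynomial_fun_generate[of S _ k f] assms by simp

lemma polynomial_fun_subgroup:
  assumes "polynomial_fun G k f" "H \<subseteq> carrier G"
  shows "polynomial_fun (G\<lparr>carrier := H\<rparr>) k f"
  using assms by (induction k arbitrary: f) auto

lemma polynomial_fun_1: "polynomial_fun G (Suc 0) f \<Longrightarrow> x \<in> carrier G \<Longrightarrow> f x = f \<one>"
  by (drule polynomial_fun.simps(2)[THEN iffD1, rule_format, of _ _ _ x]) (auto dest!: bspec[of _ _ \<one>])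

subsection \<open>Polynomial functions and residual nilpotence\<close>

text \<open>A descending filtration against which the lower central series is compared: translation
  by an element of level \<open>j\<close> is the identity up to a drop of \<open>j\<close> in
  degree. Demanding the drop in all degrees at once lets two such drops be composed.\<close>

definition lowering :: "nat \<Rightarrow> 'a set" where
  "lowering j = {g \<in> carrier G. \<forall>i f. polynomial_fun G (i + j) f \<longrightarrow>
     polynomial_fun G i (\<lambda>x. f (g \<otimes> x) - f x)}"

lemma lowering_generate: "generate G (lowering j) \<subseteq> lowering j"
proof
  fix g assume g: "g \<in> generate G (lowering j)"
  have S: "lowering j \<subseteq> carrier G" by (auto simp: lowering_def)
  show "g \<in> lowering j"
    using polynomial_fun_generate[OF S g] generate_incl[OF S] g
    unfolding lowering_def by blast
qed

text \<open>In the group ring, the commutator minus \<open>1\<close> is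
  \<open>inv (h \<otimes> g)\<close> times \<open>(g - 1)(h - 1) - (h - 1)(g - 1)\<close>, and both
  products lower the degree by \<open>j + 1\<close>. The leading factor is absorbed into
  \<open>f'\<close>.\<close>

lemma lowering_commutator:
  assumes g: "g \<in> lowering j" and h: "h \<in> carrier G"
  shows "inv g \<otimes> inv h \<otimes> g \<otimes> h \<in> lowering (Suc j)"
proof -
  have gc: "g \<in> carrier G" using g by (simp add: lowering_def)
  let ?u = "inv (h \<otimes> g)"
  have "polynomial_fun G i (\<lambda>x. f (inv g \<otimes> inv h \<otimes> g \<otimes> h \<otimes> x) - f x)"
    if "polynomial_fun G (i + Suc j) f" for i f
  proof -
    define f' where "f' x = f (?u \<otimes> x)" for x
    have f': "polynomial_fun G (i + Suc j) f'"
      unfolding f'_def using that gc h by (intro polynomial_fun_translate) auto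
    then have "polynomial_fun G (Suc (i + j)) f'" by simp
    then have 1: "polynomial_fun G (i + j) (\<lambda>x. f' (h \<otimes> x) - f' x)" using h by simp
    have "polynomial_fun G (Suc i + j) f'" using f' by simp
    then have "polynomial_fun G (Suc i) (\<lambda>x. f' (g \<otimes> x) - f' x)"
      using g unfolding lowering_def by blast
    then have "polynomial_fun G i (\<lambda>x. (f' (g \<otimes> (h \<otimes> x)) - f' (h \<otimes> x)) - (f' (g \<otimes> x) - f' x))"
      using h by simp
    moreover have "polynomial_fun G i (\<lambda>x. (f' (h \<otimes> (g \<otimes> x)) - f' (g \<otimes> x)) - (f' (h \<otimes> x) - f' x))"
      using 1 g unfolding lowering_def by blast
    ultimately have "polynomial_fun G i (\<lambda>x. ((f' (g \<otimes> (h \<otimes> x)) - f' (h \<otimes> x)) - (f' (g \<otimes> x) - f' x))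
       - ((f' (h \<otimes> (g \<otimes> x)) - f' (g \<otimes> x)) - (f' (h \<otimes> x) - f' x)))"
      by (rule polynomial_fun_diff)
    then show ?thesis
    proof (rule polynomial_fun_cong)
      fix x assume x: "x \<in> carrier G"
      have e1: "f' (g \<otimes> (h \<otimes> x)) = f (inv g \<otimes> inv h \<otimes> g \<otimes> h \<otimes> x)"
        using gc h x by (simp add: f'_def m_assoc inv_mult_group)
      have e2: "f' (h \<otimes> (g \<otimes> x)) = f x"
        using gc h x by (simp add: f'_def m_assoc inv_mult_group inv_cancel)
      show "((f' (g \<otimes> (h \<otimes> x)) - f' (h \<otimes> x)) - (f' (g \<otimes> x) - f' x))
       - ((f' (h \<otimes> (g \<otimes> x)) - f' (g \<otimes> x)) - (f' (h \<otimes> x) - f' x)) =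
        f (inv g \<otimes> inv h \<otimes> g \<otimes> h \<otimes> x) - f x"
        unfolding e1 e2 by simp
    qed
  qed
  then show ?thesis using gc h by (simp add: lowering_def)
qed

text \<open>Extended linearly to the group algebra, the functions of degree \<open>< k\<close> are
  those that vanish on the \<open>k\<close>-th power of the augmentation ideal, so this is the
  \<open>k\<close>-th dimension subgroup over \<open>\<rat>\<close>.\<close>

definition poly_kernel :: "nat \<Rightarrow> 'a set" where
  "poly_kernel k = {g \<in> carrier G. \<forall>f. polynomial_fun G k f \<longrightarrow> (\<forall>x \<in> carrier G. f (g \<otimes> x) = f x)}"

lemma lowering_subset_kernel: "lowering k \<subseteq> poly_kernel k"
proof
  fix g assume "g \<in> lowering k"
  then have g: "g \<in> carrier G" and *: "\<And>i f. polynomial_fun G (i + k) f \<Longrightarrow>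
     polynomial_fun G i (\<lambda>x. f (g \<otimes> x) - f x)" by (auto simp: lowering_def)
  show "g \<in> poly_kernel k"
    using *[of 0] g by (auto simp: poly_kernel_def)
qed

lemma poly_kernel_normal: "poly_kernel k \<lhd> G"
proof (rule normal_invI)
  show "subgroup (poly_kernel k) G"
  proof (rule subgroupI)
    show "poly_kernel k \<subseteq> carrier G" by (auto simp: poly_kernel_def)
    show "poly_kernel k \<noteq> {}" by (auto simp: poly_kernel_def intro!: exI[of _ \<one>])
  next
    fix a assume a: "a \<in> poly_kernel k"
    then have ac: "a \<in> carrier G" by (simp add: poly_kernel_def)
    have "f (inv a \<otimes> x) = f x" if "polynomial_fun G k f" "x \<in> carrier G" for f x
    proof -
      have "f (a \<otimes> (inv a \<otimes> x)) = f (inv a \<otimes> x)"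
        using a that ac by (simp add: poly_kernel_def)
      then show ?thesis using ac that by (simp add: inv_cancel)
    qed
    then show "inv a \<in> poly_kernel k" using ac by (simp add: poly_kernel_def)
  next
    fix a b assume "a \<in> poly_kernel k" "b \<in> poly_kernel k"
    then show "a \<otimes> b \<in> poly_kernel k" by (auto simp: poly_kernel_def m_assoc)
  qed
next
  fix h a assume h: "h \<in> carrier G" and a: "a \<in> poly_kernel k"
  then have ac: "a \<in> carrier G" by (simp add: poly_kernel_def)
  have "f (h \<otimes> a \<otimes> inv h \<otimes> x) = f x" if f: "polynomial_fun G k f" and x: "x \<in> carrier G" for f x
  proof -
    have "f (h \<otimes> (a \<otimes> (inv h \<otimes> x))) = f (h \<otimes> (inv h \<otimes> x))"
      using a polynomial_fun_translate[OF f h] h x by (auto simp: poly_kernel_def)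
    then show ?thesis using ac x h by (simp add: m_assoc inv_cancel)
  qed
  then show "h \<otimes> a \<otimes> inv h \<in> poly_kernel k" using ac h by (simp add: poly_kernel_def)
qed

text \<open>Left translations are unipotent on polynomial functions of bounded degree, and over \<open>\<rat>\<close> a
  unipotent operator of finite order is trivial.\<close>

lemma poly_kernel_isolated:
  assumes g: "g \<in> carrier G" and n: "n > 0" and gn: "g [^] (n::nat) \<in> poly_kernel k"
  shows "g \<in> poly_kernel k"
proof -
  have "\<forall>x\<in>carrier G. f (g \<otimes> x) = f x" if "polynomial_fun G i f" "i \<le> k" for i f
    using that
  proof (induction i arbitrary: f)
    case (Suc i)
    \<comment> \<open>By induction, translation by \<open>g\<close> fixes the difference of
      \<open>f\<close> along \<open>g\<close>; hence \<open>f (g [^] m \<otimes> x)\<close> is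
      affine in \<open>m\<close>, and equal values at \<open>0\<close> and \<open>n\<close> force
      the slope to vanish.\<close>
    have *: "f (g \<otimes> (g \<otimes> x)) - f (g \<otimes> x) = f (g \<otimes> x) - f x" if "x \<in> carrier G" for x
      using Suc.IH[of "\<lambda>x. f (g \<otimes> x) - f x"] Suc.prems g that by simp
    have pw: "f (g [^] m \<otimes> x) = f x + of_nat m * (f (g \<otimes> x) - f x)"
      if "x \<in> carrier G" for m :: nat and x
      using that
    proof (induction m arbitrary: x)
      case (Suc m)
      have "f (g [^] Suc m \<otimes> x) = f (g [^] m \<otimes> (g \<otimes> x))"
        using g Suc.prems by (simp add: m_assoc)
      also have "\<dots> = f (g \<otimes> x) + of_nat m * (f (g \<otimes> (g \<otimes> x)) - f (g \<otimes> x))"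
        using Suc g by simp
      finally show ?case using *[OF Suc.prems] by (simp add: algebra_simps)
    qed auto
    have "polynomial_fun G k f" using Suc.prems polynomial_fun_mono by blast
    then have "f (g [^] n \<otimes> x) = f x" if "x \<in> carrier G" for x
      using gn that by (auto simp: poly_kernel_def)
    then show ?case using pw[of _ n] n by simp
  qed (use g in auto)
  then show ?thesis using g by (auto simp: poly_kernel_def)
qed

lemma lower_central_poly_kernel:
  assumes "j > 0"
  shows "lower_central (G Mod poly_kernel k) j \<subseteq> (\<lambda>g. poly_kernel k #> g) ` lowering j"
  using assms
proof (induction j rule: nat_induct_non_zero)
  case 1
  have "lowering 1 = carrier G" by (auto simp: lowering_def)
  then show ?case by (auto simp: carrier_FactGroup)
next
  case (Suc j)
  let ?K = "poly_kernel k"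
  interpret K: normal ?K G by (rule poly_kernel_normal)
  interpret Q: group "G Mod ?K" by (rule K.factorgroup_is_group)
  interpret p: group_hom G "G Mod ?K" "\<lambda>g. ?K #> g"
    by unfold_locales (rule K.r_coset_hom_Mod)
  have "lower_central (G Mod ?K) (Suc j) =
    commutator_subgroup (G Mod ?K) (lower_central (G Mod ?K) j) (carrier (G Mod ?K))"
    using Suc.hyps by (cases j) auto
  also have "\<dots> \<subseteq> generate (G Mod ?K) ((\<lambda>g. ?K #> g) ` lowering (Suc j))"
    unfolding commutator_subgroup_def
  proof (rule Q.mono_generate, safe)
    fix a b assume "a \<in> lower_central (G Mod ?K) j" "b \<in> carrier (G Mod ?K)"
    then obtain g h where g: "g \<in> lowering j" "a = ?K #> g" and h: "h \<in> carrier G" "b = ?K #> h"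
      using Suc.IH by (auto simp: carrier_FactGroup)
    have gc: "g \<in> carrier G" using g by (simp add: lowering_def)
    have "inv\<^bsub>G Mod ?K\<^esub> a \<otimes>\<^bsub>G Mod ?K\<^esub> inv\<^bsub>G Mod ?K\<^esub> b \<otimes>\<^bsub>G Mod ?K\<^esub> a \<otimes>\<^bsub>G Mod ?K\<^esub> b
      = ?K #> (inv g \<otimes> inv h \<otimes> g \<otimes> h)"
      unfolding g(2) h(2) by (simp only: p.hom_mult p.hom_inv gc h(1) inv_closed m_closed)
    then show "inv\<^bsub>G Mod ?K\<^esub> a \<otimes>\<^bsub>G Mod ?K\<^esub> inv\<^bsub>G Mod ?K\<^esub> b \<otimes>\<^bsub>G Mod ?K\<^esub> a \<otimes>\<^bsub>G Mod ?K\<^esub> b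
      \<in> (\<lambda>g. ?K #> g) ` lowering (Suc j)"
      using lowering_commutator[OF g(1) h(1)] by blast
  qed
  also have "\<dots> = (\<lambda>g. ?K #> g) ` generate G (lowering (Suc j))"
    by (rule p.generate_img) (auto simp: lowering_def)
  also have "\<dots> \<subseteq> (\<lambda>g. ?K #> g) ` lowering (Suc j)"
    using lowering_generate by blast
  finally show ?case .
qed

lemma one_in_lower_central: "\<one> \<in> lower_central G j"
proof (cases "(G, j)" rule: lower_central.cases)
  case (3 G' n)
  then show ?thesis by (auto simp: commutator_subgroup_def intro: generate.one)
qed auto

lemma residually_torsion_free_nilpotentI:
  assumes "\<And>g. g \<in> carrier G \<Longrightarrow> g \<noteq> \<one> \<Longrightarrow> \<exists>k f. polynomial_fun G k f \<and> f g \<noteq> f \<one>"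
  shows "residually_torsion_free_nilpotent G"
  unfolding residually_torsion_free_nilpotent_def residually_def
proof (intro ballI impI)
  fix g assume g: "g \<in> carrier G" "g \<noteq> \<one>"
  obtain k f where f: "polynomial_fun G k f" "f g \<noteq> f \<one>" using assms[OF g] by blast
  \<comment> \<open>\<open>nilpotent_group\<close> speaks of the term with index
    \<open>c + 1\<close>; the kernel at level \<open>Suc k\<close> fits
    \<open>c = k\<close>.\<close>
  let ?K = "poly_kernel (Suc k)"
  interpret K: normal ?K G by (rule poly_kernel_normal)
  have "g \<notin> ?K"
  proof
    assume "g \<in> ?K"
    then have "f (g \<otimes> \<one>) = f \<one>"
      using polynomial_fun_Suc[OF f(1)] unfolding poly_kernel_def by blast
    then show False using f(2) g by simp
  qed
  moreover have "torsion_free_group (G Mod ?K)"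
    unfolding torsion_free_group_def one_FactGroup
  proof (intro ballI allI impI)
    fix C and n :: nat assume C: "C \<in> carrier (G Mod ?K)" "n > 0" "C [^]\<^bsub>G Mod ?K\<^esub> n = ?K"
    obtain x where x: "x \<in> carrier G" "C = ?K #> x" using C(1) by (auto simp: carrier_FactGroup)
    then have "?K #> (x [^] n) = ?K" using C(3) by (simp add: K.FactGroup_pow)
    then have "x [^] n \<in> ?K" using x rcos_self[of "x [^] n" ?K] K.subgroup_axioms by auto
    then have "x \<in> ?K" using poly_kernel_isolated x C(2) by blast
    then show "C = ?K" using x K.rcos_const by blast
  qed
  moreover have "nilpotent_group (G Mod ?K)"
    unfolding nilpotent_group_def
  proof (intro exI[of _ k] equalityI subsetI)
    fix C assume "C \<in> lower_central (G Mod ?K) (k + 1)"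
    then obtain x where "x \<in> lowering (Suc k)" "C = ?K #> x"
      using lower_central_poly_kernel[of "k + 1" "Suc k"] by auto
    then have "C = ?K" using lowering_subset_kernel K.rcos_const by blast
    then show "C \<in> {\<one>\<^bsub>G Mod ?K\<^esub>}" by simp
  next
    fix C assume "C \<in> {\<one>\<^bsub>G Mod ?K\<^esub>}"
    then show "C \<in> lower_central (G Mod ?K) (k + 1)"
      using group.one_in_lower_central[OF K.factorgroup_is_group] by blast
  qed
  ultimately show "\<exists>K. K \<lhd> G \<and> g \<notin> K \<and> torsion_free_group (G Mod K) \<and> nilpotent_group (G Mod K)"
    using poly_kernel_normal by blast
qed

end

section \<open>Linear algebra\<close>

text \<open>Fraction-free Gaussian elimination: \<open>p'\<close> clears column \<open>l\<close> by
  cross-multiplication with the pivot \<open>p i0 l\<close>, and \<open>q' i0\<close> balances the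
  pivot row.\<close>

lemma idom_dependent_vectors:
  fixes p :: "'i \<Rightarrow> 'l \<Rightarrow> 'r :: idom"
  assumes "finite S" "finite I" "card S < card I"
  shows "\<exists>q. (\<exists>i \<in> I. q i \<noteq> 0) \<and> (\<forall>l \<in> S. (\<Sum>i\<in>I. q i * p i l) = 0)"
  using assms
proof (induction S arbitrary: I p rule: finite_induct)
  case empty
  then obtain i where "i \<in> I" by fastforce
  then show ?case by (intro exI[of _ "\<lambda>_. 1"]) auto
next
  case (insert l S)
  show ?case
  proof (cases "\<forall>i\<in>I. p i l = 0")
    case True
    then show ?thesis using insert.IH[OF insert.prems(1), of p] insert.prems insert.hyps by auto
  next
    case False
    then obtain i0 where i0: "i0 \<in> I" "p i0 l \<noteq> 0" by blast
    define p' where "p' i m = p i0 l * p i m - p i l * p i0 m" for i m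
    have "card S < card (I - {i0})" using insert i0 by simp
    from insert.IH[OF _ this, of p'] insert.prems(1) obtain q where
      q: "\<exists>i\<in>I - {i0}. q i \<noteq> 0" "\<And>m. m \<in> S \<Longrightarrow> (\<Sum>i\<in>I-{i0}. q i * p' i m) = 0" by auto
    define q' where "q' i = (if i = i0 then - (\<Sum>i\<in>I-{i0}. q i * p i l) else p i0 l * q i)" for i
    have *: "(\<Sum>i\<in>I. q' i * p i m) = (\<Sum>i\<in>I-{i0}. q i * p' i m)" for m
    proof -
      have "(\<Sum>i\<in>I. q' i * p i m) = q' i0 * p i0 m + (\<Sum>i\<in>I-{i0}. q' i * p i m)"
        using insert.prems(1) i0(1) by (simp add: sum.remove)
      also have "(\<Sum>i\<in>I-{i0}. q' i * p i m) = (\<Sum>i\<in>I-{i0}. p i0 l * q i * p i m)"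
        by (intro sum.cong) (auto simp: q'_def)
      also have "q' i0 * p i0 m = (\<Sum>i\<in>I-{i0}. - (q i * p i l * p i0 m))"
        by (simp add: q'_def sum_distrib_right sum_negf)
      finally show ?thesis
        by (simp add: p'_def algebra_simps flip: sum.distrib sum_subtractf)
    qed
    have "(\<Sum>i\<in>I-{i0}. q i * p' i l) = 0" by (intro sum.neutral) (simp add: p'_def mult.commute)
    then have "\<forall>m\<in>insert l S. (\<Sum>i\<in>I. q' i * p i m) = 0" using * q(2) by auto
    moreover have "\<exists>i\<in>I. q' i \<noteq> 0" using q(1) i0 by (auto simp: q'_def)
    ultimately show ?thesis by blast
  qed
qed

text \<open>In a nontrivial relation of least total degree the coefficients cannot all vanish at
  \<open>1\<close>, since the factor \<open>[:-1, 1:]\<close> could be cancelled. Evaluation at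
  \<open>1\<close> is later the action on fixed elements, where \<open>t\<close> becomes
  \<open>1\<close>.\<close>

lemma poly_dependent_vectors:
  fixes p :: "'i \<Rightarrow> 'l \<Rightarrow> 'r :: field poly"
  assumes "finite S" "finite I" "card S < card I"
  shows "\<exists>q. (\<exists>i \<in> I. poly (q i) 1 \<noteq> 0) \<and> (\<forall>l \<in> S. (\<Sum>i\<in>I. q i * p i l) = 0)"
proof -
  define P where "P q \<longleftrightarrow> (\<exists>i\<in>I. q i \<noteq> 0) \<and> (\<forall>l \<in> S. (\<Sum>i\<in>I. q i * p i l) = 0)" for q :: "'i \<Rightarrow> 'r poly"
  have "\<exists>q. P q" unfolding P_def by (rule idom_dependent_vectors[OF assms])
  then obtain q where q: "P q" and min: "\<And>q'. P q' \<Longrightarrow> (\<Sum>i\<in>I. degree (q i)) \<le> (\<Sum>i\<in>I. degree (q' i))"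
    using ex_has_least_nat[of P _ "\<lambda>q. \<Sum>i\<in>I. degree (q i)"] by blast
  have "\<exists>i\<in>I. poly (q i) 1 \<noteq> 0"
  proof (rule ccontr)
    assume "\<not> (\<exists>i\<in>I. poly (q i) 1 \<noteq> 0)"
    then have "\<forall>i\<in>I. \<exists>r. q i = [:-1, 1:] * r" by (auto simp: poly_eq_0_iff_dvd dvd_def)
    then obtain r where r: "\<And>i. i \<in> I \<Longrightarrow> q i = [:-1, 1:] * r i" by metis
    have "P r"
      unfolding P_def
    proof (intro conjI ballI)
      show "\<exists>i\<in>I. r i \<noteq> 0" using q r unfolding P_def by (metis mult_zero_right)
      fix l assume "l \<in> S"
      then have "0 = (\<Sum>i\<in>I. q i * p i l)" using q by (simp add: P_def)
      also have "\<dots> = [:-1, 1:] * (\<Sum>i\<in>I. r i * p i l)"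
        unfolding sum_distrib_left by (intro sum.cong refl) (simp only: r mult.assoc)
      finally show "(\<Sum>i\<in>I. r i * p i l) = 0" by (metis mult_eq_0_iff pCons_eq_0_iff zero_neq_one)
    qed
    have deg: "degree (q i) = (if r i = 0 then 0 else Suc (degree (r i)))" if "i \<in> I" for i
      using that by (simp add: r degree_mult_eq del: mult_pCons_left)
    obtain i where i: "i \<in> I" "r i \<noteq> 0" using \<open>P r\<close> by (auto simp: P_def)
    have "(\<Sum>i\<in>I. degree (r i)) < (\<Sum>i\<in>I. degree (q i))"
      using i deg by (intro sum_strict_mono_ex1 assms(2)) auto
    then show False using min[OF \<open>P r\<close>] by simp
  qed
  then show ?thesis using q by (auto simp: P_def)
qed

text \<open>A new index \<open>k\<close> calls for some \<open>b \<in> E\<close> that vanishes on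
  \<open>I\<close> but not at \<open>k\<close>; without one, evaluation at \<open>k\<close> would be
  the combination of the evaluations on \<open>I\<close> with coefficients \<open>d i k\<close>,
  against independence.\<close>

lemma dual_family:
  fixes E :: "('x \<Rightarrow> 'k :: field) set"
  assumes I: "finite I" and zero: "(\<lambda>x. 0) \<in> E"
    and lin: "\<And>a b p q. a \<in> E \<Longrightarrow> b \<in> E \<Longrightarrow> (\<lambda>x. p * a x + q * b x) \<in> E"
    and indep: "\<And>v. (\<And>e. e \<in> E \<Longrightarrow> (\<Sum>i\<in>I. v i * e i) = 0) \<Longrightarrow> \<forall>i\<in>I. v i = 0"
  shows "\<exists>d. \<forall>i\<in>I. d i \<in> E \<and> (\<forall>j\<in>I. d i j = (if i = j then 1 else 0))"
  using I indep
proof (induction I rule: finite_induct)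
  case (insert k I)
  have sum_E: "(\<lambda>x. \<Sum>i\<in>J. p i * d i x) \<in> E" if "\<And>i. i \<in> J \<Longrightarrow> d i \<in> E" for J and d :: "'x \<Rightarrow> _" and p
    using that
  proof (induction J rule: infinite_finite_induct)
    case (insert j J)
    then show ?case using lin[of "d j" "\<lambda>x. \<Sum>i\<in>J. p i * d i x" "p j" 1] by auto
  qed (use zero in auto)
  have "\<forall>i\<in>I. v i = 0" if "\<And>e. e \<in> E \<Longrightarrow> (\<Sum>i\<in>I. v i * e i) = 0" for v
  proof -
    have "(\<Sum>i\<in>insert k I. (v(k := 0)) i * e i) = 0" if "e \<in> E" for e
    proof -
      have "(\<Sum>i\<in>I. (v(k := 0)) i * e i) = (\<Sum>i\<in>I. v i * e i)"
        using insert.hyps by (intro sum.cong) auto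
      then show ?thesis using \<open>\<And>e. e \<in> E \<Longrightarrow> (\<Sum>i\<in>I. v i * e i) = 0\<close>[OF that] insert.hyps by simp
    qed
    from insert.prems[OF this] show ?thesis using insert.hyps by (metis fun_upd_apply insertCI)
  qed
  from insert.IH[OF this] obtain d where
    d: "\<And>i. i \<in> I \<Longrightarrow> d i \<in> E" "\<And>i j. i \<in> I \<Longrightarrow> j \<in> I \<Longrightarrow> d i j = (if i = j then 1 else 0)" by metis
  have "\<exists>a\<in>E. a k \<noteq> (\<Sum>i\<in>I. d i k * a i)"
  proof (rule ccontr)
    assume *: "\<not> (\<exists>a\<in>E. a k \<noteq> (\<Sum>i\<in>I. d i k * a i))"
    define v where "v i = (if i = k then 1 else - d i k)" for i
    have "(\<Sum>i\<in>insert k I. v i * e i) = 0" if "e \<in> E" for e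
    proof -
      have "(\<Sum>i\<in>I. v i * e i) = (\<Sum>i\<in>I. - (d i k * e i))"
        using insert.hyps by (intro sum.cong) (auto simp: v_def)
      then show ?thesis using * that insert.hyps by (simp add: v_def sum_negf)
    qed
    from insert.prems[OF this] show False by (auto simp: v_def)
  qed
  then obtain a where a: "a \<in> E" "a k \<noteq> (\<Sum>i\<in>I. d i k * a i)" by blast
  define b where "b x = 1 * a x + (-1) * (\<Sum>i\<in>I. a i * d i x)" for x
  have bE: "b \<in> E" unfolding b_def using lin[OF a(1) sum_E[of I d a]] d(1) by blast
  have bI: "b j = 0" if "j \<in> I" for j
  proof -
    have "(\<Sum>i\<in>I. a i * d i j) = (\<Sum>i\<in>I. if i = j then a i else 0)"
      using d(2) that by (intro sum.cong) auto
    then show ?thesis using insert.hyps that by (simp add: b_def)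
  qed
  have bk: "b k \<noteq> 0" using a(2) by (simp add: b_def mult.commute)
  define d' where "d' i = (if i = k then (\<lambda>x. (1 / b k) * b x + 0 * b x) else (\<lambda>x. 1 * d i x + (- (d i k / b k)) * b x))" for i
  have "d' i \<in> E \<and> (\<forall>j\<in>insert k I. d' i j = (if i = j then 1 else 0))" if "i \<in> insert k I" for i
  proof
    show "d' i \<in> E"
    proof (cases "i = k")
      case True
      then show ?thesis using lin[OF bE bE, of "1 / b k" 0] unfolding d'_def by simp
    next
      case False
      then show ?thesis using that lin[OF d(1) bE, of i 1 "- (d i k / b k)"] unfolding d'_def by simp
    qed
    show "\<forall>j\<in>insert k I. d' i j = (if i = j then 1 else 0)"
      using that insert.hyps bk bI d(2) unfolding d'_def by auto
  qed
  then show ?case by blast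
qed auto

section \<open>Rational homomorphisms\<close>

definition rat_hom :: "('a, 'b) monoid_scheme \<Rightarrow> ('a \<Rightarrow> rat) \<Rightarrow> bool" where
  "rat_hom G f \<longleftrightarrow> (\<forall>x \<in> carrier G. \<forall>y \<in> carrier G. f (x \<otimes>\<^bsub>G\<^esub> y) = f x + f y)"

context group
begin

lemma rat_hom_one: "rat_hom G f \<Longrightarrow> f \<one> = 0"
  by (auto simp: rat_hom_def dest!: bspec[of _ _ \<one>])

lemma rat_hom_inv: "rat_hom G f \<Longrightarrow> x \<in> carrier G \<Longrightarrow> f (inv x) = - f x"
  using rat_hom_one[of f] unfolding rat_hom_def by (metis add_eq_0_iff inv_closed r_inv)

lemma rat_hom_pow: "rat_hom G f \<Longrightarrow> x \<in> carrier G \<Longrightarrow> f (x [^] (n::nat)) = of_nat n * f x"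
proof (induction n)
  case (Suc n)
  then show ?case using nat_pow_closed[of x n] by (simp add: rat_hom_def algebra_simps)
qed (simp add: rat_hom_one)

lemma rat_hom_int_pow: "rat_hom G f \<Longrightarrow> x \<in> carrier G \<Longrightarrow> f (x [^] (n::int)) = of_int n * f x"
  by (cases n rule: int_cases2)
    (auto simp: int_pow_int int_pow_neg rat_hom_pow rat_hom_inv)

text \<open>\<open>\<rat>\<close> is divisible.  Partial homomorphisms are represented by their graphs, and a maximal one
  exists by Zorn's lemma.\<close>

lemma rat_hom_extend:
  assumes H: "subgroup H G" and f: "rat_hom (G\<lparr>carrier := H\<rparr>) f"
    and comm: "\<And>x y. x \<in> carrier G \<Longrightarrow> y \<in> carrier G \<Longrightarrow>
      x \<otimes> y \<otimes> inv x \<otimes> inv y \<in> H \<and> f (x \<otimes> y \<otimes> inv x \<otimes> inv y) = 0"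
  shows "\<exists>h. rat_hom G h \<and> (\<forall>x\<in>H. h x = f x)"
proof -
  interpret H: subgroup H G by fact
  interpret HG: group "G\<lparr>carrier := H\<rparr>" using H by (rule subgroup_imp_group)
  define good where "good P \<longleftrightarrow> P \<subseteq> carrier G \<times> UNIV \<and> (\<lambda>x. (x, f x)) ` H \<subseteq> P \<and>
    (\<forall>x p y q. (x, p) \<in> P \<longrightarrow> (y, q) \<in> P \<longrightarrow> (x \<otimes> y, p + q) \<in> P) \<and>
    (\<forall>x p. (x, p) \<in> P \<longrightarrow> (inv x, - p) \<in> P) \<and> (\<forall>q. (\<one>, q) \<in> P \<longrightarrow> q = 0)" for P
  have f_mult: "f (x \<otimes> y) = f x + f y" if "x \<in> H" "y \<in> H" for x y
    using f that by (simp add: rat_hom_def)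
  have f_one: "f \<one> = 0" using HG.rat_hom_one[OF f] by simp
  have f_inv: "f (inv x) = - f x" if "x \<in> H" for x
    using HG.rat_hom_inv[OF f, of x] that H m_inv_consistent by simp
  have "good ((\<lambda>x. (x, f x)) ` H)"
    unfolding good_def using f_one f_inv f_mult by (auto simp: image_iff)
  then have ne: "{P. good P} \<noteq> {}" by blast
  have "\<exists>M\<in>{P. good P}. \<forall>P\<in>{P. good P}. M \<subseteq> P \<longrightarrow> P = M"
  proof (rule subset_Zorn_nonempty[OF ne])
    fix \<C> assume C: "\<C> \<noteq> {}" "subset.chain {P. good P} \<C>"
    then have gd: "\<And>P. P \<in> \<C> \<Longrightarrow> good P" by (auto simp: subset.chain_def)
    have two: "\<exists>P\<in>\<C>. u \<in> P \<and> v \<in> P" if uv: "u \<in> \<Union>\<C>" "v \<in> \<Union>\<C>" for u v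
    proof -
      obtain P Q where PQ: "P \<in> \<C>" "Q \<in> \<C>" "u \<in> P" "v \<in> Q" using uv by blast
      then have "P \<subseteq> Q \<or> Q \<subseteq> P" using C(2) by (auto simp: subset.chain_def)
      then show ?thesis using PQ by blast
    qed
    have "\<Union>\<C> \<subseteq> carrier G \<times> UNIV" using gd unfolding good_def by blast
    moreover have "(\<lambda>x. (x, f x)) ` H \<subseteq> \<Union>\<C>" using gd C(1) unfolding good_def by blast
    moreover have "(x \<otimes> y, p + q) \<in> \<Union>\<C>" if "(x, p) \<in> \<Union>\<C>" "(y, q) \<in> \<Union>\<C>" for x p y q
      using two[OF that] gd unfolding good_def by blast
    moreover have "(inv x, - p) \<in> \<Union>\<C>" if "(x, p) \<in> \<Union>\<C>" for x p
      using that gd unfolding good_def by blast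
    moreover have "q = 0" if "(\<one>, q) \<in> \<Union>\<C>" for q
      using that gd unfolding good_def by blast
    ultimately show "\<Union>\<C> \<in> {P. good P}" by (auto simp: good_def)
  qed
  then obtain M where M: "good M" and max: "\<And>P. good P \<Longrightarrow> M \<subseteq> P \<Longrightarrow> P = M" by blast
  have M_car: "y \<in> carrier G" if "(y, p) \<in> M" for y p using M that by (auto simp: good_def)
  have M_mult: "(x \<otimes> y, p + q) \<in> M" if "(x, p) \<in> M" "(y, q) \<in> M" for x p y q
    using M that by (auto simp: good_def)
  have M_inv: "(inv x, - p) \<in> M" if "(x, p) \<in> M" for x p
    using M that by (auto simp: good_def)
  have M_H: "(x, f x) \<in> M" if "x \<in> H" for x using M that by (auto simp: good_def)
  have M_one: "(\<one>, 0) \<in> M" using M_H[of \<one>] f_one by simp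
  have M_comm: "(x \<otimes> y \<otimes> inv x \<otimes> inv y, 0) \<in> M" if "x \<in> carrier G" "y \<in> carrier G" for x y
    using M_H comm[OF that] by metis
  have M_fun: "p = q" if "(x, p) \<in> M" "(x, q) \<in> M" for x p q
  proof -
    have "(inv x \<otimes> x, - p + q) \<in> M" using that M_mult M_inv by blast
    then have "(\<one>, - p + q) \<in> M" using M_car that(1) by simp
    then have "- p + q = 0" using M unfolding good_def by blast
    then show ?thesis by simp
  qed
  have M_pow: "(x [^] (n::nat), of_nat n * p) \<in> M" if "(x, p) \<in> M" for x p n
  proof (induction n)
    case (Suc n)
    then show ?case using M_mult[OF Suc that] by (simp add: algebra_simps)
  qed (use M_one in simp)
  have M_int_pow: "(x [^] (i::int), of_int i * p) \<in> M" if "(x, p) \<in> M" for x p i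
    using M_pow[OF that] M_inv[OF M_pow[OF that]] M_car[OF that]
    by (cases i rule: int_cases2) (auto simp: int_pow_int int_pow_neg)
  have dom: "\<exists>p. (x, p) \<in> M" if x: "x \<in> carrier G" for x
  proof (rule ccontr)
    assume nx: "\<nexists>p. (x, p) \<in> M"
    \<comment> \<open>The value to be given to \<open>x\<close>: it is forced, by division, as soon
      as some nonzero power of \<open>x\<close> lies in the domain of \<open>M\<close>; otherwise
      \<open>0\<close> serves.\<close>
    obtain r where r: "\<And>i v. (x [^] (i::int), v) \<in> M \<Longrightarrow> v = of_int i * r"
    proof (cases "\<exists>i0 v0. i0 \<noteq> 0 \<and> (x [^] (i0::int), v0) \<in> M")
      case True
      then obtain i0 v0 where i0: "i0 \<noteq> 0" "(x [^] (i0::int), v0) \<in> M" by blast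
      show ?thesis
      proof (rule that[of "v0 / of_int i0"])
        fix i v assume "(x [^] (i::int), v) \<in> M"
        from M_int_pow[OF this, of i0] M_int_pow[OF i0(2), of i]
        have "of_int i0 * v = of_int i * v0"
          using x by (intro M_fun) (auto simp: int_pow_pow mult.commute)
        then show "v = of_int i * (v0 / of_int i0)" using i0(1) by (simp add: field_simps)
      qed
    next
      case False
      show ?thesis
        by (rule that[of 0]) (use False M_fun[OF _ M_one] in \<open>metis int_pow_0 mult_zero_right\<close>)
    qed
    define M' where "M' = {(y \<otimes> x [^] i, p + of_int i * r) | y p (i::int). (y, p) \<in> M}"
    have "good M'"
      unfolding good_def
    proof (intro conjI allI impI)
      show "M' \<subseteq> carrier G \<times> UNIV" using x M_car by (auto simp: M'_def)
      show "(\<lambda>x. (x, f x)) ` H \<subseteq> M'"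
      proof safe
        fix y assume "y \<in> H"
        then have "(y \<otimes> x [^] (0::int), f y + of_int 0 * r) \<in> M'" unfolding M'_def using M_H by blast
        then show "(y, f y) \<in> M'" using \<open>y \<in> H\<close> by simp
      qed
    next
      fix a p b q assume "(a, p) \<in> M'" "(b, q) \<in> M'"
      then obtain y p' i z q' j where
        a: "a = y \<otimes> x [^] (i::int)" "p = p' + of_int i * r" "(y, p') \<in> M" and
        b: "b = z \<otimes> x [^] (j::int)" "q = q' + of_int j * r" "(z, q') \<in> M"
        by (auto simp: M'_def)
      \<comment> \<open>Moving \<open>x [^] i\<close> past \<open>z\<close> costs a commutator,
        which lies in the domain with value \<open>0\<close>.\<close>
      let ?c = "x [^] i \<otimes> z \<otimes> inv (x [^] i) \<otimes> inv z"
      have yz: "y \<in> carrier G" "z \<in> carrier G" using a b M_car by auto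
      have "(y \<otimes> ?c \<otimes> z, p' + 0 + q') \<in> M"
        using M_mult[OF M_mult[OF a(3) M_comm[OF int_pow_closed[OF x] yz(2)]] b(3)] .
      then have "(y \<otimes> ?c \<otimes> z \<otimes> x [^] (i + j), p' + 0 + q' + of_int (i + j) * r) \<in> M'"
        unfolding M'_def by blast
      moreover have "y \<otimes> ?c \<otimes> z \<otimes> x [^] (i + j) = a \<otimes> b"
        unfolding a b using x yz by (simp add: int_pow_mult m_assoc inv_cancel)
      moreover have "p' + 0 + q' + of_int (i + j) * r = p + q"
        unfolding a b by (simp add: algebra_simps)
      ultimately show "(a \<otimes> b, p + q) \<in> M'" by simp
    next
      fix a p assume "(a, p) \<in> M'"
      then obtain y p' i where
        a: "a = y \<otimes> x [^] (i::int)" "p = p' + of_int i * r" "(y, p') \<in> M" by (auto simp: M'_def)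
      have y: "y \<in> carrier G" using a M_car by auto
      let ?c = "inv (x [^] i) \<otimes> inv y \<otimes> inv (inv (x [^] i)) \<otimes> inv (inv y)"
      have "(?c \<otimes> inv y, 0 + - p') \<in> M"
        by (rule M_mult[OF M_comm M_inv[OF a(3)]]) (use x y in auto)
      then have "(?c \<otimes> inv y \<otimes> x [^] (- i), 0 + - p' + of_int (- i) * r) \<in> M'"
        unfolding M'_def by blast
      moreover have "?c \<otimes> inv y \<otimes> x [^] (- i) = inv a"
        unfolding a using x y by (simp add: int_pow_neg m_assoc inv_cancel inv_mult_group)
      ultimately show "(inv a, - p) \<in> M'" unfolding a by simp
    next
      fix q assume "(\<one>, q) \<in> M'"
      then obtain y p' i where
        a: "\<one> = y \<otimes> x [^] (i::int)" "q = p' + of_int i * r" "(y, p') \<in> M" by (auto simp: M'_def)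
      have y: "y \<in> carrier G" using a M_car by auto
      have "x [^] i = inv y" using a(1) x y by (metis inv_equality inv_inv int_pow_closed inv_closed)
      then have "(x [^] i, - p') \<in> M" using M_inv[OF a(3)] by simp
      from r[OF this] show "q = 0" using a(2) by simp
    qed
    moreover have "M \<subseteq> M'"
    proof safe
      fix y p assume "(y, p) \<in> M"
      then have "(y \<otimes> x [^] (0::int), p + of_int 0 * r) \<in> M'" unfolding M'_def by blast
      then show "(y, p) \<in> M'" using \<open>(y, p) \<in> M\<close> M_car by simp
    qed
    ultimately have "M' = M" by (rule max)
    moreover have "(\<one> \<otimes> x [^] (1::int), 0 + of_int 1 * r) \<in> M'"
      unfolding M'_def using M_one by blast
    ultimately show False using nx x by auto
  qed
  define h where "h x = (THE p. (x, p) \<in> M)" for x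
  have h: "h x = p" if "(x, p) \<in> M" for x p
    unfolding h_def using that M_fun by blast
  have "rat_hom G h"
    unfolding rat_hom_def
  proof (intro ballI)
    fix x y assume "x \<in> carrier G" "y \<in> carrier G"
    then obtain p q where "(x, p) \<in> M" "(y, q) \<in> M" using dom by blast
    then show "h (x \<otimes> y) = h x + h y" using M_mult h by simp
  qed
  moreover have "h x = f x" if "x \<in> H" for x using h[OF M_H[OF that]] .
  ultimately show ?thesis by blast
qed

end

section \<open>Free groups\<close>

text \<open>The coefficient of the monomial \<open>s\<close> in the Magnus expansion \<open>x\<^sup>\<plusminus>\<^sup>1 \<mapsto> 1 \<plusminus> x\<close> of a word, in
  noncommuting variables with \<open>x\<^sup>2 = 0\<close>.  It depends only on the group element if \<open>s\<close> has
  no equal neighbours.\<close>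

fun magnus_coeff :: "'a list \<Rightarrow> ('a \<times> bool) list \<Rightarrow> rat" where
  "magnus_coeff s [] = (if s = [] then 1 else 0)"
| "magnus_coeff [] (l # w) = magnus_coeff [] w"
| "magnus_coeff (b # s) (l # w) =
     magnus_coeff (b # s) w + (if fst l = b then (if snd l then 1 else - 1) * magnus_coeff s w else 0)"

lemma magnus_coeff_Nil: "magnus_coeff [] w = 1"
  by (induction w) auto

text \<open>The expansions \<open>(1 + b)(1 - b)\<close> and \<open>1\<close> differ only by the
  square of \<open>b\<close>, which divides no monomial without equal neighbours.\<close>

lemma magnus_coeff_cancel:
  assumes "distinct_adj s"
  shows "magnus_coeff s ((b, e) # (b, \<not> e) # w) = magnus_coeff s w"
proof (cases s)
  case (Cons a s')
  then show ?thesis using assms by (cases s') auto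
qed simp

text \<open>Each contribution to the coefficient spells \<open>s\<close> as a subsequence of
  \<open>w\<close>. As \<open>s\<close> has no equal neighbours, a syllable of \<open>w\<close>
  supplies at most one letter; so \<open>s\<close> is no longer than the number of syllables and, in
  case of equality, begins with the first of them.\<close>

lemma magnus_coeff_eq_0:
  assumes "distinct_adj s"
    and "length s > length (remdups_adj (map fst w)) \<or>
      length s = length (remdups_adj (map fst w)) \<and> w \<noteq> [] \<and> hd s \<noteq> fst (hd w)"
  shows "magnus_coeff s w = 0"
  using assms
proof (induction w arbitrary: s)
  case (Cons l w)
  then obtain a s' where s: "s = a # s'" by (cases s) auto
  then have s': "distinct_adj s'" "s' \<noteq> [] \<Longrightarrow> hd s' \<noteq> a"
    using Cons.prems(1) by (cases s'; auto)+
  show ?case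
  proof (cases w)
    case Nil
    then show ?thesis using Cons.prems s by (auto split: if_splits)
  next
    case (Cons m u)
    show ?thesis
    proof (cases "fst l = fst m")
      case True
      then have *: "length (remdups_adj (map fst (l # w))) = length (remdups_adj (map fst w))"
        by (simp add: Cons)
      show ?thesis
      proof (cases "fst l = a")
        case False
        then show ?thesis using Cons.IH[OF Cons.prems(1)] Cons.prems(2) * s True Cons by auto
      next
        case aT: True
        then have len: "length s > length (remdups_adj (map fst w))"
          using Cons.prems(2) * s by auto
        have "s' \<noteq> []" using len s Cons by (auto simp: remdups_adj_length_ge1)
        then have "hd s' \<noteq> fst (hd w)" using s' aT True Cons by simp
        then have "magnus_coeff s' w = 0" using Cons.IH[OF s'(1)] len s Cons by fastforce
        then show ?thesis using Cons.IH[OF Cons.prems(1)] len s by simp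
      qed
    next
      case False
      then have *: "length (remdups_adj (map fst (l # w))) = Suc (length (remdups_adj (map fst w)))"
        by (simp add: Cons)
      show ?thesis
        using Cons.IH[OF Cons.prems(1)] Cons.IH[OF s'(1)] Cons.prems(2) * s by auto
    qed
  qed
qed auto

text \<open>Within a syllable, the contributions of the letters to the leading coefficient have the same
  sign.\<close>

lemma magnus_coeff_reduced:
  assumes "reduced_word ((b, e) # w)"
  shows "(if e then 1 else - 1) * magnus_coeff (remdups_adj (map fst ((b, e) # w))) ((b, e) # w)
      * magnus_coeff (tl (remdups_adj (map fst ((b, e) # w)))) ((b, e) # w) > 0"
  using assms
proof (induction w arbitrary: b e)
  case Nil
  then show ?case by simp
next
  case (Cons l w)
  obtain b' e' where l: "l = (b', e')" by (cases l)
  define p where "p = remdups_adj (map fst ((b', e') # w))"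
  have "reduced_word ((b', e') # w)" using Cons.prems l by (auto simp: reduced_word_def)
  from Cons.IH[OF this]
  have IH: "(if e' then 1 else - 1) * magnus_coeff p (l # w) * magnus_coeff (tl p) (l # w) > 0"
    by (simp add: p_def l)
  have da: "distinct_adj p" unfolding p_def by (rule distinct_adj_remdups_adj)
  have "hd p = b'" "p \<noteq> []" unfolding p_def by simp_all
  then obtain p' where p: "p = b' # p'" by (cases p) auto
  have p': "p' = [] \<or> hd p' \<noteq> b'" using da p by (cases p') auto
  have neq: "magnus_coeff s ((b, e) # l # w) = magnus_coeff s (l # w)" if "s = [] \<or> hd s \<noteq> b" for s
    using that by (cases s) (auto simp: magnus_coeff_Nil)
  show ?case
  proof (cases "b = b'")
    case True
    then have e: "e' = e" using Cons.prems l by (auto simp: reduced_word_def)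
    have "remdups_adj (map fst ((b, e) # l # w)) = p" using True by (simp add: p_def l)
    moreover have "magnus_coeff p' ((b, e) # l # w) = magnus_coeff p' (l # w)" using neq p' True by simp
    moreover have "magnus_coeff p ((b, e) # l # w) = magnus_coeff p (l # w) + (if e then 1 else - 1) * magnus_coeff p' (l # w)"
      using True p by simp
    moreover have "(if e then 1 else - 1) * (x + (if e then 1 else - 1) * y) * y > 0"
      if "(if e then 1 else - 1) * x * y > 0" for x y :: rat
      using that by (cases e; simp add: algebra_simps; insert zero_le_square[of y]; linarith)
    ultimately show ?thesis using IH e p by simp
  next
    case False
    have 1: "remdups_adj (map fst ((b, e) # l # w)) = b # p" using False by (simp add: p_def l)
    have "distinct_adj (b # p)" using False da p by simp
    \<comment> \<open>At a new syllable, \<open>b # p\<close> is too long to occur in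
      \<open>l # w\<close>; its coefficient is therefore that of \<open>p\<close> up to the sign of
      the new letter, and the claimed product is a square.\<close>
    then have 2: "magnus_coeff (b # p) (l # w) = 0"
      by (rule magnus_coeff_eq_0) (simp add: p_def l)
    have 3: "magnus_coeff p ((b, e) # l # w) = magnus_coeff p (l # w)" using neq p False by simp
    have "magnus_coeff p (l # w) \<noteq> 0" using IH by auto
    then show ?thesis using 2 3 unfolding 1 by (auto simp: zero_less_mult_iff)
  qed
qed

context group
begin

lemma free_basis_generate:
  assumes "free_basis G B"
  shows "generate G B = carrier G"
proof
  have B: "B \<subseteq> carrier G" using assms by (simp add: free_basis_def)
  show "generate G B \<subseteq> carrier G" using B by (rule generate_incl)
  have wv: "word_value G w \<in> generate G B" if "set w \<subseteq> B \<times> UNIV" for w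
    using that
  proof (induction w)
    case (Cons l w)
    then have "letter_value G l \<in> generate G B"
      by (auto simp: letter_value_def intro: generate.incl generate.inv)
    with Cons show ?case by (auto intro: generate.eng)
  qed (simp add: generate.one)
  show "carrier G \<subseteq> generate G B"
  proof
    fix x assume "x \<in> carrier G"
    then obtain w where "set w \<subseteq> B \<times> UNIV" "x = word_value G w"
      using assms unfolding free_basis_def bij_betw_def by blast
    then show "x \<in> generate G B" using wv by simp
  qed
qed

lemma free_basis_rat_hom:
  assumes "free_basis G B"
  shows "\<exists>h. rat_hom G h \<and> (\<forall>b\<in>B. h b = f b)"
proof -
  let ?Q = "\<lparr>carrier = UNIV, monoid.mult = (+), one = 0\<rparr> :: rat monoid"
  have "group ?Q" by (rule groupI) (auto intro: exI[of _ "- _"])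
  from free_basis_extends[OF is_group assms this, of f] show ?thesis
    by (auto simp: rat_hom_def hom_def)
qed

text \<open>The inclusion of the basis lifts to the central extension defined by the cocycle.\<close>

lemma free_basis_cocycle:
  fixes c :: "'a \<Rightarrow> 'a \<Rightarrow> rat"
  assumes B: "free_basis G B"
    and c: "\<And>x y z. x \<in> carrier G \<Longrightarrow> y \<in> carrier G \<Longrightarrow> z \<in> carrier G \<Longrightarrow>
      c x y + c (x \<otimes> y) z = c y z + c x (y \<otimes> z)"
    and c1: "\<And>x. x \<in> carrier G \<Longrightarrow> c \<one> x = 0" "\<And>x. x \<in> carrier G \<Longrightarrow> c x \<one> = 0"
  shows "\<exists>h. \<forall>x\<in>carrier G. \<forall>y\<in>carrier G. h (x \<otimes> y) = h x + h y + c x y"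
proof -
  let ?M = "\<lparr>carrier = carrier G \<times> UNIV,
    monoid.mult = (\<lambda>p q. (fst p \<otimes> fst q, snd p + snd q + c (fst p) (fst q))), one = (\<one>, 0)\<rparr> :: ('a \<times> rat) monoid"
  have M: "group ?M"
  proof (rule groupI)
    fix x y z assume "x \<in> carrier ?M" "y \<in> carrier ?M" "z \<in> carrier ?M"
    then show "x \<otimes>\<^bsub>?M\<^esub> y \<otimes>\<^bsub>?M\<^esub> z = x \<otimes>\<^bsub>?M\<^esub> (y \<otimes>\<^bsub>?M\<^esub> z)"
      using c[of "fst x" "fst y" "fst z"] by (auto simp: m_assoc)
  next
    fix x assume "x \<in> carrier ?M"
    then show "\<exists>y\<in>carrier ?M. y \<otimes>\<^bsub>?M\<^esub> x = \<one>\<^bsub>?M\<^esub>"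
      by (intro bexI[of _ "(inv (fst x), - snd x - c (inv (fst x)) (fst x))"]) auto
  qed (auto simp: c1)
  have Bc: "B \<subseteq> carrier G" using B by (simp add: free_basis_def)
  obtain \<sigma> where \<sigma>: "\<sigma> \<in> hom G ?M" "\<And>b. b \<in> B \<Longrightarrow> \<sigma> b = (b, 0)"
    using free_basis_extends[OF is_group B M, of "\<lambda>b. (b, 0)"] Bc by auto
  interpret \<sigma>: group_hom G ?M \<sigma>
    using M \<sigma>(1) by (simp add: group_hom_def group_hom_axioms_def)
  have fst_mult: "fst (\<sigma> (x \<otimes> y)) = fst (\<sigma> x) \<otimes> fst (\<sigma> y)"
    if "x \<in> carrier G" "y \<in> carrier G" for x y using \<sigma>.hom_mult[OF that] by simp
  have fst_hom: "(\<lambda>x. fst (\<sigma> x)) \<in> hom G G"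
    using fst_mult \<sigma>.hom_closed by (auto simp: hom_def mem_Times_iff)
  interpret f: group_hom G G "\<lambda>x. fst (\<sigma> x)"
    using fst_hom by (simp add: group_hom_def group_hom_axioms_def)
  \<comment> \<open>The first component of the lift is an endomorphism that fixes the basis, hence
    the identity; the second component is then the cochain sought.\<close>
  have "fst (\<sigma> x) = x" if "x \<in> generate G B" for x
    using that
  proof induction
    case (inv h)
    then show ?case using Bc \<sigma>(2) f.hom_inv[of h] by auto
  next
    case (eng h1 h2)
    then have "h1 \<in> carrier G" "h2 \<in> carrier G" using generate_incl[OF Bc] by blast+
    then show ?case using eng.IH fst_mult by simp
  qed (use \<sigma>(2) f.hom_one in auto)
  then have id: "fst (\<sigma> x) = x" if "x \<in> carrier G" for x
    using that free_basis_generate[OF B] by simp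
  have "snd (\<sigma> (x \<otimes> y)) = snd (\<sigma> x) + snd (\<sigma> y) + c x y"
    if "x \<in> carrier G" "y \<in> carrier G" for x y
    using \<sigma>.hom_mult[OF that] id that by simp
  then show ?thesis by (intro exI[of _ "\<lambda>x. snd (\<sigma> x)"]) blast
qed

text \<open>The separating function is the coefficient of the syllable sequence of \<open>g\<close>.
  Left multiplication by \<open>b\<close> changes the coefficient of \<open>a # s\<close> by that of
  \<open>s\<close> if \<open>a = b\<close> and not at all otherwise, which bounds the degree; a
  cancellation in the reduced word is not seen by these coefficients.\<close>

lemma free_basis_polynomial_separates:
  assumes B: "free_basis G B" and g: "g \<in> carrier G" "g \<noteq> \<one>"
  shows "\<exists>k f. polynomial_fun G k f \<and> f g \<noteq> f \<one>"
proof -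
  define R where "R = {w. set w \<subseteq> B \<times> (UNIV :: bool set) \<and> reduced_word w}"
  define word where "word = the_inv_into R (word_value G)"
  have Bc: "B \<subseteq> carrier G" and bij: "bij_betw (word_value G) R (carrier G)"
    using B by (auto simp: free_basis_def R_def)
  have word_R: "word x \<in> R" and value_word: "word_value G (word x) = x" if "x \<in> carrier G" for x
    using that bij unfolding word_def
    by (metis bij_betw_def f_the_inv_into_f the_inv_into_into order_refl)+
  have word_value: "word (word_value G w) = w" if "w \<in> R" for w
    using that bij unfolding word_def by (metis bij_betw_def the_inv_into_f_f)
  have closed: "word_value G w \<in> carrier G" if "w \<in> R" for w
    using that bij by (meson bij_betwE)
  have step: "magnus_coeff s (word (b \<otimes> x)) = magnus_coeff s ((b, True) # word x)"
    if b: "b \<in> B" and x: "x \<in> carrier G" and s: "distinct_adj s" for b x s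
  proof (cases "reduced_word ((b, True) # word x)")
    case True
    then have "(b, True) # word x \<in> R" using word_R[OF x] b by (auto simp: R_def)
    from word_value[OF this] show ?thesis by (simp add: letter_value_def value_word[OF x])
  next
    case False
    then obtain u where u: "word x = (b, False) # u"
      using word_R[OF x] by (cases "word x") (auto simp: R_def reduced_word_def)
    then have uR: "u \<in> R" using word_R[OF x] by (cases u) (auto simp: R_def reduced_word_def)
    have "x = inv b \<otimes> word_value G u" using value_word[OF x] u by (simp add: letter_value_def)
    then have "b \<otimes> x = word_value G u" using b Bc closed[OF uR] by (auto simp: inv_cancel)
    then have "word (b \<otimes> x) = u" using word_value[OF uR] by simp
    then show ?thesis using magnus_coeff_cancel[OF s, of b True u] u by simp
  qed
  have poly: "polynomial_fun G (Suc (length s)) (\<lambda>x. magnus_coeff s (word x))" if "distinct_adj s" for s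
    using that
  proof (induction s)
    case Nil
    show ?case using polynomial_fun_const[of 0 1] by (simp only: magnus_coeff_Nil list.size)
  next
    case (Cons a s)
    show ?case
    proof (rule polynomial_fun_SucI[OF Bc free_basis_generate[OF B]])
      fix b assume b: "b \<in> B"
      have s: "distinct_adj s" using Cons.prems by (cases s) auto
      show "polynomial_fun G (length (a # s)) (\<lambda>x. magnus_coeff (a # s) (word (b \<otimes> x)) - magnus_coeff (a # s) (word x))"
      proof (rule polynomial_fun_cong)
        show "polynomial_fun G (length (a # s)) (\<lambda>x. (if b = a then 1 else 0) * magnus_coeff s (word x))"
          using polynomial_fun_scale[OF Cons.IH[OF s]] by simp
      qed (simp add: step[OF b _ Cons.prems])
    qed
  qed
  define w where "w = word g"
  have "w \<noteq> []" using value_word[OF g(1)] g(2) unfolding w_def by force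
  then obtain b e v where w: "w = (b, e) # v" by (metis list.exhaust surj_pair)
  define s where "s = remdups_adj (map fst w)"
  have "magnus_coeff s w \<noteq> 0"
    using magnus_coeff_reduced[of b e v] word_R[OF g(1)] unfolding s_def w w_def[symmetric] R_def by auto
  moreover have "word \<one> = []" using word_value[of "[]"] by (simp add: R_def reduced_word_def)
  moreover have "s \<noteq> []" using \<open>w \<noteq> []\<close> by (simp add: s_def)
  moreover have "distinct_adj s" unfolding s_def by (rule distinct_adj_remdups_adj)
  ultimately show ?thesis using poly[of s]
    by (intro exI[of _ "Suc (length s)"] exI[of _ "\<lambda>x. magnus_coeff s (word x)"]) (simp add: w_def)
qed

end

section \<open>Extensions by an infinite cyclic group\<close>

text \<open>The quotient is encoded by an exponent map \<open>\<epsilon>\<close> with kernel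
  \<open>N\<close> and a section \<open>t\<close>, so that \<open>G\<close> is the semidirect
  product of \<open>N\<close> by the powers of \<open>t\<close> and no cosets are handled.\<close>

locale infinite_cyclic_extension = group G for G (structure) +
  fixes N :: "'a set" and t :: 'a and \<epsilon> :: "'a \<Rightarrow> int"
  assumes N_iff: "x \<in> N \<longleftrightarrow> x \<in> carrier G \<and> \<epsilon> x = 0"
    and t_closed [simp]: "t \<in> carrier G" and \<epsilon>_t [simp]: "\<epsilon> t = 1"
    and \<epsilon>_mult [simp]: "x \<in> carrier G \<Longrightarrow> y \<in> carrier G \<Longrightarrow> \<epsilon> (x \<otimes> y) = \<epsilon> x + \<epsilon> y"
begin

lemma N_closed: "y \<in> N \<Longrightarrow> y \<in> carrier G"
  by (simp add: N_iff)

lemma \<epsilon>_N: "y \<in> N \<Longrightarrow> \<epsilon> y = 0"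
  by (simp add: N_iff)

lemma \<epsilon>_one [simp]: "\<epsilon> \<one> = 0"
  using \<epsilon>_mult[of \<one> \<one>] by simp

lemma \<epsilon>_inv [simp]: "x \<in> carrier G \<Longrightarrow> \<epsilon> (inv x) = - \<epsilon> x"
  using \<epsilon>_mult[of x "inv x"] by simp

lemma \<epsilon>_pow [simp]: "\<epsilon> (t [^] (n::nat)) = int n"
  by (induction n) auto

lemma \<epsilon>_int_pow [simp]: "\<epsilon> (t [^] (i::int)) = i"
  by (cases i rule: int_cases2) (auto simp: int_pow_int int_pow_neg)

lemma N_one [simp]: "\<one> \<in> N"
  by (simp add: N_iff)

lemma N_mult [simp]: "x \<in> N \<Longrightarrow> y \<in> N \<Longrightarrow> x \<otimes> y \<in> N"
  by (simp add: N_iff)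

lemma N_inv [simp]: "x \<in> N \<Longrightarrow> inv x \<in> N"
  by (simp add: N_iff)

lemma N_conj [simp]: "y \<in> N \<Longrightarrow> t \<otimes> y \<otimes> inv t \<in> N"
  by (simp add: N_iff)

declare N_closed [simp] \<epsilon>_N [simp]

lemma t_pow_commute: "x \<in> carrier G \<Longrightarrow> t [^] (j::nat) \<otimes> (t \<otimes> x) = t \<otimes> (t [^] j \<otimes> x)"
  using nat_pow_Suc2[of t j] by (simp flip: m_assoc)

lemma subgroup_N: "subgroup N G"
  proof (rule subgroupI)
  show "N \<noteq> {}" using N_one by blast
qed auto

abbreviation GN where "GN \<equiv> G\<lparr>carrier := N\<rparr>"

sublocale GN: group GN
  by (rule subgroup_imp_group[OF subgroup_N])

lemma inv_GN [simp]: "x \<in> N \<Longrightarrow> inv\<^bsub>GN\<^esub> x = inv x"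
  by (rule m_inv_consistent[OF subgroup_N])

text \<open>The \<open>N\<close>-component of \<open>x = y \<otimes> t [^] i\<close>. It is in
  general not a homomorphism, but it commutes with left multiplication by \<open>N\<close> and
  ignores right multiplication by \<open>t\<close>; composing with it turns functions on
  \<open>N\<close> into invariant functions on \<open>G\<close>.\<close>

definition proj where "proj x = x \<otimes> t [^] (- \<epsilon> x)"

lemma proj_closed [simp]: "x \<in> carrier G \<Longrightarrow> proj x \<in> N"
  by (simp add: proj_def N_iff del: N_closed \<epsilon>_N)

lemma proj_N_mult [simp]: "y \<in> N \<Longrightarrow> x \<in> carrier G \<Longrightarrow> proj (y \<otimes> x) = y \<otimes> proj x"
  by (simp add: proj_def m_assoc)

lemma proj_N [simp]: "y \<in> N \<Longrightarrow> proj y = y"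
  by (simp add: proj_def)

lemma proj_mult_t [simp]: "x \<in> carrier G \<Longrightarrow> proj (x \<otimes> t) = proj x"
  using int_pow_mult[of t 1 "- \<epsilon> x - 1"] by (simp add: proj_def m_assoc)

lemma proj_decomp: "x \<in> carrier G \<Longrightarrow> x = proj x \<otimes> t [^] \<epsilon> x"
  using int_pow_mult[of t "- \<epsilon> x" "\<epsilon> x"] by (simp add: proj_def m_assoc)

lemma generate_N_t: "generate G (insert t N) = carrier G"
proof
  have S: "insert t N \<subseteq> carrier G" by auto
  show "generate G (insert t N) \<subseteq> carrier G" by (rule generate_incl[OF S])
  have sub: "subgroup (generate G (insert t N)) G" by (rule generate_is_subgroup[OF S])
  show "carrier G \<subseteq> generate G (insert t N)"
  proof
    fix x assume x: "x \<in> carrier G"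
    have "proj x \<in> generate G (insert t N)" using x by (auto intro: generate.incl)
    moreover have "t [^] \<epsilon> x \<in> generate G (insert t N)"
      by (rule subgroup_int_pow_closed[OF sub]) (auto intro: generate.incl)
    ultimately show "x \<in> generate G (insert t N)"
      using proj_decomp[OF x] generate.eng by metis
  qed
qed

definition invariant where
  "invariant f \<longleftrightarrow> (\<forall>x \<in> carrier G. f (x \<otimes> t) = (f x :: rat))"

lemma invariant_int_pow:
  assumes "invariant f" "x \<in> carrier G"
  shows "f (x \<otimes> t [^] (i::int)) = f x"
proof -
  have *: "f (x \<otimes> t [^] (n::nat)) = f x" if "x \<in> carrier G" for n x
    using that
  proof (induction n)
    case (Suc n)
    have "f (x \<otimes> t [^] Suc n) = f (x \<otimes> t [^] n \<otimes> t)" using Suc.prems by (simp add: m_assoc)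
    then show ?case using Suc assms(1) by (simp add: invariant_def)
  qed simp
  show ?thesis
  proof (cases i rule: int_cases2)
    case (nonneg n)
    then show ?thesis using *[OF assms(2)] by (simp add: int_pow_int)
  next
    case (nonpos n)
    have "x = x \<otimes> t [^] i \<otimes> t [^] n"
      using assms(2) nonpos by (simp add: int_pow_neg int_pow_int m_assoc)
    then show ?thesis using *[of "x \<otimes> t [^] i" n] assms(2) by simp
  qed
qed

lemma invariant_inv_t: "invariant f \<Longrightarrow> x \<in> carrier G \<Longrightarrow> f (x \<otimes> inv t) = f x"
  using invariant_int_pow[of f x "-1"] by (simp add: int_pow_neg)

lemma invariant_proj: "invariant f \<Longrightarrow> x \<in> carrier G \<Longrightarrow> f (proj x) = f x"
  unfolding proj_def by (rule invariant_int_pow)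

lemma invariant_left_proj:
  assumes "invariant f" "g \<in> carrier G" "x \<in> carrier G"
  shows "f (g \<otimes> proj x) = f (g \<otimes> x)"
  using invariant_int_pow[OF assms(1), of "g \<otimes> x"] assms(2,3) by (simp add: proj_def m_assoc)

text \<open>Homomorphisms \<open>N \<rightarrow> \<rat>\<close> are extended to \<open>G\<close> by invariance under right multiplication by \<open>t\<close>.
  The left translate by \<open>t\<close> then corresponds to precomposition with conjugation by \<open>t\<close> on \<open>N\<close>.\<close>

definition hom_N where
  "hom_N e \<longleftrightarrow> invariant e \<and> (\<forall>y \<in> N. \<forall>x \<in> carrier G. e (y \<otimes> x) = e y + e x)"

lemma hom_N_invariant: "hom_N e \<Longrightarrow> invariant e"
  by (simp add: hom_N_def)

lemma hom_N_mult_N: "hom_N e \<Longrightarrow> y \<in> N \<Longrightarrow> x \<in> carrier G \<Longrightarrow> e (y \<otimes> x) = e y + e x"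
  by (simp add: hom_N_def)

lemma hom_N_rat_hom: "hom_N e \<Longrightarrow> rat_hom GN e"
  by (simp add: hom_N_def rat_hom_def)

lemma hom_N_one: "hom_N e \<Longrightarrow> e \<one> = 0"
  using hom_N_mult_N[of e \<one> \<one>] by simp

lemma hom_N_t_pow: "hom_N e \<Longrightarrow> e (t [^] (i::int)) = 0"
  using invariant_int_pow[OF hom_N_invariant, of e \<one> i] hom_N_one by simp

lemma hom_N_proj:
  assumes "rat_hom GN r"
  shows "hom_N (\<lambda>x. r (proj x))"
  using assms by (simp add: hom_N_def invariant_def rat_hom_def)

lemma hom_N_lincomb: "hom_N e \<Longrightarrow> hom_N e' \<Longrightarrow> hom_N (\<lambda>x. a * e x + b * e' x)"
  by (simp add: hom_N_def invariant_def algebra_simps)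

lemma hom_N_zero: "hom_N (\<lambda>x. 0)"
  by (simp add: hom_N_def invariant_def)

lemma hom_N_translate:
  assumes e: "hom_N e"
  shows "hom_N (\<lambda>x. e (t \<otimes> x))"
  unfolding hom_N_def
proof (intro conjI ballI)
  show "invariant (\<lambda>x. e (t \<otimes> x))"
    using hom_N_invariant[OF e] by (simp add: invariant_def m_assoc[symmetric])
  fix y x assume y: "y \<in> N" and x: "x \<in> carrier G"
  have "e (t \<otimes> (y \<otimes> x)) = e (t \<otimes> y \<otimes> inv t \<otimes> (t \<otimes> x))"
    using x y by (simp add: m_assoc inv_cancel)
  also have "\<dots> = e (t \<otimes> y \<otimes> inv t) + e (t \<otimes> x)"
    using x y by (intro hom_N_mult_N[OF e]) auto
  also have "e (t \<otimes> y \<otimes> inv t) = e (t \<otimes> y)"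
    using y by (intro invariant_inv_t[OF hom_N_invariant[OF e]]) auto
  finally show "e (t \<otimes> (y \<otimes> x)) = e (t \<otimes> y) + e (t \<otimes> x)" .
qed

text \<open>On all of \<open>G\<close> such an \<open>e\<close> is a crossed homomorphism,
  \<open>g\<close> acting through \<open>t [^] \<epsilon> g\<close>; this rule expands values on
  words in generators of \<open>G\<close>.\<close>

lemma hom_N_mult:
  assumes e: "hom_N e" and g: "g \<in> carrier G" and x: "x \<in> carrier G"
  shows "e (g \<otimes> x) = e g + e (t [^] \<epsilon> g \<otimes> x)"
proof -
  have "g \<otimes> x = proj g \<otimes> (t [^] \<epsilon> g \<otimes> x)"
    using proj_decomp[OF g] g x by (metis int_pow_closed m_assoc N_closed proj_closed t_closed)
  then show ?thesis
    using hom_N_mult_N[OF e proj_closed[OF g], of "t [^] \<epsilon> g \<otimes> x"]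
      invariant_proj[OF hom_N_invariant[OF e] g] x by simp
qed

subsection \<open>The action of polynomials in \<open>t\<close>\<close>

text \<open>A relation over \<open>\<rat>[t]\<close> in the rational abelianization of
  \<open>N\<close> is expressed by letting its coefficients act on every \<open>e\<close> with
  \<open>hom_N e\<close>.\<close>

definition act :: "rat poly \<Rightarrow> ('a \<Rightarrow> rat) \<Rightarrow> 'a \<Rightarrow> rat" where
  "act p e x = (\<Sum>j\<le>degree p. coeff p j * e (t [^] j \<otimes> x))"

lemma act_upto: "degree p \<le> n \<Longrightarrow> act p e x = (\<Sum>j\<le>n. coeff p j * e (t [^] j \<otimes> x))"
  unfolding act_def by (intro sum.mono_neutral_left) (auto simp: coeff_eq_0)

lemma act_cong: "x \<in> carrier G \<Longrightarrow> (\<And>x. x \<in> carrier G \<Longrightarrow> e x = e' x) \<Longrightarrow> act p e x = act p e' x"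
  unfolding act_def by (intro sum.cong) auto

lemma act_0 [simp]: "act 0 e x = 0"
  by (simp add: act_def)

lemma act_pCons:
  assumes x: "x \<in> carrier G"
  shows "act (pCons a p) e x = a * e x + act p (\<lambda>x. e (t \<otimes> x)) x"
proof -
  have "act (pCons a p) e x = (\<Sum>j\<le>Suc (degree p). coeff (pCons a p) j * e (t [^] j \<otimes> x))"
    by (rule act_upto) (rule degree_pCons_le)
  also have "\<dots> = a * e x + (\<Sum>j\<le>degree p. coeff p j * e (t [^] Suc j \<otimes> x))"
    using x by (simp add: sum.atMost_Suc_shift del: sum.atMost_Suc nat_pow_Suc)
  also have "(\<Sum>j\<le>degree p. coeff p j * e (t [^] Suc j \<otimes> x)) = act p (\<lambda>x. e (t \<otimes> x)) x"
    unfolding act_def using x by (intro sum.cong) (auto simp: t_pow_commute m_assoc)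
  finally show ?thesis .
qed

lemma act_add: "act (p + q) e x = act p e x + act q e x"
proof -
  define n where "n = max (degree p) (degree q)"
  have "degree (p + q) \<le> n" "degree p \<le> n" "degree q \<le> n" by (auto simp: n_def degree_add_le_max)
  then show ?thesis by (simp add: act_upto[of _ n] algebra_simps sum.distrib)
qed

lemma act_smult: "act (smult a p) e x = a * act p e x"
  by (cases "a = 0") (auto simp: act_def sum_distrib_left mult.assoc)

lemma act_sum: "act (\<Sum>i\<in>I. p i) e x = (\<Sum>i\<in>I. act (p i) e x)"
  by (induction I rule: infinite_finite_induct) (auto simp: act_add)

lemma act_const_1: "x \<in> carrier G \<Longrightarrow> act 1 e x = e x"
  by (simp add: one_pCons act_pCons)

lemma act_monom: "act (monom a n) e x = a * e (t [^] n \<otimes> x)"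
proof -
  have "act (monom a n) e x = (\<Sum>j\<le>n. coeff (monom a n) j * e (t [^] j \<otimes> x))"
    by (rule act_upto) (rule degree_monom_le)
  also have "\<dots> = (\<Sum>j\<le>n. if j = n then a * e (t [^] n \<otimes> x) else 0)"
    by (intro sum.cong) auto
  finally show ?thesis by simp
qed

lemma act_translate:
  assumes "x \<in> carrier G"
  shows "act q (\<lambda>x. e (t \<otimes> x)) x = act q e (t \<otimes> x)"
  unfolding act_def
proof (intro sum.cong refl)
  fix j :: nat
  show "coeff q j * e (t \<otimes> (t [^] j \<otimes> x)) = coeff q j * e (t [^] j \<otimes> (t \<otimes> x))"
    using assms by (simp add: t_pow_commute)
qed

lemma act_mult: "x \<in> carrier G \<Longrightarrow> act (p * q) e x = act p (act q e) x"
proof (induction p arbitrary: e)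
  case (pCons a p)
  have "act (pCons a p * q) e x = a * act q e x + act (p * q) (\<lambda>x. e (t \<otimes> x)) x"
    using pCons.prems by (simp add: act_add act_smult act_pCons)
  also have "act (p * q) (\<lambda>x. e (t \<otimes> x)) x = act p (act q (\<lambda>x. e (t \<otimes> x))) x"
    using pCons by simp
  also have "\<dots> = act p (\<lambda>x. act q e (t \<otimes> x)) x"
    by (rule act_cong[OF pCons.prems]) (rule act_translate)
  finally show ?case by (simp add: act_pCons[OF pCons.prems])
qed simp

lemma hom_N_act: "hom_N e \<Longrightarrow> hom_N (act p e)"
proof (induction p arbitrary: e)
  case 0
  show ?case using hom_N_zero by (simp add: act_def hom_N_def invariant_def)
next
  case (pCons a p)
  have "hom_N (\<lambda>x. a * e x + 1 * act p (\<lambda>x. e (t \<otimes> x)) x)"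
    by (rule hom_N_lincomb[OF pCons.prems pCons.IH[OF hom_N_translate[OF pCons.prems]]])
  then show ?case by (simp add: hom_N_def invariant_def act_pCons)
qed

text \<open>The elements of \<open>N\<close> whose classes in the rational abelianization are fixed by \<open>t\<close>.\<close>

definition fixed :: "'a set" where
  "fixed = {z \<in> N. \<forall>e. hom_N e \<longrightarrow> e (t \<otimes> z) = e z}"

lemma fixed_pow:
  assumes "z \<in> fixed" "hom_N e"
  shows "e (t [^] (j::nat) \<otimes> z) = e z"
  using assms(2)
proof (induction j arbitrary: e)
  case (Suc j)
  have z: "z \<in> carrier G" using assms(1) by (simp add: fixed_def)
  have "e (t [^] Suc j \<otimes> z) = e (t \<otimes> (t [^] j \<otimes> z))"
    using z by (simp add: t_pow_commute m_assoc)
  also have "\<dots> = e (t \<otimes> z)" using Suc.IH[OF hom_N_translate[OF Suc.prems]] .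
  finally show ?case using assms(1) Suc.prems by (simp add: fixed_def)
qed (use assms(1) in \<open>simp add: fixed_def\<close>)

lemma act_fixed: "z \<in> fixed \<Longrightarrow> hom_N e \<Longrightarrow> act q e z = poly q 1 * e z"
  by (simp add: act_def fixed_pow poly_altdef sum_distrib_right)

text \<open>Tested against all homomorphisms, \<open>t [^] n\<close> times the class of
  \<open>x\<close> is a \<open>\<rat>[t]\<close>-combination of the classes of \<open>proj l\<close>
  for \<open>l \<in> S\<close>. The shift clears the negative powers of \<open>t\<close> caused by
  inverses and by negative \<open>\<epsilon>\<close>.\<close>

definition represented where
  "represented S x n \<longleftrightarrow> (\<exists>p. \<forall>e. hom_N e \<longrightarrow> e (t [^] (n::nat) \<otimes> x) = (\<Sum>l\<in>S. act (p l) e l))"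

lemma represented_mono:
  assumes S: "S \<subseteq> carrier G" and x: "x \<in> carrier G" and r: "represented S x n" and "n \<le> m"
  shows "represented S x m"
  using \<open>n \<le> m\<close>
proof (induction m rule: dec_induct)
  case (step m)
  then obtain p where p: "\<And>e. hom_N e \<Longrightarrow> e (t [^] m \<otimes> x) = (\<Sum>l\<in>S. act (p l) e l)"
    unfolding represented_def by blast
  have "e (t [^] Suc m \<otimes> x) = (\<Sum>l\<in>S. act (pCons 0 (p l)) e l)" if e: "hom_N e" for e
  proof -
    have "e (t [^] Suc m \<otimes> x) = e (t \<otimes> (t [^] m \<otimes> x))"
      using x by (simp add: t_pow_commute m_assoc)
    also have "\<dots> = (\<Sum>l\<in>S. act (p l) (\<lambda>x. e (t \<otimes> x)) l)" by (rule p[OF hom_N_translate[OF e]])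
    also have "\<dots> = (\<Sum>l\<in>S. act (pCons 0 (p l)) e l)"
      using S by (intro sum.cong) (auto simp: act_pCons)
    finally show ?thesis .
  qed
  then show ?case unfolding represented_def by (intro exI[of _ "\<lambda>l. pCons 0 (p l)"]) simp
qed (use r in simp)

text \<open>A Fox-calculus expansion: the crossed rule of \<open>hom_N_mult\<close> reduces the
  value of \<open>e\<close> on a word to values on its letters, up to powers of
  \<open>t\<close>.\<close>

lemma represented_generate:
  assumes S: "finite S" "S \<subseteq> carrier G" and x: "x \<in> generate G S"
  shows "\<exists>n. represented S x n"
  using x
proof induction
  case one
  have "represented S \<one> 0"
    unfolding represented_def by (intro exI[of _ "\<lambda>_. 0"]) (simp add: hom_N_one)
  then show ?case by blast
next
  case (incl h)
  have "e h = (\<Sum>l\<in>S. act (if l = h then 1 else 0) e l)" for e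
  proof -
    have "(\<Sum>l\<in>S. act (if l = h then 1 else 0) e l) = (\<Sum>l\<in>S. if l = h then e h else 0)"
      using S by (intro sum.cong) (auto simp: act_const_1)
    then show ?thesis using incl S by simp
  qed
  then have "represented S h 0"
    unfolding represented_def using incl S by (intro exI[of _ "\<lambda>l. if l = h then 1 else 0"]) auto
  then show ?case by blast
next
  case (inv h)
  then have h: "h \<in> carrier G" using S by auto
  \<comment> \<open>Natural numbers with \<open>n - \<epsilon> h = m\<close>, so that \<open>0 = e
    (t [^] n) = e (t [^] n \<otimes> inv h) + e (t [^] m \<otimes> h)\<close>.\<close>
  define n m where "n = nat (\<epsilon> h)" and "m = nat (- \<epsilon> h)"
  have nm: "int n - \<epsilon> h = int m" by (simp add: n_def m_def)
  have "e (t [^] n \<otimes> inv h) = (\<Sum>l\<in>S. act (if l = h then monom (-1) m else 0) e l)" if e: "hom_N e" for e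
  proof -
    have "e (t [^] n \<otimes> inv h \<otimes> h) = e (t [^] n \<otimes> inv h) + e (t [^] (int m) \<otimes> h)"
    proof -
      have "\<epsilon> (t [^] n \<otimes> inv h) = int m" using h nm by simp
      then show ?thesis using hom_N_mult[OF e, of "t [^] n \<otimes> inv h" h] h by (simp only: m_closed inv_closed nat_pow_closed t_closed)
    qed
    moreover have "e (t [^] n \<otimes> inv h \<otimes> h) = 0"
      using hom_N_t_pow[OF e, of "int n"] h by (simp add: m_assoc int_pow_int)
    ultimately have "e (t [^] n \<otimes> inv h) = - e (t [^] m \<otimes> h)" by (simp add: int_pow_int)
    moreover have "(\<Sum>l\<in>S. act (if l = h then monom (-1) m else 0) e l) = (\<Sum>l\<in>S. if l = h then - e (t [^] m \<otimes> h) else 0)"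
      by (intro sum.cong) (auto simp: act_monom)
    ultimately show ?thesis using inv by (simp only: sum.delta[OF S(1)] if_True)
  qed
  then have "represented S (inv h) n"
    unfolding represented_def by (intro exI[of _ "\<lambda>l. if l = h then monom (-1) m else 0"]) simp
  then show ?case by blast
next
  case (eng x y)
  then obtain n1 n2 where n: "represented S x n1" "represented S y n2" by blast
  have xy: "x \<in> carrier G" "y \<in> carrier G" using eng.hyps generate_incl[OF S(2)] by blast+
  \<comment> \<open>Large enough that \<open>n \<ge> n1\<close> and that the shift
    \<open>n + \<epsilon> x\<close> met by \<open>y\<close> is a natural number at least
    \<open>n2\<close>.\<close>
  define n m where "n = n1 + n2 + nat \<bar>\<epsilon> x\<bar>" and "m = nat (int n + \<epsilon> x)"
  have m: "int n + \<epsilon> x = int m" "n2 \<le> m" "n1 \<le> n" by (auto simp: m_def n_def)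
  obtain p where p: "\<And>e. hom_N e \<Longrightarrow> e (t [^] n \<otimes> x) = (\<Sum>l\<in>S. act (p l) e l)"
    using represented_mono[OF S(2) xy(1) n(1) m(3)] unfolding represented_def by blast
  obtain q where q: "\<And>e. hom_N e \<Longrightarrow> e (t [^] m \<otimes> y) = (\<Sum>l\<in>S. act (q l) e l)"
    using represented_mono[OF S(2) xy(2) n(2) m(2)] unfolding represented_def by blast
  have "e (t [^] n \<otimes> (x \<otimes> y)) = (\<Sum>l\<in>S. act (p l + q l) e l)" if e: "hom_N e" for e
  proof -
    have "e (t [^] n \<otimes> (x \<otimes> y)) = e (t [^] n \<otimes> x) + e (t [^] (int m) \<otimes> y)"
      using hom_N_mult[OF e, of "t [^] n \<otimes> x" y] xy m by (simp add: m_assoc)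
    then show ?thesis using p[OF e] q[OF e] by (simp add: act_add sum.distrib int_pow_int)
  qed
  then have "represented S (x \<otimes> y) n" unfolding represented_def by (intro exI[of _ "\<lambda>l. p l + q l"]) simp
  then show ?case by blast
qed

text \<open>The rational abelianization of \<open>N\<close> is generated by \<open>card S\<close> elements over \<open>\<rat>[t, t\<^sup>-\<^sup>1]\<close>, so more
  than \<open>card S\<close> elements satisfy a relation over \<open>\<rat>[t]\<close>, which may be evaluated at \<open>t = 1\<close> on
  fixed elements.\<close>

lemma fixed_dependent:
  assumes S: "finite S" "S \<subseteq> carrier G" "generate G S = carrier G"
    and I: "finite I" "I \<subseteq> fixed" "card S < card I"
  shows "\<exists>v. (\<exists>z\<in>I. v z \<noteq> 0) \<and> (\<forall>e. hom_N e \<longrightarrow> (\<Sum>z\<in>I. v z * e z) = 0)"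
proof -
  have "\<exists>p. \<forall>e. hom_N e \<longrightarrow> e z = (\<Sum>l\<in>S. act (p l) e l)" if z: "z \<in> I" for z
  proof -
    have zf: "z \<in> fixed" using z I by blast
    then have "z \<in> generate G S" unfolding S(3) by (simp add: fixed_def)
    then obtain n where "represented S z n" using represented_generate[OF S(1,2)] by blast
    then show ?thesis unfolding represented_def using fixed_pow[OF zf] by metis
  qed
  then obtain p where p: "\<And>z e. z \<in> I \<Longrightarrow> hom_N e \<Longrightarrow> e z = (\<Sum>l\<in>S. act (p z l) e l)" by metis
  obtain q where q: "\<exists>z\<in>I. poly (q z) 1 \<noteq> 0" "\<And>l. l \<in> S \<Longrightarrow> (\<Sum>z\<in>I. q z * p z l) = 0"
    using poly_dependent_vectors[OF S(1) I(1,3), of p] by blast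
  have "(\<Sum>z\<in>I. poly (q z) 1 * e z) = 0" if e: "hom_N e" for e
  proof -
    have "(\<Sum>z\<in>I. poly (q z) 1 * e z) = (\<Sum>z\<in>I. act (q z) e z)"
      using I(2) e by (intro sum.cong) (auto simp: act_fixed)
    \<comment> \<open>The representation \<open>p z\<close> holds for every homomorphism, here for
      \<open>act (q z) e\<close>.\<close>
    also have "\<dots> = (\<Sum>z\<in>I. \<Sum>l\<in>S. act (p z l) (act (q z) e) l)"
      by (intro sum.cong refl p hom_N_act e)
    also have "\<dots> = (\<Sum>l\<in>S. \<Sum>z\<in>I. act (p z l) (act (q z) e) l)" by (rule sum.swap)
    also have "\<dots> = (\<Sum>l\<in>S. act (\<Sum>z\<in>I. q z * p z l) e l)"
      unfolding act_sum using S(2) by (intro sum.cong refl) (auto simp flip: act_mult simp: mult.commute)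
    also have "\<dots> = 0" using q(2) by simp
    finally show ?thesis .
  qed
  then show ?thesis using q(1) by (intro exI[of _ "\<lambda>z. poly (q z) 1"]) blast
qed

end

section \<open>Auxiliary facts on denominators, degrees and double sums\<close>

lemma common_denominator:
  fixes v :: "'i \<Rightarrow> rat"
  assumes "finite I"
  shows "\<exists>D::int. D \<noteq> 0 \<and> (\<forall>i\<in>I. \<exists>k::int. of_int D * v i = of_int k)"
  using assms
proof (induction I rule: finite_induct)
  case empty
  show ?case by (intro exI[of _ 1]) auto
next
  case (insert i I)
  then obtain D where D: "D \<noteq> 0" "\<And>j. j \<in> I \<Longrightarrow> \<exists>k::int. of_int D * v j = of_int k" by blast
  obtain a b where ab: "v i = of_int a / of_int b" "b > 0"
    by (metis quotient_of_div quotient_of_denom_pos surj_pair)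
  have "\<exists>k::int. of_int (b * D) * v j = of_int k" if j: "j \<in> insert i I" for j
  proof (cases "j = i")
    case True
    then show ?thesis using ab by (intro exI[of _ "D * a"]) simp
  next
    case False
    then obtain k :: int where "of_int D * v j = of_int k" using D(2) j by blast
    then show ?thesis by (intro exI[of _ "b * k"]) (simp add: mult.assoc)
  qed
  then show ?case using D(1) ab(2) by (intro exI[of _ "b * D"]) auto
qed

lemma (in group) polynomial_fun_common_degree:
  assumes "finite I" "\<And>i. i \<in> I \<Longrightarrow> \<exists>k. polynomial_fun G k (f i)"
  shows "\<exists>k. \<forall>i\<in>I. polynomial_fun G k (f i)"
  using assms
proof (induction I rule: finite_induct)
  case (insert i I)
  then obtain k l where "\<forall>i\<in>I. polynomial_fun G k (f i)" "polynomial_fun G l (f i)" by blast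
  then have "\<forall>j\<in>insert i I. polynomial_fun G (max k l) (f j)"
    using polynomial_fun_mono by (metis insert_iff max.cobounded1 max.cobounded2)
  then show ?case by blast
qed auto

lemma sum_triangle:
  fixes A :: "nat \<Rightarrow> nat \<Rightarrow> 'r :: comm_monoid_add"
  shows "(\<Sum>i=1..n. \<Sum>j=1..i. A j i) = (\<Sum>j=1..n. \<Sum>i=j..n. A j i)"
proof (induction n)
  case (Suc n)
  have "(\<Sum>j=1..Suc n. \<Sum>i=j..Suc n. A j i) = (\<Sum>j=1..Suc n. (\<Sum>i=j..n. A j i) + A j (Suc n))"
    by (intro sum.cong) auto
  also have "\<dots> = (\<Sum>j=1..n. \<Sum>i=j..n. A j i) + (\<Sum>j=1..Suc n. A j (Suc n))"
    by (simp add: sum.distrib add.assoc)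
  finally show ?case using Suc.IH by simp
qed simp

text \<open>\<open>separated\<close> is the form in which the hypothesis on the quotient by the
  derived subgroup of \<open>N\<close> enters: whatever some rational homomorphism of
  \<open>N\<close> detects is detected by one that is polynomial on \<open>G\<close>.\<close>

locale unipotent_free_extension = infinite_cyclic_extension +
  fixes S B
  assumes finite_S: "finite S" and S_closed: "S \<subseteq> carrier G" and generate_S: "generate G S = carrier G"
    and basis: "free_basis GN B"
    and separated: "x \<in> N \<Longrightarrow> rat_hom GN r \<Longrightarrow> r x \<noteq> 0 \<Longrightarrow>
      \<exists>e k. hom_N e \<and> polynomial_fun G k e \<and> e x \<noteq> 0"
begin

subsection \<open>Polynomial homomorphisms\<close>

definition poly_homs where "poly_homs = {e. hom_N e \<and> (\<exists>k. polynomial_fun G k e)}"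

lemma poly_homs_lincomb:
  assumes "a \<in> poly_homs" "b \<in> poly_homs"
  shows "(\<lambda>x. p * a x + q * b x) \<in> poly_homs"
proof -
  obtain k l where "polynomial_fun G k a" "polynomial_fun G l b" using assms by (auto simp: poly_homs_def)
  then have "polynomial_fun G (max k l) (\<lambda>x. p * a x + q * b x)"
    by (intro polynomial_fun_lincomb) (auto intro: polynomial_fun_mono)
  then show ?thesis using assms hom_N_lincomb by (auto simp: poly_homs_def)
qed

lemma poly_homs_zero: "(\<lambda>x. 0) \<in> poly_homs"
  using hom_N_zero polynomial_fun_zero by (auto simp: poly_homs_def)

lemma poly_homs_sum: "(\<And>i. i \<in> I \<Longrightarrow> d i \<in> poly_homs) \<Longrightarrow> (\<lambda>x. \<Sum>i\<in>I. v i * d i x) \<in> poly_homs"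
proof (induction I rule: infinite_finite_induct)
  case (insert i I)
  then show ?case using poly_homs_lincomb[of "d i" "\<lambda>x. \<Sum>i\<in>I. v i * d i x" "v i" 1] by simp
qed (simp_all add: poly_homs_zero)

lemma integral_combination:
  assumes "finite I" "I \<subseteq> N"
  shows "\<exists>x\<in>N. \<forall>e. hom_N e \<longrightarrow> e x = (\<Sum>z\<in>I. of_int (k z :: int) * e z)"
  using assms
proof (induction I rule: finite_induct)
  case empty
  show ?case by (intro bexI[of _ \<one>]) (auto simp: hom_N_one)
next
  case (insert z I)
  then obtain x where x: "x \<in> N" "\<And>e. hom_N e \<Longrightarrow> e x = (\<Sum>z\<in>I. of_int (k z) * e z)" by auto
  have z: "z \<in> N" using insert by simp
  have zp: "z [^] k z \<in> N" using subgroup_int_pow_closed[OF subgroup_N z] .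
  have "e (z [^] k z) = of_int (k z) * e z" if "hom_N e" for e
    using GN.rat_hom_int_pow[OF hom_N_rat_hom[OF that], of z "k z"] z
      int_pow_consistent[OF subgroup_N z] by simp
  then have "e (z [^] k z \<otimes> x) = (\<Sum>z\<in>insert z I. of_int (k z) * e z)" if "hom_N e" for e
    using hom_N_mult_N[OF that zp] x insert.hyps that by simp
  then show ?case using zp x by (intro bexI[of _ "z [^] k z \<otimes> x"]) auto
qed

text \<open>\<open>separated\<close> concerns elements of \<open>N\<close>, this concerns rational
  combinations of them: clearing denominators makes such a combination a rational multiple of the
  class of a single element.\<close>

lemma poly_homs_separate:
  assumes I: "finite I" "I \<subseteq> N" and v: "\<And>e. e \<in> poly_homs \<Longrightarrow> (\<Sum>z\<in>I. v z * e z) = 0"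
    and r: "hom_N r"
  shows "(\<Sum>z\<in>I. v z * r z) = 0"
proof (rule ccontr)
  assume nz: "(\<Sum>z\<in>I. v z * r z) \<noteq> 0"
  obtain D :: int where D: "D \<noteq> 0" "\<forall>z\<in>I. \<exists>k::int. of_int D * v z = of_int k"
    using common_denominator[OF I(1)] by blast
  then obtain k where k: "\<And>z. z \<in> I \<Longrightarrow> of_int D * v z = of_int (k z :: int)" by metis
  obtain x where x: "x \<in> N" "\<And>e. hom_N e \<Longrightarrow> e x = (\<Sum>z\<in>I. of_int (k z) * e z)"
    using integral_combination[OF I] by blast
  have val: "e x = of_int D * (\<Sum>z\<in>I. v z * e z)" if "hom_N e" for e
    unfolding x(2)[OF that] sum_distrib_left by (intro sum.cong refl) (simp add: k[symmetric] mult.assoc)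
  have "r x \<noteq> 0" using val[OF r] nz D(1) by simp
  then obtain e k where e: "hom_N e" "polynomial_fun G k e" "e x \<noteq> 0"
    using separated[OF x(1) hom_N_rat_hom[OF r]] by blast
  then have "e \<in> poly_homs" by (auto simp: poly_homs_def)
  then show False using val[OF e(1)] v e(3) by simp
qed

text \<open>The fixed space of the rational abelianization is finite-dimensional, so polynomial
  homomorphisms, which separate its points, induce all functionals on it.\<close>

lemma poly_homs_on_fixed:
  assumes r: "hom_N r"
  shows "\<exists>e\<in>poly_homs. \<forall>z\<in>fixed. e z = r z"
proof -
  \<comment> \<open>Independence of the evaluations at \<open>I\<close> on polynomial homomorphisms.
    The size of \<open>I\<close> is then at most \<open>card S\<close>, and an \<open>I\<close> of
    maximal size serves as a basis of the fixed space.\<close>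
  define P where "P I \<longleftrightarrow> finite I \<and> I \<subseteq> fixed \<and>
    (\<forall>v. (\<forall>e\<in>poly_homs. (\<Sum>i\<in>I. v i * e i) = 0) \<longrightarrow> (\<forall>i\<in>I. v i = (0::rat)))" for I
  have "P {}" by (simp add: P_def)
  moreover have "\<forall>I. P I \<longrightarrow> card I \<le> card S"
  proof (intro allI impI)
    fix I assume PI: "P I"
    show "card I \<le> card S"
    proof (rule ccontr)
      assume "\<not> card I \<le> card S"
      then obtain v where v: "\<exists>z\<in>I. v z \<noteq> 0" "\<And>e. hom_N e \<Longrightarrow> (\<Sum>z\<in>I. v z * e z) = 0"
        using fixed_dependent[OF finite_S S_closed generate_S, of I] PI by (auto simp: P_def)
      then show False using PI unfolding P_def poly_homs_def by blast
    qed
  qed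
  ultimately obtain I where I: "P I" and max: "\<And>J. P J \<Longrightarrow> card J \<le> card I"
    using ex_has_greatest_nat[of P "{}" card "Suc (card S)"] by (metis le_imp_less_Suc)
  have fI: "finite I" "I \<subseteq> fixed" using I by (auto simp: P_def)
  have "\<exists>d. \<forall>i\<in>I. d i \<in> poly_homs \<and> (\<forall>j\<in>I. d i j = (if i = j then 1 else 0))"
    by (rule dual_family[OF fI(1) poly_homs_zero]) (use I poly_homs_lincomb in \<open>auto simp: P_def\<close>)
  then obtain d where d: "\<And>i. i \<in> I \<Longrightarrow> d i \<in> poly_homs"
      "\<And>i j. i \<in> I \<Longrightarrow> j \<in> I \<Longrightarrow> d i j = (if i = j then 1 else 0)" by blast
  define e where "e x = (\<Sum>i\<in>I. r i * d i x)" for x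
  have e: "e \<in> poly_homs" unfolding e_def by (rule poly_homs_sum) (rule d(1))
  have eI: "e z = r z" if "z \<in> I" for z
  proof -
    have "e z = (\<Sum>i\<in>I. if i = z then r i else 0)"
      unfolding e_def using d(2) that by (intro sum.cong) auto
    then show ?thesis using that fI by simp
  qed
  have "e z = r z" if z: "z \<in> fixed" for z
  proof (cases "z \<in> I")
    case False
    \<comment> \<open>By maximality, evaluation at \<open>z\<close> depends on those at
      \<open>I\<close> within \<open>poly_homs\<close>, and \<open>poly_homs_separate\<close>
      carries the relation over to \<open>r\<close>.\<close>
    then have "\<not> P (insert z I)" using max[of "insert z I"] fI by auto
    then obtain v where v: "\<And>e. e \<in> poly_homs \<Longrightarrow> (\<Sum>i\<in>insert z I. v i * e i) = 0"
        "\<exists>i\<in>insert z I. v i \<noteq> 0"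
      using fI z unfolding P_def by auto
    have vz: "v z \<noteq> 0"
    proof
      assume v0: "v z = 0"
      then have "\<forall>e\<in>poly_homs. (\<Sum>i\<in>I. v i * e i) = 0" using v(1) False fI by simp
      then show False using I v(2) v0 unfolding P_def by blast
    qed
    have "finite (insert z I)" "insert z I \<subseteq> N" using fI z by (auto simp: fixed_def)
    then have "(\<Sum>i\<in>insert z I. v i * r i) = 0"
      using v(1) r by (rule poly_homs_separate)
    moreover have "(\<Sum>i\<in>insert z I. v i * e i) = 0" using v(1) e by blast
    moreover have "(\<Sum>i\<in>I. v i * e i) = (\<Sum>i\<in>I. v i * r i)" using eI by (intro sum.cong) auto
    ultimately have "v z * e z = v z * r z" unfolding sum.insert[OF fI(1) False] by linarith
    then show ?thesis using vz by simp
  qed (rule eI)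
  then show ?thesis using e by blast
qed

text \<open>With \<open>e\<close> equal to \<open>r\<close> on fixed elements,
  \<open>q = r - e\<close> vanishes on the kernel of \<open>t - 1\<close> and descends to the image
  of \<open>t - 1\<close>; a homomorphism \<open>h\<close> that extends it from there to
  \<open>N\<close> satisfies \<open>(t - 1) h = q\<close>.\<close>

lemma hom_N_decomp:
  assumes r: "hom_N r"
  shows "\<exists>h. hom_N h \<and> (\<exists>e\<in>poly_homs. \<forall>x\<in>carrier G. r x = h (t \<otimes> x) - h x + e x)"
proof -
  obtain e where e: "e \<in> poly_homs" "\<And>z. z \<in> fixed \<Longrightarrow> e z = r z"
    using poly_homs_on_fixed[OF r] by blast
  have eh: "hom_N e" using e by (simp add: poly_homs_def)
  define q where "q x = 1 * r x + (-1) * e x" for x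
  have q: "hom_N q" unfolding q_def by (rule hom_N_lincomb[OF r eh])
  \<comment> \<open>In the rational abelianization, the class of \<open>x\<close> is
    \<open>t - 1\<close> applied to the class of \<open>y\<close>.\<close>
  define rel where "rel x y \<longleftrightarrow> y \<in> N \<and> (\<forall>a. hom_N a \<longrightarrow> a x = a (t \<otimes> y) - a y)" for x y
  define H where "H = {x \<in> N. \<exists>y. rel x y}"
  define f where "f x = q (SOME y. rel x y)" for x
  have rat: "rat_hom GN a" if "hom_N a" for a using hom_N_rat_hom[OF that] .
  have a_mult: "a (x \<otimes> y) = a x + a y" if "hom_N a" "x \<in> N" "y \<in> N" for a x y
    using hom_N_mult_N[OF that(1,2)] that(3) by simp
  have a_inv: "a (inv x) = - a x" if "hom_N a" "x \<in> N" for a x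
    using GN.rat_hom_inv[OF rat[OF that(1)], of x] that(2) by simp
  have rel_mult: "rel (x \<otimes> x') (y \<otimes> y')" if "rel x y" "rel x' y'" "x \<in> N" "x' \<in> N" for x x' y y'
    unfolding rel_def
  proof (intro conjI allI impI)
    show "y \<otimes> y' \<in> N" using that by (simp add: rel_def)
    fix a assume a: "hom_N a"
    have "a (t \<otimes> (y \<otimes> y')) = a (t \<otimes> y) + a (t \<otimes> y')"
      using hom_N_mult_N[OF hom_N_translate[OF a]] that by (simp add: rel_def)
    moreover have "a (y \<otimes> y') = a y + a y'" using a_mult[OF a] that by (simp add: rel_def)
    moreover have "a x = a (t \<otimes> y) - a y" "a x' = a (t \<otimes> y') - a y'"
      using that(1,2) a unfolding rel_def by blast+
    ultimately show "a (x \<otimes> x') = a (t \<otimes> (y \<otimes> y')) - a (y \<otimes> y')"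
      using a_mult[OF a that(3,4)] by simp
  qed
  have rel_inv: "rel (inv x) (inv y)" if "rel x y" "x \<in> N" for x y
    unfolding rel_def
  proof (intro conjI allI impI)
    have y: "y \<in> N" using that by (simp add: rel_def)
    then show "inv y \<in> N" by simp
    fix a assume a: "hom_N a"
    have "a (t \<otimes> inv y) = - a (t \<otimes> y)"
      using GN.rat_hom_inv[OF rat[OF hom_N_translate[OF a]], of y] y by simp
    moreover have "a x = a (t \<otimes> y) - a y" using that(1) a unfolding rel_def by blast
    ultimately show "a (inv x) = a (t \<otimes> inv y) - a (inv y)"
      using a_inv[OF a that(2)] a_inv[OF a y] by simp
  qed
  have q_unique: "q y = q y'" if "rel x y" "rel x y'" for x y y'
  proof -
    have yN: "y \<in> N" "y' \<in> N" using that by (auto simp: rel_def)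
    have "a (t \<otimes> (y \<otimes> inv y')) = a (y \<otimes> inv y')" if a: "hom_N a" for a
    proof -
      have "a (t \<otimes> (y \<otimes> inv y')) = a (t \<otimes> y) - a (t \<otimes> y')"
        using hom_N_mult_N[OF hom_N_translate[OF a] yN(1), of "inv y'"] yN
          GN.rat_hom_inv[OF rat[OF hom_N_translate[OF a]], of y'] by simp
      moreover have "a (y \<otimes> inv y') = a y - a y'" using a_mult[OF a] a_inv[OF a] yN by simp
      moreover have "a (t \<otimes> y) - a y = a (t \<otimes> y') - a y'"
        using \<open>rel x y\<close> \<open>rel x y'\<close> a unfolding rel_def by metis
      ultimately show ?thesis by simp
    qed
    \<comment> \<open>Two choices of \<open>y\<close> differ by a fixed element, where
      \<open>q\<close> is \<open>0\<close>; so \<open>f\<close> is well defined.\<close>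
    then have "y \<otimes> inv y' \<in> fixed" using yN by (simp add: fixed_def)
    then have "q (y \<otimes> inv y') = 0" using e(2) by (simp add: q_def)
    then show ?thesis using a_mult[OF q] a_inv[OF q] yN by simp
  qed
  have f: "f x = q y" if "rel x y" for x y
    unfolding f_def using q_unique[OF that someI[of "rel x", OF that]] by simp
  have rel_comm: "rel (x \<otimes> y \<otimes> inv x \<otimes> inv y) \<one>" if "x \<in> N" "y \<in> N" for x y
    unfolding rel_def
  proof (intro conjI allI impI)
    fix a assume a: "hom_N a"
    have "a (t \<otimes> \<one>) = 0" using hom_N_t_pow[OF a, of 1] by simp
    then show "a (x \<otimes> y \<otimes> inv x \<otimes> inv y) = a (t \<otimes> \<one>) - a \<one>"
      using that a_mult[OF a] a_inv[OF a] hom_N_one[OF a] by simp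
  qed simp
  have "subgroup H GN"
  proof (rule GN.subgroupI)
    have "\<one> \<in> H" using rel_comm[of \<one> \<one>] by (auto simp: H_def)
    then show "H \<noteq> {}" by blast
  next
    fix x y assume "x \<in> H" "y \<in> H"
    then obtain u v where "x \<in> N" "y \<in> N" "rel x u" "rel y v" by (auto simp: H_def)
    then show "x \<otimes>\<^bsub>GN\<^esub> y \<in> H" using rel_mult[of x u y v] by (auto simp: H_def)
  next
    fix x assume "x \<in> H"
    then obtain u where "x \<in> N" "rel x u" by (auto simp: H_def)
    then show "inv\<^bsub>GN\<^esub> x \<in> H" using rel_inv[of x u] by (auto simp: H_def)
  qed (auto simp: H_def)
  moreover have "rat_hom (GN\<lparr>carrier := H\<rparr>) f"
    unfolding rat_hom_def
  proof (intro ballI)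
    fix x x' assume "x \<in> carrier (GN\<lparr>carrier := H\<rparr>)" "x' \<in> carrier (GN\<lparr>carrier := H\<rparr>)"
    then obtain y y' where xy: "x \<in> N" "x' \<in> N" "rel x y" "rel x' y'" by (auto simp: H_def)
    then have "f (x \<otimes> x') = q (y \<otimes> y')" using f[OF rel_mult] by blast
    also have "\<dots> = q y + q y'" using xy a_mult[OF q] by (simp add: rel_def)
    finally show "f (x \<otimes>\<^bsub>GN\<lparr>carrier := H\<rparr>\<^esub> x') = f x + f x'" using f xy by simp
  qed
  moreover have "x \<otimes>\<^bsub>GN\<^esub> y \<otimes>\<^bsub>GN\<^esub> inv\<^bsub>GN\<^esub> x \<otimes>\<^bsub>GN\<^esub> inv\<^bsub>GN\<^esub> y \<in> H \<and>
      f (x \<otimes>\<^bsub>GN\<^esub> y \<otimes>\<^bsub>GN\<^esub> inv\<^bsub>GN\<^esub> x \<otimes>\<^bsub>GN\<^esub> inv\<^bsub>GN\<^esub> y) = 0"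
    if "x \<in> carrier GN" "y \<in> carrier GN" for x y
    using rel_comm[of x y] f[OF rel_comm[of x y]] that hom_N_one[OF q] by (auto simp: H_def)
  ultimately obtain h0 where h0: "rat_hom GN h0" "\<And>x. x \<in> H \<Longrightarrow> h0 x = f x"
    using GN.rat_hom_extend[of H f] by blast
  define h where "h x = h0 (proj x)" for x
  have h: "hom_N h" unfolding h_def by (rule hom_N_proj[OF h0(1)])
  have hN: "h (t \<otimes> y) - h y = q y" if y: "y \<in> N" for y
  proof -
    \<comment> \<open>This commutator represents \<open>t - 1\<close> applied to \<open>y\<close>,
      so it lies in \<open>H\<close>, where \<open>h\<close> is known.\<close>
    define x where "x = t \<otimes> y \<otimes> inv t \<otimes> inv y"
    have x: "x \<in> N" using y by (simp add: x_def)
    have val: "a x = a (t \<otimes> y) - a y" if a: "hom_N a" for a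
    proof -
      have "a x = a (t \<otimes> y \<otimes> inv t) + a (inv y)" unfolding x_def using y by (intro a_mult[OF a]) auto
      also have "a (t \<otimes> y \<otimes> inv t) = a (t \<otimes> y)"
        using y by (intro invariant_inv_t[OF hom_N_invariant[OF a]]) auto
      finally show ?thesis using a_inv[OF a y] by simp
    qed
    then have "rel x y" using y by (simp add: rel_def)
    then have "h x = q y" using x h0(2)[of x] f by (auto simp: h_def H_def)
    then show ?thesis using val[OF h] by simp
  qed
  have "r x = h (t \<otimes> x) - h x + e x" if x: "x \<in> carrier G" for x
  proof -
    have "h (t \<otimes> proj x) - h (proj x) = q (proj x)" using hN x by simp
    then show ?thesis
      using invariant_left_proj[OF hom_N_invariant[OF h] t_closed x]
        invariant_proj[OF hom_N_invariant[OF h] x] invariant_proj[OF hom_N_invariant[OF q] x]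
      by (simp add: q_def)
  qed
  then show ?thesis using h e(1) by blast
qed

end

context infinite_cyclic_extension
begin

subsection \<open>Cocycles\<close>

text \<open>The recursion applies \<open>t - 1\<close> for the diagonal action of \<open>t\<close>
  by conjugation. The second argument is merely translated, which for functions invariant under
  right multiplication by \<open>t\<close> is the same.\<close>

primrec unipotent_cochain :: "nat \<Rightarrow> ('a \<Rightarrow> 'a \<Rightarrow> rat) \<Rightarrow> bool" where
  "unipotent_cochain 0 c \<longleftrightarrow> (\<forall>y \<in> N. \<forall>x \<in> carrier G. c y x = 0)"
| "unipotent_cochain (Suc m) c \<longleftrightarrow>
     unipotent_cochain m (\<lambda>y x. c (t \<otimes> y \<otimes> inv t) (t \<otimes> x) - c y x)"

lemma unipotent_cochain_cong:
  "unipotent_cochain m c \<Longrightarrow> (\<And>y x. y \<in> N \<Longrightarrow> x \<in> carrier G \<Longrightarrow> c y x = c' y x) \<Longrightarrow>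
    unipotent_cochain m c'"
proof (induction m arbitrary: c c')
  case (Suc m)
  show ?case unfolding unipotent_cochain.simps
    by (rule Suc.IH[OF Suc.prems(1)[unfolded unipotent_cochain.simps]]) (simp add: Suc.prems(2))
qed auto

lemma unipotent_cochain_zero: "unipotent_cochain m (\<lambda>y x. 0)"
  by (induction m) auto

lemma unipotent_cochain_add:
  "unipotent_cochain m c \<Longrightarrow> unipotent_cochain m c' \<Longrightarrow> unipotent_cochain m (\<lambda>y x. c y x + c' y x)"
proof (induction m arbitrary: c c')
  case (Suc m)
  show ?case unfolding unipotent_cochain.simps
    by (rule unipotent_cochain_cong[OF Suc.IH[OF Suc.prems[unfolded unipotent_cochain.simps]]])
      (simp add: algebra_simps)
qed auto

lemma unipotent_cochain_sum:
  "(\<And>i. i \<in> I \<Longrightarrow> unipotent_cochain m (c i)) \<Longrightarrow> unipotent_cochain m (\<lambda>y x. \<Sum>i\<in>I. c i y x)"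
  by (induction I rule: infinite_finite_induct) (auto intro: unipotent_cochain_zero unipotent_cochain_add)

lemma invariant_translate_diff: "invariant u \<Longrightarrow> invariant (\<lambda>x. u (t \<otimes> x) - u x)"
  by (simp add: invariant_def m_assoc[symmetric])

text \<open>Applying \<open>t - 1\<close> to a product gives three products, in each of which
  \<open>t - 1\<close> falls on at least one factor; so the total degree \<open>k + l\<close>
  drops.\<close>

lemma unipotent_cochain_product:
  assumes "polynomial_fun G k u" "polynomial_fun G l w" "invariant u"
  shows "unipotent_cochain (k + l) (\<lambda>y x. u y * w x)"
  using assms
proof (induction "k + l" arbitrary: k l u w)
  case (Suc n)
  show ?case
  proof (cases "k = 0 \<or> l = 0")
    case True
    then have "u y * w x = 0" if "y \<in> N" "x \<in> carrier G" for y x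
      using Suc.prems that by auto
    then show ?thesis by (intro unipotent_cochain_cong[OF unipotent_cochain_zero]) simp
  next
    case False
    then obtain k' l' where kl: "k = Suc k'" "l = Suc l'" by (metis not0_implies_Suc)
    define u' w' where "u' x = u (t \<otimes> x) - u x" and "w' x = w (t \<otimes> x) - w x" for x
    have u': "polynomial_fun G k' u'" "polynomial_fun G k u'" "invariant u'"
      and w': "polynomial_fun G l' w'" "polynomial_fun G l w'"
      using Suc.prems invariant_translate_diff[OF Suc.prems(3)] polynomial_fun_Suc[of k' u'] polynomial_fun_Suc[of l' w']
      unfolding u'_def w'_def kl by auto
    have "unipotent_cochain n (\<lambda>y x. u' y * w x)" "unipotent_cochain n (\<lambda>y x. u y * w' x)"
      "unipotent_cochain n (\<lambda>y x. u' y * w' x)"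
      using Suc.hyps(1)[of k' l u' w] Suc.hyps(1)[of k l' u w'] Suc.hyps(1)[of k' l u' w'] Suc.hyps(2)
        Suc.prems u' w' kl by auto
    then have "unipotent_cochain n (\<lambda>y x. u' y * w x + u y * w' x + u' y * w' x)"
      by (intro unipotent_cochain_add)
    then have "unipotent_cochain n (\<lambda>y x. u (t \<otimes> y \<otimes> inv t) * w (t \<otimes> x) - u y * w x)"
    proof (rule unipotent_cochain_cong)
      fix y x assume "y \<in> N" "x \<in> carrier G"
      then have "u (t \<otimes> y \<otimes> inv t) = u (t \<otimes> y)"
        by (intro invariant_inv_t[OF Suc.prems(3)]) auto
      then show "u' y * w x + u y * w' x + u' y * w' x = u (t \<otimes> y \<otimes> inv t) * w (t \<otimes> x) - u y * w x"
        by (simp add: u'_def w'_def algebra_simps)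
    qed
    then show ?thesis by (simp flip: Suc.hyps(2))
  qed
qed simp

text \<open>Normalized 2-cocycles of \<open>N\<close> with values in \<open>\<rat>\<close>, the
  second argument being extended to \<open>G\<close>. The degree bound \<open>k\<close> is uniform
  in \<open>y\<close>, so that a cochain with such a coboundary can have finite degree.\<close>

definition cocycle where
  "cocycle k c \<longleftrightarrow>
    (\<forall>y \<in> N. polynomial_fun G k (c y) \<and> invariant (c y) \<and> c y \<one> = 0) \<and> (\<forall>x \<in> carrier G. c \<one> x = 0) \<and>
    (\<forall>y \<in> N. \<forall>y' \<in> N. \<forall>x \<in> carrier G. c y y' + c (y \<otimes> y') x = c y' x + c y (y' \<otimes> x))"

lemma cocycle_translate:
  assumes "cocycle k c"
  shows "cocycle k (\<lambda>y x. c (t \<otimes> y \<otimes> inv t) (t \<otimes> x) - c y x)"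
proof -
  have inv: "invariant (c y)" if "y \<in> N" for y using assms that by (simp add: cocycle_def)
  have coc: "c y y' + c (y \<otimes> y') x = c y' x + c y (y' \<otimes> x)" if "y \<in> N" "y' \<in> N" "x \<in> carrier G" for y y' x
    using assms that by (simp add: cocycle_def)
  show ?thesis
    unfolding cocycle_def
  proof (intro conjI ballI)
    fix y assume y: "y \<in> N"
    show "polynomial_fun G k (\<lambda>x. c (t \<otimes> y \<otimes> inv t) (t \<otimes> x) - c y x)"
      using assms y by (intro polynomial_fun_diff polynomial_fun_translate) (auto simp: cocycle_def)
    show "invariant (\<lambda>x. c (t \<otimes> y \<otimes> inv t) (t \<otimes> x) - c y x)"
      using inv[OF y] inv[OF N_conj[OF y]] by (simp add: invariant_def m_assoc[symmetric])
    have "c (t \<otimes> y \<otimes> inv t) (\<one> \<otimes> t) = c (t \<otimes> y \<otimes> inv t) \<one>"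
      using inv[OF N_conj[OF y]] by (simp only: invariant_def one_closed)
    then show "c (t \<otimes> y \<otimes> inv t) (t \<otimes> \<one>) - c y \<one> = 0"
      using assms y by (simp add: cocycle_def)
  next
    fix x assume "x \<in> carrier G"
    then show "c (t \<otimes> \<one> \<otimes> inv t) (t \<otimes> x) - c \<one> x = 0" using assms by (simp add: cocycle_def)
  next
    fix y y' x assume y: "y \<in> N" "y' \<in> N" and x: "x \<in> carrier G"
    let ?c = "\<lambda>y. t \<otimes> y \<otimes> inv t"
    have "?c y \<otimes> ?c y' = ?c (y \<otimes> y')" using y by (simp add: m_assoc inv_cancel)
    moreover have "?c y' \<otimes> (t \<otimes> x) = t \<otimes> (y' \<otimes> x)" using y x by (simp add: m_assoc inv_cancel)
    moreover have "c (?c y) (?c y') = c (?c y) (t \<otimes> y')"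
      using y by (intro invariant_inv_t inv) auto
    ultimately have "c (?c y) (t \<otimes> y') + c (?c (y \<otimes> y')) (t \<otimes> x) = c (?c y') (t \<otimes> x) + c (?c y) (t \<otimes> (y' \<otimes> x))"
      using coc[of "?c y" "?c y'" "t \<otimes> x"] y x by simp
    then show "c (?c y) (t \<otimes> y') - c y y' + (c (?c (y \<otimes> y')) (t \<otimes> x) - c (y \<otimes> y') x) =
      c (?c y') (t \<otimes> x) - c y' x + (c (?c y) (t \<otimes> (y' \<otimes> x)) - c y (y' \<otimes> x))"
      using coc[OF y x] by simp
  qed
qed

end

context unipotent_free_extension
begin

text \<open>A cochain \<open>h\<close> with coboundary \<open>c\<close> exists because \<open>N\<close> is free; its \<open>t\<close>-difference is a
  polynomial function, known by induction, up to a homomorphism \<open>r\<close>, which is removed with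
  \<open>hom_N_decomp\<close>.\<close>

lemma cocycle_trivial:
  assumes "cocycle k c" "unipotent_cochain m c"
  shows "\<exists>h l. polynomial_fun G l h \<and> invariant h \<and>
    (\<forall>y \<in> N. \<forall>x \<in> carrier G. h (y \<otimes> x) = h y + h x + c y x)"
  using assms
proof (induction m arbitrary: c)
  case 0
  then have "\<forall>y \<in> N. \<forall>x \<in> carrier G. (0::rat) = 0 + 0 + c y x" by simp
  moreover have "invariant (\<lambda>x. 0)" by (simp add: invariant_def)
  ultimately show ?case using polynomial_fun_zero[of 0] by (intro exI[of _ "\<lambda>x. 0"] exI[of _ 0]) blast
next
  case (Suc m)
  define c' where "c' = (\<lambda>y x. c (t \<otimes> y \<otimes> inv t) (t \<otimes> x) - c y x)"
  have "cocycle k c'" unfolding c'_def by (rule cocycle_translate[OF Suc.prems(1)])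
  moreover have "unipotent_cochain m c'" using Suc.prems(2) by (simp add: c'_def)
  ultimately obtain q l where q: "polynomial_fun G l q" "invariant q"
    "\<And>y x. y \<in> N \<Longrightarrow> x \<in> carrier G \<Longrightarrow> q (y \<otimes> x) = q y + q x + c' y x"
    using Suc.IH by blast
  have c_inv: "invariant (c y)" and c_poly: "polynomial_fun G k (c y)" if "y \<in> N" for y
    using Suc.prems(1) that by (simp_all add: cocycle_def)
  have "\<exists>h. \<forall>x\<in>carrier GN. \<forall>y\<in>carrier GN. h (x \<otimes>\<^bsub>GN\<^esub> y) = h x + h y + c x y"
    by (rule GN.free_basis_cocycle[OF basis]) (use Suc.prems(1) in \<open>auto simp: cocycle_def\<close>)
  then obtain h0 where h0: "\<And>x y. x \<in> N \<Longrightarrow> y \<in> N \<Longrightarrow> h0 (x \<otimes> y) = h0 x + h0 y + c x y" by auto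
  define h1 where "h1 x = h0 (proj x)" for x
  have h1_inv: "invariant h1" by (simp add: h1_def invariant_def)
  have h1: "h1 (y \<otimes> x) = h1 y + h1 x + c y x" if "y \<in> N" "x \<in> carrier G" for y x
    using that h0[of y "proj x"] invariant_proj[OF c_inv[OF that(1)] that(2)] by (simp add: h1_def)
  \<comment> \<open>\<open>q\<close> and the \<open>t\<close>-difference of \<open>h1\<close> have
    the same coboundary \<open>c'\<close>, so \<open>r\<close> is a homomorphism.\<close>
  define r where "r x = h1 (t \<otimes> x) - h1 x - q x" for x
  have "hom_N r"
    unfolding hom_N_def
  proof (intro conjI ballI)
    show "invariant r"
      using h1_inv q(2) by (simp add: r_def invariant_def m_assoc[symmetric])
    fix y x assume y: "y \<in> N" and x: "x \<in> carrier G"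
    have "h1 (t \<otimes> (y \<otimes> x)) = h1 (t \<otimes> y \<otimes> inv t \<otimes> (t \<otimes> x))"
      using x y by (simp add: m_assoc inv_cancel)
    also have "\<dots> = h1 (t \<otimes> y \<otimes> inv t) + h1 (t \<otimes> x) + c (t \<otimes> y \<otimes> inv t) (t \<otimes> x)"
      using x y by (intro h1) auto
    also have "h1 (t \<otimes> y \<otimes> inv t) = h1 (t \<otimes> y)"
      using y by (intro invariant_inv_t[OF h1_inv]) auto
    finally show "r (y \<otimes> x) = r y + r x"
      using h1[OF y x] q(3)[OF y x] by (simp add: r_def c'_def)
  qed
  then obtain h e where h: "hom_N h" and e: "e \<in> poly_homs"
    and r: "\<And>x. x \<in> carrier G \<Longrightarrow> r x = h (t \<otimes> x) - h x + e x"
    using hom_N_decomp by blast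
  obtain l' where l': "polynomial_fun G l' e" using e by (auto simp: poly_homs_def)
  \<comment> \<open>Subtracting \<open>h\<close> keeps the coboundary and reduces the
    \<open>t\<close>-difference from \<open>q + r\<close> to \<open>q + e\<close>.\<close>
  define h2 where "h2 x = h1 x - h x" for x
  have h2: "h2 (y \<otimes> x) = h2 y + h2 x + c y x" if "y \<in> N" "x \<in> carrier G" for y x
    using h1[OF that] hom_N_mult_N[OF h that] by (simp add: h2_def)
  \<comment> \<open>Differences along \<open>N\<close> are a constant plus a function of degree
    \<open>< k\<close>, whence \<open>Suc k\<close>; the difference along \<open>t\<close> is
    \<open>q + e\<close>, whence \<open>l\<close> and \<open>l'\<close>.\<close>
  define n where "n = max (Suc k) (max l l')"
  have "polynomial_fun G (Suc n) h2"
  proof (rule polynomial_fun_SucI[OF _ generate_N_t])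
    show "insert t N \<subseteq> carrier G" by auto
    fix g assume "g \<in> insert t N"
    then consider "g = t" | "g \<in> N" by blast
    then show "polynomial_fun G n (\<lambda>x. h2 (g \<otimes> x) - h2 x)"
    proof cases
      case 1
      have "polynomial_fun G n (\<lambda>x. q x + e x)"
        using polynomial_fun_mono[OF q(1), of n] polynomial_fun_mono[OF l', of n]
        by (intro polynomial_fun_add) (auto simp: n_def)
      then show ?thesis
      proof (rule polynomial_fun_cong)
        fix x assume x: "x \<in> carrier G"
        then show "q x + e x = h2 (g \<otimes> x) - h2 x" using 1 r[OF x] by (simp add: r_def h2_def)
      qed
    next
      case 2
      have "polynomial_fun G n (\<lambda>x. h2 g + c g x)"
        using polynomial_fun_mono[OF polynomial_fun_const[of k "h2 g"], of n]
          polynomial_fun_mono[OF c_poly[OF 2], of n]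
        by (intro polynomial_fun_add) (auto simp: n_def)
      then show ?thesis by (rule polynomial_fun_cong) (simp add: h2[OF 2])
    qed
  qed
  moreover have "invariant h2"
    using h1_inv hom_N_invariant[OF h] by (simp add: h2_def invariant_def)
  ultimately show ?case using h2 by blast
qed

subsection \<open>Iterated integrals\<close>

text \<open>The last clause is Chen's rule for iterated integrals along a composite path. Words are
  bounded by a length \<open>n\<close> so that a family can be extended one length at a
  time.\<close>

definition integral_family where
  "integral_family n F \<longleftrightarrow> F [] = (\<lambda>x. 1) \<and>
    (\<forall>as. set as \<subseteq> poly_homs \<and> length as \<le> n \<longrightarrow>
      (\<exists>k. polynomial_fun G k (F as)) \<and> invariant (F as) \<and> (as \<noteq> [] \<longrightarrow> F as \<one> = 0) \<and>
      (\<forall>a. as = [a] \<longrightarrow> F as = a) \<and>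
      (\<forall>y \<in> N. \<forall>x \<in> carrier G. F as (y \<otimes> x) = (\<Sum>i=0..length as. F (take i as) y * F (drop i as) x)))"

text \<open>The terms of the product rule with two proper factors form a 2-cocycle, as for Massey
  products. It is polynomial and unipotent because the shorter integrals are polynomial, so
  \<open>cocycle_trivial\<close> provides the next integral.\<close>

lemma integral_family_step:
  assumes F: "integral_family n F" and as: "set as \<subseteq> poly_homs" "length as = Suc n"
  shows "\<exists>h k. polynomial_fun G k h \<and> invariant h \<and> h \<one> = 0 \<and> (\<forall>a. as = [a] \<longrightarrow> h = a) \<and>
    (\<forall>y \<in> N. \<forall>x \<in> carrier G. h (y \<otimes> x) = h y + h x + (\<Sum>i=1..n. F (take i as) y * F (drop i as) x))"
proof (cases "n = 0")
  case True
  then obtain a where a: "as = [a]" "a \<in> poly_homs" using as by (cases as) auto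
  then obtain k where "hom_N a" "polynomial_fun G k a" by (auto simp: poly_homs_def)
  then show ?thesis using a True hom_N_one[of a] hom_N_invariant[of a] hom_N_mult_N[of a]
    by (intro exI[of _ a] exI[of _ k]) auto
next
  case False
  have take_drop: "set (take i as) \<subseteq> poly_homs" "set (drop i as) \<subseteq> poly_homs" for i
    using as(1) by (meson set_drop_subset set_take_subset subset_trans)+
  have sub: "(\<exists>k. polynomial_fun G k (F bs)) \<and> invariant (F bs) \<and> (bs \<noteq> [] \<longrightarrow> F bs \<one> = 0) \<and>
      (\<forall>y \<in> N. \<forall>x \<in> carrier G. F bs (y \<otimes> x) = (\<Sum>i=0..length bs. F (take i bs) y * F (drop i bs) x))"
    if "set bs \<subseteq> poly_homs" "length bs \<le> n" for bs
    using F that by (simp add: integral_family_def)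
  define c where "c y x = (\<Sum>i=1..n. F (take i as) y * F (drop i as) x)" for y x
  have len: "length (take i as) = i" "length (drop i as) = Suc n - i" "take i as \<noteq> []" "drop i as \<noteq> []"
    if "i \<in> {1..n}" for i using that as(2) by auto
  have take_sub: "(\<exists>k. polynomial_fun G k (F (take i as))) \<and> invariant (F (take i as)) \<and> F (take i as) \<one> = 0"
    and drop_sub: "(\<exists>k. polynomial_fun G k (F (drop i as))) \<and> invariant (F (drop i as)) \<and> F (drop i as) \<one> = 0"
    if "i \<in> {1..n}" for i
    using sub[OF take_drop(1)[of i]] sub[OF take_drop(2)[of i]] len[OF that] that by auto
  have "\<exists>k. \<forall>i\<in>{1..n}. polynomial_fun G k (F (take i as))"
    by (rule polynomial_fun_common_degree) (use take_sub in blast)+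
  then obtain k where k: "\<And>i. i \<in> {1..n} \<Longrightarrow> polynomial_fun G k (F (take i as))" by blast
  have "\<exists>k. \<forall>i\<in>{1..n}. polynomial_fun G k (F (drop i as))"
    by (rule polynomial_fun_common_degree) (use drop_sub in blast)+
  then obtain l where l: "\<And>i. i \<in> {1..n} \<Longrightarrow> polynomial_fun G l (F (drop i as))" by blast
  have "unipotent_cochain (k + l) c"
    unfolding c_def by (intro unipotent_cochain_sum unipotent_cochain_product k l) (use take_sub in auto)
  moreover have "cocycle l c"
    unfolding cocycle_def
  proof (intro conjI ballI)
    fix y assume y: "y \<in> N"
    show "polynomial_fun G l (c y)"
      unfolding c_def by (intro polynomial_fun_sum polynomial_fun_scale l)
    show "invariant (c y)"
      using drop_sub by (auto simp: c_def invariant_def intro!: sum.cong)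
    show "c y \<one> = 0" unfolding c_def using drop_sub by (intro sum.neutral) auto
  next
    fix x assume "x \<in> carrier G"
    show "c \<one> x = 0" unfolding c_def using take_sub by (intro sum.neutral) auto
  next
    fix y y' x assume y: "y \<in> N" "y' \<in> N" and x: "x \<in> carrier G"
    \<comment> \<open>\<open>A j i\<close> cuts \<open>as\<close> into three pieces, at
      \<open>j\<close> and \<open>i\<close>. Both \<open>c (y \<otimes> y') x\<close> and
      \<open>c y (y' \<otimes> x)\<close> contain the triangle
      \<open>1 \<le> j \<le> i \<le> n\<close>; the remaining edges \<open>j = 0\<close> and
      \<open>i = Suc n\<close> are \<open>c y' x\<close> and \<open>c y y'\<close>.\<close>
    define A where "A j i = F (take j as) y * F (take (i - j) (drop j as)) y' * F (drop i as) x" for j i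
    have F0: "F [] = (\<lambda>x. 1)" using F by (simp add: integral_family_def)
    have "c (y \<otimes> y') x = (\<Sum>i=1..n. \<Sum>j=0..i. A j i)"
      unfolding c_def
    proof (intro sum.cong refl)
      fix i assume i: "i \<in> {1..n}"
      have "F (take i as) (y \<otimes> y') = (\<Sum>j=0..i. F (take j (take i as)) y * F (drop j (take i as)) y')"
        using sub[OF take_drop(1)[of i]] len[OF i] i y by auto
      also have "\<dots> = (\<Sum>j=0..i. F (take j as) y * F (take (i - j) (drop j as)) y')"
        by (intro sum.cong refl) (simp add: drop_take min_def)
      finally show "F (take i as) (y \<otimes> y') * F (drop i as) x = (\<Sum>j=0..i. A j i)"
        by (simp add: A_def sum_distrib_right)
    qed
    also have "\<dots> = (\<Sum>i=1..n. A 0 i) + (\<Sum>i=1..n. \<Sum>j=1..i. A j i)"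
      by (simp add: sum.atLeast_Suc_atMost[of 0] sum.distrib)
    also have "(\<Sum>i=1..n. A 0 i) = c y' x"
      unfolding c_def A_def by (simp add: F0)
    finally have 1: "c (y \<otimes> y') x = c y' x + (\<Sum>i=1..n. \<Sum>j=1..i. A j i)" .
    have "c y (y' \<otimes> x) = (\<Sum>j=1..n. \<Sum>i=j..Suc n. A j i)"
      unfolding c_def
    proof (intro sum.cong refl)
      fix j assume j: "j \<in> {1..n}"
      have "F (drop j as) (y' \<otimes> x) = (\<Sum>i=0..Suc n - j. F (take i (drop j as)) y' * F (drop i (drop j as)) x)"
        using sub[OF take_drop(2)[of j]] len[OF j] j y x by auto
      also have "\<dots> = (\<Sum>i=j..Suc n. F (take (i - j) (drop j as)) y' * F (drop i as) x)"
        using j by (intro sum.reindex_bij_witness[of _ "\<lambda>i. i - j" "\<lambda>i. i + j"]) auto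
      finally show "F (take j as) y * F (drop j as) (y' \<otimes> x) = (\<Sum>i=j..Suc n. A j i)"
        by (simp only: A_def sum_distrib_left mult.assoc)
    qed
    also have "\<dots> = (\<Sum>j=1..n. (\<Sum>i=j..n. A j i) + A j (Suc n))"
      by (intro sum.cong) auto
    also have "\<dots> = (\<Sum>j=1..n. \<Sum>i=j..n. A j i) + (\<Sum>j=1..n. A j (Suc n))"
      by (rule sum.distrib)
    also have "(\<Sum>j=1..n. A j (Suc n)) = c y y'"
      unfolding c_def A_def using as(2) by (intro sum.cong refl) (simp add: F0)
    finally show "c y y' + c (y \<otimes> y') x = c y' x + c y (y' \<otimes> x)"
      unfolding 1 sum_triangle by simp
  qed
  ultimately obtain h m where h: "polynomial_fun G m h" "invariant h"
      "\<And>y x. y \<in> N \<Longrightarrow> x \<in> carrier G \<Longrightarrow> h (y \<otimes> x) = h y + h x + c y x"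
    using cocycle_trivial by blast
  have "c \<one> \<one> = 0" using \<open>cocycle l c\<close> by (simp add: cocycle_def)
  then have "h \<one> = 0" using h(3)[of \<one> \<one>] by simp
  moreover have "\<nexists>a. as = [a]" using as(2) False by auto
  ultimately show ?thesis using h unfolding c_def by blast
qed

lemma integral_family_exists: "\<exists>F. integral_family n F"
proof (induction n)
  case 0
  have "invariant (\<lambda>x. 1)" by (simp add: invariant_def)
  then show ?case using polynomial_fun_const[of 0 1] unfolding integral_family_def
    by (intro exI[of _ "\<lambda>_ _. 1"]) (auto simp del: polynomial_fun.simps)
next
  case (Suc n)
  then obtain F where F: "integral_family n F" by blast
  define Q where "Q as h \<longleftrightarrow>
    (\<exists>k. polynomial_fun G k h) \<and> invariant h \<and> h \<one> = 0 \<and> (\<forall>a. as = [a] \<longrightarrow> h = a) \<and>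
    (\<forall>y \<in> N. \<forall>x \<in> carrier G. h (y \<otimes> x) = h y + h x + (\<Sum>i=1..n. F (take i as) y * F (drop i as) x))" for as h
  define h where "h as = (SOME h. Q as h)" for as
  have h: "Q as (h as)" if "set as \<subseteq> poly_homs" "length as = Suc n" for as
  proof -
    have "\<exists>h. Q as h" using integral_family_step[OF F that] unfolding Q_def by blast
    then show ?thesis unfolding h_def by (rule someI_ex)
  qed
  define F' where "F' as = (if length as \<le> n then F as else h as)" for as
  have F0: "F [] = (\<lambda>x. 1)" using F by (simp add: integral_family_def)
  have "integral_family (Suc n) F'"
    unfolding integral_family_def
  proof (intro conjI[OF _ allI] impI)
    show "F' [] = (\<lambda>x. 1)" by (simp add: F'_def F0)
    fix as assume as: "set as \<subseteq> poly_homs \<and> length as \<le> Suc n"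
    show "(\<exists>k. polynomial_fun G k (F' as)) \<and> invariant (F' as) \<and> (as \<noteq> [] \<longrightarrow> F' as \<one> = 0) \<and>
      (\<forall>a. as = [a] \<longrightarrow> F' as = a) \<and>
      (\<forall>y \<in> N. \<forall>x \<in> carrier G. F' as (y \<otimes> x) = (\<Sum>i=0..length as. F' (take i as) y * F' (drop i as) x))"
    proof (cases "length as \<le> n")
      case True
      have "length (take i as) \<le> n" "length (drop i as) \<le> n" for i using True by auto
      then have e: "F' as = F as" "F' (take i as) = F (take i as)" "F' (drop i as) = F (drop i as)" for i
        unfolding F'_def using True by (simp_all only: if_True)
      show ?thesis unfolding e using F as True unfolding integral_family_def by blast
    next
      case False
      then have len: "length as = Suc n" using as by simp
      note h' = h[OF conjunct1[OF as] len, unfolded Q_def]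
      have e: "F' as = h as" by (simp add: F'_def len)
      have "F' as (y \<otimes> x) = (\<Sum>i=0..length as. F' (take i as) y * F' (drop i as) x)"
        if "y \<in> N" "x \<in> carrier G" for y x
      proof -
        have "(\<Sum>i=0..Suc n. F' (take i as) y * F' (drop i as) x) =
          F' (take 0 as) y * F' (drop 0 as) x + (\<Sum>i=1..n. F' (take i as) y * F' (drop i as) x)
          + F' (take (Suc n) as) y * F' (drop (Suc n) as) x"
          by (simp add: sum.atLeast_Suc_atMost[of 0])
        also have "(\<Sum>i=1..n. F' (take i as) y * F' (drop i as) x) = (\<Sum>i=1..n. F (take i as) y * F (drop i as) x)"
          by (intro sum.cong refl) (auto simp: F'_def len)
        also have "F' (take 0 as) y * F' (drop 0 as) x = h as x" by (simp add: F'_def[of "[]"] F0 e)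
        also have "F' (take (Suc n) as) y * F' (drop (Suc n) as) x = h as y"
          using len by (simp add: F'_def[of "[]"] F0 e)
        finally show ?thesis using h' that len e by simp
      qed
      then show ?thesis using h' unfolding e by blast
    qed
  qed
  then show ?case by blast
qed

end

section \<open>Iterated integrals on subgroups of \<open>N\<close>\<close>

context unipotent_free_extension
begin

lemma integral_family_mult:
  assumes "integral_family n F" "set as \<subseteq> poly_homs" "length as \<le> n" "y \<in> N" "x \<in> carrier G"
  shows "F as (y \<otimes> x) = (\<Sum>i=0..length as. F (take i as) y * F (drop i as) x)"
  using assms unfolding integral_family_def by blast

text \<open>Inside \<open>N\<close> every difference removes at least one letter, so the length
  bounds the degree. On \<open>G\<close> no such bound holds in general, already for words of one
  letter.\<close>

lemma integral_family_polynomial: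
  assumes F: "integral_family n F" and M: "subgroup M G" "M \<subseteq> N"
    and as: "set as \<subseteq> poly_homs" "length as \<le> n"
  shows "polynomial_fun (G\<lparr>carrier := M\<rparr>) (Suc (length as)) (F as)"
  using as
proof (induction "length as" arbitrary: as rule: less_induct)
  case less
  interpret M: group "G\<lparr>carrier := M\<rparr>" by (rule subgroup_imp_group[OF M(1)])
  show ?case unfolding polynomial_fun.simps
  proof
    fix y assume "y \<in> carrier (G\<lparr>carrier := M\<rparr>)"
    then have y: "y \<in> N" using M by auto
    have "polynomial_fun (G\<lparr>carrier := M\<rparr>) (length as) (\<lambda>x. \<Sum>i=1..length as. F (take i as) y * F (drop i as) x)"
    proof (intro M.polynomial_fun_sum M.polynomial_fun_scale)
      fix i assume i: "i \<in> {1..length as}"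
      have "set (drop i as) \<subseteq> poly_homs" using less.prems(1) by (meson set_drop_subset subset_trans)
      then have "polynomial_fun (G\<lparr>carrier := M\<rparr>) (Suc (length (drop i as))) (F (drop i as))"
        using i less.prems(2) by (intro less.hyps) auto
      then show "polynomial_fun (G\<lparr>carrier := M\<rparr>) (length as) (F (drop i as))"
        by (rule M.polynomial_fun_mono) (use i in auto)
    qed
    then show "polynomial_fun (G\<lparr>carrier := M\<rparr>) (length as) (\<lambda>x. F as (y \<otimes>\<^bsub>G\<lparr>carrier := M\<rparr>\<^esub> x) - F as x)"
    proof (rule M.polynomial_fun_cong)
      fix x assume "x \<in> carrier (G\<lparr>carrier := M\<rparr>)"
      then have x: "x \<in> carrier G" using M by auto
      have "F as (y \<otimes> x) = (\<Sum>i=0..length as. F (take i as) y * F (drop i as) x)"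
        by (rule integral_family_mult[OF F less.prems y x])
      also have "\<dots> = F [] y * F as x + (\<Sum>i=1..length as. F (take i as) y * F (drop i as) x)"
        by (simp add: sum.atLeast_Suc_atMost[of 0])
      finally show "(\<Sum>i=1..length as. F (take i as) y * F (drop i as) x) = F as (y \<otimes>\<^bsub>G\<lparr>carrier := M\<rparr>\<^esub> x) - F as x"
        using F by (simp add: integral_family_def)
    qed
  qed
qed

inductive integral_span :: "(('a \<Rightarrow> rat) list \<Rightarrow> 'a \<Rightarrow> rat) \<Rightarrow> nat \<Rightarrow> ('a \<Rightarrow> rat) \<Rightarrow> bool" for F m where
  zero: "integral_span F m (\<lambda>x. 0)"
| add: "integral_span F m w \<Longrightarrow> set as \<subseteq> poly_homs \<Longrightarrow> length as = m \<Longrightarrow>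
    integral_span F m (\<lambda>x. a * F as x + w x)"

lemma integral_span_plus:
  "integral_span F m w \<Longrightarrow> integral_span F m w' \<Longrightarrow> integral_span F m (\<lambda>x. w x + w' x)"
proof (induction rule: integral_span.induct)
  case (add w as a)
  then have "integral_span F m (\<lambda>x. a * F as x + (w x + w' x))" by (intro integral_span.add)
  then show ?case by (simp add: add.assoc)
qed simp

lemma integral_span_sum:
  "(\<And>b. b \<in> I \<Longrightarrow> integral_span F m (w b)) \<Longrightarrow> integral_span F m (\<lambda>x. \<Sum>b\<in>I. w b x)"
  by (induction I rule: infinite_finite_induct) (auto intro: integral_span.zero integral_span_plus)

lemma integral_span_polynomial:
  assumes F: "integral_family n F" and "m \<le> n" and "integral_span F m w"
  shows "\<exists>k. polynomial_fun G k w"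
  using assms(3)
proof (induction rule: integral_span.induct)
  case zero
  then show ?case using polynomial_fun_zero by blast
next
  case (add w as a)
  then obtain k l where kl: "polynomial_fun G k w" "polynomial_fun G l (F as)"
    using F \<open>m \<le> n\<close> unfolding integral_family_def by blast
  have "polynomial_fun G (max k l) (\<lambda>x. a * F as x + w x)"
    using kl by (intro polynomial_fun_add polynomial_fun_scale) (auto intro: polynomial_fun_mono)
  then show ?case by blast
qed

text \<open>The operation \<open>w \<mapsto> \<integral> a w\<close>.\<close>

lemma integral_span_integrate:
  assumes F: "integral_family n F" and M: "subgroup M G" "M \<subseteq> N" and a: "a \<in> poly_homs"
    and m: "Suc m \<le> n" and w: "integral_span F m w"
  shows "\<exists>w'. integral_span F (Suc m) w' \<and>
    (\<forall>y\<in>M. polynomial_fun (G\<lparr>carrier := M\<rparr>) m (\<lambda>x. w' (y \<otimes> x) - w' x - a y * w x))"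
  using w
proof (induction rule: integral_span.induct)
  interpret M: group "G\<lparr>carrier := M\<rparr>" by (rule subgroup_imp_group[OF M(1)])
  case zero
  show ?case using integral_span.zero M.polynomial_fun_zero by (intro exI[of _ "\<lambda>x. 0"]) auto
next
  interpret M: group "G\<lparr>carrier := M\<rparr>" by (rule subgroup_imp_group[OF M(1)])
  case (add w as b)
  then obtain w' where w': "integral_span F (Suc m) w'"
    "\<And>y. y \<in> M \<Longrightarrow> polynomial_fun (G\<lparr>carrier := M\<rparr>) m (\<lambda>x. w' (y \<otimes> x) - w' x - a y * w x)" by blast
  have as: "set (a # as) \<subseteq> poly_homs" "length (a # as) = Suc m" using add a by auto
  have "polynomial_fun (G\<lparr>carrier := M\<rparr>) m (\<lambda>x. b * F (a # as) (y \<otimes> x) + w' (y \<otimes> x)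
      - (b * F (a # as) x + w' x) - a y * (b * F as x + w x))" if y: "y \<in> M" for y
  proof (rule M.polynomial_fun_cong)
    \<comment> \<open>In the product rule for \<open>a # as\<close>, the cut after one letter gives
      \<open>a y * F as x\<close>; from \<open>i = 2\<close> on, the remaining word is shorter than
      \<open>m\<close> and counts as lower order.\<close>
    show "polynomial_fun (G\<lparr>carrier := M\<rparr>) m (\<lambda>x. b * (\<Sum>i=2..Suc m. F (take i (a # as)) y * F (drop i (a # as)) x)
        + (w' (y \<otimes> x) - w' x - a y * w x))"
    proof (intro M.polynomial_fun_add M.polynomial_fun_scale M.polynomial_fun_sum w'(2) y)
      fix i assume i: "i \<in> {2..Suc m}"
      have "set (drop i (a # as)) \<subseteq> poly_homs" using as(1) by (meson set_drop_subset subset_trans)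
      then have "polynomial_fun (G\<lparr>carrier := M\<rparr>) (Suc (length (drop i (a # as)))) (F (drop i (a # as)))"
        using as m by (intro integral_family_polynomial[OF F M]) auto
      then show "polynomial_fun (G\<lparr>carrier := M\<rparr>) m (F (drop i (a # as)))"
        by (rule M.polynomial_fun_mono) (use i as in auto)
    qed
    fix x assume "x \<in> carrier (G\<lparr>carrier := M\<rparr>)"
    then have xy: "x \<in> carrier G" "y \<in> N" using M y by auto
    have F0: "F [] = (\<lambda>x. 1)" using F by (simp add: integral_family_def)
    have "set [a] \<subseteq> poly_homs \<and> length [a] \<le> n" using a m by simp
    then have F1: "F [a] = a" using F unfolding integral_family_def by blast
    have "F (a # as) (y \<otimes> x) = (\<Sum>i=0..Suc m. F (take i (a # as)) y * F (drop i (a # as)) x)"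
      using integral_family_mult[OF F as(1) _ xy(2,1)] m unfolding as(2) by blast
    also have "\<dots> = F (a # as) x + (a y * F as x + (\<Sum>i=2..Suc m. F (take i (a # as)) y * F (drop i (a # as)) x))"
      by (simp add: sum.atLeast_Suc_atMost[of 0] sum.atLeast_Suc_atMost[of "Suc 0"] F0 F1 numeral_2_eq_2 del: sum.cl_ivl_Suc)
    finally show "b * (\<Sum>i=2..Suc m. F (take i (a # as)) y * F (drop i (a # as)) x)
        + (w' (y \<otimes> x) - w' x - a y * w x) =
      b * F (a # as) (y \<otimes> x) + w' (y \<otimes> x) - (b * F (a # as) x + w' x) - a y * (b * F as x + w x)"
      by (simp add: algebra_simps)
  qed
  moreover have "integral_span F (Suc m) (\<lambda>x. b * F (a # as) x + w' x)"
    by (rule integral_span.add[OF w'(1) as])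
  ultimately show ?case by (intro exI[of _ "\<lambda>x. b * F (a # as) x + w' x"]) blast
qed

section \<open>Polynomial functions on the subgroup generated by finitely many elements\<close>

context
  fixes B0 d
  assumes B0: "finite B0" "B0 \<subseteq> N"
    and d: "\<And>b. b \<in> B0 \<Longrightarrow> d b \<in> poly_homs"
      "\<And>b b'. b \<in> B0 \<Longrightarrow> b' \<in> B0 \<Longrightarrow> d b b' = (if b = b' then 1 else 0)"
begin

abbreviation M where "M \<equiv> generate G B0"

lemma subgroup_M: "subgroup M G" and M_N: "M \<subseteq> N"
proof -
  have "B0 \<subseteq> carrier G" using B0(2) by auto
  then show "subgroup M G" by (rule generate_is_subgroup)
  show "M \<subseteq> N" by (rule generate_subgroup_incl[OF B0(2) subgroup_N])
qed

text \<open>If the difference of \<open>f\<close> along each \<open>b \<in> B0\<close> has leading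
  part \<open>w b\<close>, the sum over \<open>b\<close> of the integrals of \<open>d b\<close>
  followed by \<open>w b\<close> has the same leading differences, because \<open>d\<close> is dual
  to \<open>B0\<close>; agreement along generators suffices.\<close>

lemma leading_part:
  assumes F: "integral_family n F" and m: "m \<le> n"
    and f: "polynomial_fun (G\<lparr>carrier := M\<rparr>) (Suc m) f"
  shows "\<exists>w. integral_span F m w \<and> polynomial_fun (G\<lparr>carrier := M\<rparr>) m (\<lambda>x. f x - w x)"
  using m f
proof (induction m arbitrary: f)
  interpret M: group "G\<lparr>carrier := M\<rparr>" by (rule subgroup_imp_group[OF subgroup_M])
  case 0
  have "integral_span F 0 (\<lambda>x. f \<one> * F [] x + 0)"
    by (rule integral_span.add[OF integral_span.zero]) auto
  moreover have "f x = f \<one>" if "x \<in> M" for x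
    using M.polynomial_fun_1[OF 0(2)] that by simp
  ultimately show ?case
    using F by (intro exI[of _ "\<lambda>x. f \<one> * F [] x + 0"]) (auto simp: integral_family_def)
next
  interpret M: group "G\<lparr>carrier := M\<rparr>" by (rule subgroup_imp_group[OF subgroup_M])
  case (Suc m)
  have gen: "generate (G\<lparr>carrier := M\<rparr>) B0 = carrier (G\<lparr>carrier := M\<rparr>)"
    using generate_consistent[OF _ subgroup_M, of B0] generate.incl[of _ B0 G] by auto
  have B0M: "b \<in> M" if "b \<in> B0" for b using that by (rule generate.incl)
  have "\<exists>w. integral_span F m w \<and>
      polynomial_fun (G\<lparr>carrier := M\<rparr>) m (\<lambda>x. (f (b \<otimes> x) - f x) - w x)" if "b \<in> B0" for b
    using Suc.IH[of "\<lambda>x. f (b \<otimes> x) - f x"] Suc.prems B0M[OF that] by auto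
  then obtain w where w: "\<And>b. b \<in> B0 \<Longrightarrow> integral_span F m (w b)"
    "\<And>b. b \<in> B0 \<Longrightarrow> polynomial_fun (G\<lparr>carrier := M\<rparr>) m (\<lambda>x. (f (b \<otimes> x) - f x) - w b x)" by metis
  have "\<exists>w'. integral_span F (Suc m) w' \<and>
      (\<forall>y\<in>M. polynomial_fun (G\<lparr>carrier := M\<rparr>) m (\<lambda>x. w' (y \<otimes> x) - w' x - d b y * w b x))"
    if "b \<in> B0" for b
    by (rule integral_span_integrate[OF F subgroup_M M_N d(1)[OF that] Suc.prems(1) w(1)[OF that]])
  then obtain w' where w': "\<And>b. b \<in> B0 \<Longrightarrow> integral_span F (Suc m) (w' b)"
    "\<And>b y. b \<in> B0 \<Longrightarrow> y \<in> M \<Longrightarrow>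
      polynomial_fun (G\<lparr>carrier := M\<rparr>) m (\<lambda>x. w' b (y \<otimes> x) - w' b x - d b y * w b x)" by metis
  define v where "v x = (\<Sum>b\<in>B0. w' b x)" for x
  have "integral_span F (Suc m) v" unfolding v_def by (rule integral_span_sum[OF w'(1)])
  moreover have "polynomial_fun (G\<lparr>carrier := M\<rparr>) (Suc m) (\<lambda>x. f x - v x)"
  proof (rule M.polynomial_fun_SucI[OF _ gen])
    show "B0 \<subseteq> carrier (G\<lparr>carrier := M\<rparr>)" using B0M by auto
    fix b assume b: "b \<in> B0"
    have "polynomial_fun (G\<lparr>carrier := M\<rparr>) m (\<lambda>x. (f (b \<otimes> x) - f x - w b x) -
      (\<Sum>c\<in>B0. w' c (b \<otimes> x) - w' c x - d c b * w c x))"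
      using b B0M by (intro M.polynomial_fun_diff M.polynomial_fun_sum w(2) w'(2)) auto
    then show "polynomial_fun (G\<lparr>carrier := M\<rparr>) m
      (\<lambda>x. f (b \<otimes>\<^bsub>G\<lparr>carrier := M\<rparr>\<^esub> x) - v (b \<otimes>\<^bsub>G\<lparr>carrier := M\<rparr>\<^esub> x) - (f x - v x))"
    proof (rule M.polynomial_fun_cong)
      fix x
      have "(\<Sum>c\<in>B0. d c b * w c x) = (\<Sum>c\<in>B0. if c = b then w b x else 0)"
        using d(2) b by (intro sum.cong) auto
      then have "(\<Sum>c\<in>B0. d c b * w c x) = w b x" using b B0 by simp
      then show "(f (b \<otimes> x) - f x - w b x) - (\<Sum>c\<in>B0. w' c (b \<otimes> x) - w' c x - d c b * w c x) =
        f (b \<otimes>\<^bsub>G\<lparr>carrier := M\<rparr>\<^esub> x) - v (b \<otimes>\<^bsub>G\<lparr>carrier := M\<rparr>\<^esub> x) - (f x - v x)"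
        by (simp add: v_def sum_subtractf)
    qed
  qed
  ultimately show ?case by blast
qed

text \<open>Leading parts are split off degree by degree, and each of them is polynomial on all of
  \<open>G\<close>.\<close>

lemma polynomial_extends:
  assumes F: "integral_family n F" and m: "m \<le> Suc n"
    and f: "polynomial_fun (G\<lparr>carrier := M\<rparr>) m f"
  shows "\<exists>w k. polynomial_fun G k w \<and> (\<forall>x\<in>M. f x = w x)"
  using m f
proof (induction m arbitrary: f)
  case 0
  then show ?case using polynomial_fun_zero[of 0] by (intro exI[of _ "\<lambda>x. 0"] exI[of _ 0]) auto
next
  case (Suc m)
  obtain w where w: "integral_span F m w" "polynomial_fun (G\<lparr>carrier := M\<rparr>) m (\<lambda>x. f x - w x)"
    using leading_part[OF F _ Suc.prems(2)] Suc.prems(1) by auto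
  obtain k where k: "polynomial_fun G k w"
    using integral_span_polynomial[OF F _ w(1)] Suc.prems(1) by auto
  obtain u l where u: "polynomial_fun G l u" "\<And>x. x \<in> M \<Longrightarrow> f x - w x = u x"
    using Suc.IH[OF _ w(2)] Suc.prems(1) by auto
  have "polynomial_fun G (max k l) (\<lambda>x. w x + u x)"
    using k u(1) by (intro polynomial_fun_add) (auto intro: polynomial_fun_mono)
  moreover have "f x = w x + u x" if "x \<in> M" for x using u(2)[OF that] by simp
  ultimately show ?case by blast
qed

end

lemma polynomial_separates_N:
  assumes g: "g \<in> N" "g \<noteq> \<one>"
  shows "\<exists>k f. polynomial_fun G k f \<and> f g \<noteq> f \<one>"
proof -
  have BN: "B \<subseteq> N" using basis by (simp add: free_basis_def)
  have "g \<in> generate GN B" using GN.free_basis_generate[OF basis] g by simp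
  then have "\<exists>B0\<subseteq>B. finite B0 \<and> g \<in> generate G B0"
  proof induction
    case one
    then show ?case by (intro exI[of _ "{}"]) (auto intro: generate.one)
  next
    case (incl h)
    then show ?case by (intro exI[of _ "{h}"]) (auto intro: generate.incl)
  next
    case (inv h)
    then have "inv\<^bsub>GN\<^esub> h = inv h" using BN by auto
    then show ?case using inv by (intro exI[of _ "{h}"]) (auto intro: generate.inv)
  next
    case (eng h1 h2)
    then obtain C D where "C \<subseteq> B" "finite C" "h1 \<in> generate G C" "D \<subseteq> B" "finite D" "h2 \<in> generate G D"
      by blast
    moreover from this have "h1 \<in> generate G (C \<union> D)" "h2 \<in> generate G (C \<union> D)"
      using mono_generate[of C "C \<union> D"] mono_generate[of D "C \<union> D"] by auto
    ultimately show ?case by (intro exI[of _ "C \<union> D"]) (auto intro: generate.eng)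
  qed
  then obtain B0 where B0: "B0 \<subseteq> B" "finite B0" "g \<in> generate G B0" by blast
  then have B0N: "B0 \<subseteq> N" using BN by blast
  \<comment> \<open>Coordinate homomorphisms of the free group show independence with respect to all
    homomorphisms, and \<open>poly_homs_separate\<close> transfers it to the polynomial
    ones.\<close>
  have indep: "\<forall>b\<in>B0. v b = 0" if v: "\<And>e. e \<in> poly_homs \<Longrightarrow> (\<Sum>b\<in>B0. v b * e b) = 0" for v
  proof
    fix b assume b: "b \<in> B0"
    obtain r where r: "rat_hom GN r" "\<And>c. c \<in> B \<Longrightarrow> r c = (if c = b then 1 else 0)"
      using GN.free_basis_rat_hom[OF basis, of "\<lambda>c. if c = b then 1 else 0"] by blast
    have "0 = (\<Sum>c\<in>B0. v c * r (proj c))"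
      using poly_homs_separate[OF B0(2) B0N v hom_N_proj[OF r(1)]] by simp
    also have "\<dots> = (\<Sum>c\<in>B0. if c = b then v b else 0)"
      using r(2) B0(1) B0N by (intro sum.cong) (auto simp: subset_iff)
    finally show "v b = 0" using b B0(2) by simp
  qed
  have "\<exists>d. \<forall>b\<in>B0. d b \<in> poly_homs \<and> (\<forall>c\<in>B0. d b c = (if b = c then 1 else 0))"
  proof (rule dual_family[OF B0(2) poly_homs_zero])
    show "(\<lambda>x. p * a x + q * b x) \<in> poly_homs" if "a \<in> poly_homs" "b \<in> poly_homs" for a b p q
      using that by (rule poly_homs_lincomb)
    show "\<forall>i\<in>B0. v i = 0" if "\<And>e. e \<in> poly_homs \<Longrightarrow> (\<Sum>i\<in>B0. v i * e i) = 0" for v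
      using that by (rule indep)
  qed
  then obtain d where d: "\<And>b. b \<in> B0 \<Longrightarrow> d b \<in> poly_homs"
      "\<And>b c. b \<in> B0 \<Longrightarrow> c \<in> B0 \<Longrightarrow> d b c = (if b = c then 1 else 0)" by blast
  obtain k f where f: "polynomial_fun GN k f" "f g \<noteq> f \<one>"
    using GN.free_basis_polynomial_separates[OF basis, of g] g by auto
  have "polynomial_fun (G\<lparr>carrier := generate G B0\<rparr>) k f"
    using GN.polynomial_fun_subgroup[OF f(1), of "generate G B0"] M_N[OF B0(2) B0N d] by simp
  moreover obtain F where F: "integral_family k F" using integral_family_exists by blast
  ultimately obtain w l where w: "polynomial_fun G l w" "\<And>x. x \<in> generate G B0 \<Longrightarrow> f x = w x"
    using polynomial_extends[OF B0(2) B0N d F, of k f] by auto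
  have "w g \<noteq> w \<one>" using f(2) w(2)[OF B0(3)] w(2)[OF generate.one] by simp
  then show ?thesis using w(1) by blast
qed

lemma residually_torsion_free_nilpotent: "residually_torsion_free_nilpotent G"
proof (rule residually_torsion_free_nilpotentI)
  fix g assume g: "g \<in> carrier G" "g \<noteq> \<one>"
  show "\<exists>k f. polynomial_fun G k f \<and> f g \<noteq> f \<one>"
  proof (cases "g \<in> N")
    case True
    then show ?thesis using g(2) by (rule polynomial_separates_N)
  next
    case False
    have "polynomial_fun G (Suc (Suc 0)) (\<lambda>x. of_int (\<epsilon> x))" by simp
    moreover have "rat_of_int (\<epsilon> g) \<noteq> of_int (\<epsilon> \<one>)"
    proof -
      have "\<epsilon> g \<noteq> 0" using False g(1) N_iff by blast
      then show ?thesis by simp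
    qed
    ultimately show ?thesis by (intro exI[of _ "Suc (Suc 0)"] exI[of _ "\<lambda>x. of_int (\<epsilon> x)"] conjI)
  qed
qed

end

section \<open>The hypothesis on the abelianization\<close>

context infinite_cyclic_extension
begin

text \<open>The value of \<open>(t - 1) e\<close> at \<open>y\<close> is that of \<open>e\<close> at
  the commutator of \<open>y\<close> and \<open>inv t\<close>, which lies one step deeper in the
  lower central series; along \<open>N\<close> the differences of \<open>e\<close> are
  constant.\<close>

lemma poly_hom_nilpotent_quotient:
  assumes "group_hom G Q \<pi>" and e: "hom_N e"
    and kills: "\<And>y. y \<in> N \<Longrightarrow> \<pi> y \<in> lower_central Q (Suc j) \<Longrightarrow> e y = 0"
  shows "polynomial_fun G (Suc j) e"
  using e kills
proof (induction j arbitrary: e)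
  interpret \<pi>: group_hom G Q \<pi> by fact
  case 0
  have "e x = 0" if "x \<in> carrier G" for x
    using 0(2)[of "proj x"] invariant_proj[OF hom_N_invariant[OF 0(1)] that] that by simp
  then have "polynomial_fun G 0 e" by simp
  then show ?case by (rule polynomial_fun_Suc)
next
  interpret \<pi>: group_hom G Q \<pi> by fact
  case (Suc j)
  show ?case
  proof (rule polynomial_fun_SucI[OF _ generate_N_t])
    show "insert t N \<subseteq> carrier G" by auto
    fix g assume "g \<in> insert t N"
    then consider "g = t" | "g \<in> N" by blast
    then show "polynomial_fun G (Suc j) (\<lambda>x. e (g \<otimes> x) - e x)"
    proof cases
      case 2
      show ?thesis
        by (rule polynomial_fun_cong[OF polynomial_fun_const[of j "e g"]]) (simp add: hom_N_mult_N[OF Suc.prems(1) 2])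
    next
      case 1
      define e' where "e' x = 1 * e (t \<otimes> x) + (- 1) * e x" for x
      have e': "hom_N e'"
        unfolding e'_def by (rule hom_N_lincomb[OF hom_N_translate[OF Suc.prems(1)] Suc.prems(1)])
      have "polynomial_fun G (Suc j) e'"
      proof (rule Suc.IH[OF e'])
        fix y assume y: "y \<in> N" "\<pi> y \<in> lower_central Q (Suc j)"
        define z where "z = inv y \<otimes> (t \<otimes> y \<otimes> inv t)"
        have z: "z \<in> N" using y by (simp add: z_def)
        have eq: "\<pi> z = inv\<^bsub>Q\<^esub> (\<pi> y) \<otimes>\<^bsub>Q\<^esub> inv\<^bsub>Q\<^esub> (\<pi> (inv t)) \<otimes>\<^bsub>Q\<^esub> \<pi> y \<otimes>\<^bsub>Q\<^esub> \<pi> (inv t)"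
          using y by (simp add: z_def \<pi>.H.m_assoc)
        have "\<pi> (inv t) \<in> carrier Q" by simp
        then have "\<pi> z \<in> lower_central Q (Suc (Suc j))"
          using y(2) unfolding eq lower_central.simps commutator_subgroup_def
          by (intro generate.incl CollectI exI conjI) (rule refl)
        then have "e z = 0" using Suc.prems(2) z by blast
        moreover have "e z = e (inv y) + e (t \<otimes> y \<otimes> inv t)"
          unfolding z_def using y by (intro hom_N_mult_N[OF Suc.prems(1)]) auto
        moreover have "e (inv y) = - e y"
          using GN.rat_hom_inv[OF hom_N_rat_hom[OF Suc.prems(1)], of y] y by simp
        moreover have "e (t \<otimes> y \<otimes> inv t) = e (t \<otimes> y)"
          using y by (intro invariant_inv_t[OF hom_N_invariant[OF Suc.prems(1)]]) auto
        ultimately show "e' y = 0" by (simp add: e'_def)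
      qed
      then show ?thesis unfolding 1 by (rule polynomial_fun_cong) (simp add: e'_def)
    qed
  qed
qed

text \<open>As \<open>\<pi> x\<close> has infinite order, exponents define a homomorphism on the
  preimage of its powers. This contains all commutators of \<open>N\<close>, and divisibility
  extends the homomorphism to \<open>N\<close>; nilpotence of \<open>Q\<close> makes it
  polynomial.\<close>

lemma poly_hom_from_quotient:
  assumes \<pi>: "group_hom G Q \<pi>" and tf: "torsion_free_group Q" and nil: "nilpotent_group Q"
    and comm: "\<And>x y. x \<in> N \<Longrightarrow> y \<in> N \<Longrightarrow> \<pi> (x \<otimes> y \<otimes> inv x \<otimes> inv y) = \<one>\<^bsub>Q\<^esub>"
    and x: "x \<in> N" "\<pi> x \<noteq> \<one>\<^bsub>Q\<^esub>"
  shows "\<exists>e k. hom_N e \<and> polynomial_fun G k e \<and> e x \<noteq> 0"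
proof -
  interpret \<pi>: group_hom G Q \<pi> by fact
  have px: "\<pi> x \<in> carrier Q" using x by simp
  have pow_0: "i = 0" if "\<pi> x [^]\<^bsub>Q\<^esub> (i::int) = \<one>\<^bsub>Q\<^esub>" for i
  proof (rule ccontr)
    assume "i \<noteq> 0"
    have "\<pi> x [^]\<^bsub>Q\<^esub> (nat \<bar>i\<bar>) = \<one>\<^bsub>Q\<^esub>"
    proof (cases i rule: int_cases2)
      case (nonneg n)
      then show ?thesis using that by (simp add: int_pow_int)
    next
      case (nonpos n)
      then show ?thesis using that px \<pi>.H.int_pow_neg_int[of "\<pi> x" n]
        by (metis \<pi>.H.inv_eq_1_iff \<pi>.H.nat_pow_closed abs_minus_cancel abs_of_nat nat_int)
    qed
    then show False using tf x px \<open>i \<noteq> 0\<close> unfolding torsion_free_group_def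
      by (metis zero_less_abs_iff zero_less_nat_eq)
  qed
  have pow_inj: "i = j" if "\<pi> x [^]\<^bsub>Q\<^esub> (i::int) = \<pi> x [^]\<^bsub>Q\<^esub> (j::int)" for i j
    using pow_0[of "i - j"] that px by (simp add: \<pi>.H.int_pow_diff)
  \<comment> \<open>\<open>H\<close> contains the kernel of \<open>\<pi>\<close> in
    \<open>N\<close>, with \<open>f\<close> equal to \<open>0\<close> there; this makes the
    extension vanish on the preimage of the trivial term of the lower central series.\<close>
  define H where "H = {y \<in> N. \<exists>i::int. \<pi> y = \<pi> x [^]\<^bsub>Q\<^esub> i}"
  define f where "f y = rat_of_int (THE i. \<pi> y = \<pi> x [^]\<^bsub>Q\<^esub> (i::int))" for y
  have f: "f y = of_int i" if "\<pi> y = \<pi> x [^]\<^bsub>Q\<^esub> (i::int)" for y i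
  proof -
    have "(THE i. \<pi> y = \<pi> x [^]\<^bsub>Q\<^esub> (i::int)) = i" using that pow_inj by (intro the_equality) auto
    then show ?thesis by (simp add: f_def)
  qed
  have H_mult: "y \<otimes> z \<in> H \<and> f (y \<otimes> z) = f y + f z" if yz: "y \<in> H" "z \<in> H" for y z
  proof -
    obtain i j where ij: "\<pi> y = \<pi> x [^]\<^bsub>Q\<^esub> (i::int)" "\<pi> z = \<pi> x [^]\<^bsub>Q\<^esub> (j::int)" "y \<in> N" "z \<in> N"
      using yz by (auto simp: H_def)
    then have "\<pi> (y \<otimes> z) = \<pi> x [^]\<^bsub>Q\<^esub> (i + j)" using px by (simp add: \<pi>.H.int_pow_mult)
    then show ?thesis using f[of y i] f[of z j] f[of "y \<otimes> z" "i + j"] ij by (auto simp: H_def)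
  qed
  have one: "\<pi> y = \<one>\<^bsub>Q\<^esub> \<Longrightarrow> y \<in> N \<Longrightarrow> y \<in> H \<and> f y = 0" for y
    using f[of y 0] by (auto simp: H_def intro!: exI[of _ "0::int"])
  have "subgroup H GN"
  proof (rule GN.subgroupI)
    have "\<one> \<in> H" using one[of \<one>] by simp
    then show "H \<noteq> {}" by blast
  next
    fix y assume "y \<in> H"
    then obtain i where i: "\<pi> y = \<pi> x [^]\<^bsub>Q\<^esub> (i::int)" "y \<in> N" by (auto simp: H_def)
    then have "\<pi> (inv y) = \<pi> x [^]\<^bsub>Q\<^esub> (- i)" using px by (simp add: \<pi>.H.int_pow_neg)
    then show "inv\<^bsub>GN\<^esub> y \<in> H" using i by (auto simp: H_def)
  qed (use H_mult in \<open>auto simp: H_def\<close>)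
  moreover have "rat_hom (GN\<lparr>carrier := H\<rparr>) f"
    using H_mult by (simp add: rat_hom_def)
  moreover have "y \<otimes>\<^bsub>GN\<^esub> z \<otimes>\<^bsub>GN\<^esub> inv\<^bsub>GN\<^esub> y \<otimes>\<^bsub>GN\<^esub> inv\<^bsub>GN\<^esub> z \<in> H \<and>
      f (y \<otimes>\<^bsub>GN\<^esub> z \<otimes>\<^bsub>GN\<^esub> inv\<^bsub>GN\<^esub> y \<otimes>\<^bsub>GN\<^esub> inv\<^bsub>GN\<^esub> z) = 0"
    if "y \<in> carrier GN" "z \<in> carrier GN" for y z
    using one[OF comm[of y z]] that by simp
  ultimately obtain h where h: "rat_hom GN h" "\<And>y. y \<in> H \<Longrightarrow> h y = f y"
    using GN.rat_hom_extend[of H f] by blast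
  define e where "e y = h (proj y)" for y
  have e: "hom_N e" unfolding e_def by (rule hom_N_proj[OF h(1)])
  obtain c where c: "lower_central Q (Suc c) = {\<one>\<^bsub>Q\<^esub>}" using nil by (auto simp: nilpotent_group_def)
  have "polynomial_fun G (Suc c) e"
  proof (rule poly_hom_nilpotent_quotient[OF \<pi> e])
    fix y assume "y \<in> N" "\<pi> y \<in> lower_central Q (Suc c)"
    then show "e y = 0" using one[of y] h(2) c by (auto simp: e_def)
  qed
  moreover have "x \<in> H \<and> f x = 1"
    using x f[of x 1] px by (auto simp: H_def intro!: exI[of _ "1::int"])
  then have "e x = 1" using h(2) x by (simp add: e_def)
  ultimately show ?thesis using e by (metis zero_neq_one)
qed

end

section \<open>From the hypotheses of the theorem to the locales\<close>

lemma (in group) infinite_cyclic_quotient: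
  assumes "N \<lhd> G" "cyclic_group (G Mod N)" "infinite (carrier (G Mod N))"
  shows "\<exists>t \<epsilon>. infinite_cyclic_extension G N t \<epsilon>"
proof -
  interpret N: normal N G by fact
  interpret Q: group "G Mod N" by (rule N.factorgroup_is_group)
  obtain C where C: "C \<in> carrier (G Mod N)" "subgroup_generated (G Mod N) {C} = G Mod N"
    using assms(2) by (auto simp: cyclic_group_def)
  obtain t where t: "t \<in> carrier G" "C = N #> t" using C(1) by (auto simp: carrier_FactGroup)
  have "carrier (G Mod N) = range (\<lambda>n::int. C [^]\<^bsub>G Mod N\<^esub> n)"
    using Q.carrier_subgroup_generated_by_singleton[OF C(1)] C(2) by simp
  moreover have "N #> g \<in> carrier (G Mod N)" if "g \<in> carrier G" for g
    using that unfolding carrier_FactGroup by blast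
  ultimately have "\<exists>i::int. N #> g = C [^]\<^bsub>G Mod N\<^esub> i" if "g \<in> carrier G" for g
    using that by blast
  then have ex: "\<exists>i::int. N #> g = N #> (t [^] i)" if "g \<in> carrier G" for g
    using that unfolding t(2) N.FactGroup_int_pow[OF t(1)] by blast
  have inj: "i = j" if "N #> (t [^] (i::int)) = N #> (t [^] (j::int))" for i j
    using that assms(3) Q.infinite_cyclic_subgroup_int[OF C(1)] C(2) t by (simp add: N.FactGroup_int_pow)
  define \<epsilon> where "\<epsilon> g = (THE i. N #> g = N #> (t [^] (i::int)))" for g
  have \<epsilon>: "\<epsilon> g = i" if "N #> g = N #> (t [^] (i::int))" for g i
    unfolding \<epsilon>_def using that inj by (intro the_equality) auto
  have \<epsilon>_eq: "N #> g = N #> (t [^] \<epsilon> g)" if "g \<in> carrier G" for g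
    using ex[OF that] \<epsilon> by auto
  have "infinite_cyclic_extension G N t \<epsilon>"
  proof unfold_locales
    fix x
    show "x \<in> N \<longleftrightarrow> x \<in> carrier G \<and> \<epsilon> x = 0"
    proof safe
      assume x: "x \<in> N"
      then show "x \<in> carrier G" by (rule N.mem_carrier)
      have "N #> x = N #> (t [^] (0::int))" using N.rcos_const[OF is_group x] N.subset by (simp add: coset_mult_one)
      then show "\<epsilon> x = 0" by (rule \<epsilon>)
    next
      assume x: "x \<in> carrier G" "\<epsilon> x = 0"
      then have "N #> x = N" using \<epsilon>_eq[OF x(1)] N.subset by (simp add: coset_mult_one)
      then show "x \<in> N" using rcos_self[OF x(1) N.subgroup_axioms] by simp
    qed
    show "t \<in> carrier G" by (rule t(1))
    show "\<epsilon> t = 1" using t(1) by (intro \<epsilon>) simp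
    fix y assume xy: "x \<in> carrier G" "y \<in> carrier G"
    show "\<epsilon> (x \<otimes> y) = \<epsilon> x + \<epsilon> y"
    proof (rule \<epsilon>)
      have "N #> (x \<otimes> y) = (N #> x) <#> (N #> y)" using xy by (simp add: N.rcos_sum)
      also have "\<dots> = (N #> (t [^] \<epsilon> x)) <#> (N #> (t [^] \<epsilon> y))" using \<epsilon>_eq xy by metis
      also have "\<dots> = N #> (t [^] (\<epsilon> x + \<epsilon> y))" using t(1) by (simp add: N.rcos_sum int_pow_mult)
      finally show "N #> (x \<otimes> y) = N #> (t [^] (\<epsilon> x + \<epsilon> y))" .
    qed
  qed
  then show ?thesis by blast
qed

lemma (in normal) lower_central_2_normal:
  shows "lower_central (G\<lparr>carrier := H\<rparr>) 2 \<lhd> G"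
proof -
  let ?X = "{inv h \<otimes> inv k \<otimes> h \<otimes> k | h k. h \<in> H \<and> k \<in> H}"
  have image: "{f h k | h k. h \<in> H \<and> k \<in> H} = (\<lambda>(h, k). f h k) ` (H \<times> H)" for f :: "'a \<Rightarrow> 'a \<Rightarrow> 'a"
    by auto
  have "{inv\<^bsub>G\<lparr>carrier := H\<rparr>\<^esub> h \<otimes> inv\<^bsub>G\<lparr>carrier := H\<rparr>\<^esub> k \<otimes> h \<otimes> k | h k. h \<in> H \<and> k \<in> H} = ?X"
    unfolding image by (intro image_cong) (auto simp: m_inv_consistent[OF subgroup_axioms])
  then have "lower_central (G\<lparr>carrier := H\<rparr>) 2 = generate (G\<lparr>carrier := H\<rparr>) ?X"
    by (simp add: numeral_2_eq_2 commutator_subgroup_def)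
  also have "\<dots> = generate G ?X"
    by (rule generate_consistent[OF _ subgroup_axioms]) auto
  also have "\<dots> \<lhd> G"
  proof (rule normal_generateI)
    show "?X \<subseteq> carrier G" by (auto intro: mem_carrier)
    fix c g assume "c \<in> ?X" and g: "g \<in> carrier G"
    then obtain h k where hk: "c = inv h \<otimes> inv k \<otimes> h \<otimes> k" "h \<in> H" "k \<in> H" by blast
    then have "h \<in> carrier G" "k \<in> carrier G" by (auto intro: mem_carrier)
    then have "g \<otimes> c \<otimes> inv g = inv (g \<otimes> h \<otimes> inv g) \<otimes> inv (g \<otimes> k \<otimes> inv g) \<otimes> (g \<otimes> h \<otimes> inv g) \<otimes> (g \<otimes> k \<otimes> inv g)"
      unfolding hk(1) using g by (simp add: inv_mult_group m_assoc inv_cancel)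
    moreover have "g \<otimes> h \<otimes> inv g \<in> H" "g \<otimes> k \<otimes> inv g \<in> H" using inv_op_closed2[OF g] hk by auto
    ultimately show "g \<otimes> c \<otimes> inv g \<in> ?X" by blast
  qed
  finally show ?thesis .
qed

lemma (in group) rat_hom_lower_central_2:
  assumes r: "rat_hom G r" and x: "x \<in> lower_central G 2"
  shows "r x = 0"
proof -
  let ?X = "{inv h \<otimes> inv k \<otimes> h \<otimes> k | h k. h \<in> carrier G \<and> k \<in> carrier G}"
  have X: "?X \<subseteq> carrier G" by auto
  have mult: "r (a \<otimes> b) = r a + r b" if "a \<in> carrier G" "b \<in> carrier G" for a b
    using r that by (simp add: rat_hom_def)
  have "x \<in> generate G ?X" using x by (simp add: numeral_2_eq_2 commutator_subgroup_def)
  then show ?thesis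
  proof induction
    case one
    show ?case by (rule rat_hom_one[OF r])
  next
    case (incl h)
    then show ?case by (auto simp: mult rat_hom_inv[OF r])
  next
    case (inv h)
    then show ?case by (auto simp: mult rat_hom_inv[OF r])
  next
    case (eng a b)
    then have "a \<in> carrier G" "b \<in> carrier G" using generate_incl[OF X] by blast+
    then show ?case using eng.IH mult by simp
  qed
qed

lemma (in group) residually_torsion_free_nilpotent_extension:
  assumes "finitely_generated G"
    and "N \<lhd> G"
    and "free_group (G\<lparr>carrier := N\<rparr>)"
    and "cyclic_group (G Mod N)" and "infinite (carrier (G Mod N))"
    and "residually_torsion_free_nilpotent (G Mod lower_central (G\<lparr>carrier := N\<rparr>) 2)"
  shows "residually_torsion_free_nilpotent G"
proof -
  interpret N: normal N G by fact
  obtain t \<epsilon> where "infinite_cyclic_extension G N t \<epsilon>"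
    using infinite_cyclic_quotient[OF assms(2,4,5)] by blast
  then interpret E: infinite_cyclic_extension G N t \<epsilon> .
  obtain S where S: "finite S" "S \<subseteq> carrier G" "generate G S = carrier G"
    using assms(1) by (auto simp: finitely_generated_def)
  obtain B where B: "free_basis (G\<lparr>carrier := N\<rparr>) B"
    using assms(3) by (auto simp: free_group_def)
  define L where "L = lower_central (G\<lparr>carrier := N\<rparr>) 2"
  interpret L: normal L G unfolding L_def by (rule N.lower_central_2_normal)
  interpret GL: group "G Mod L" by (rule L.factorgroup_is_group)
  have "\<exists>e k. E.hom_N e \<and> polynomial_fun G k e \<and> e x \<noteq> 0"
    if x: "x \<in> N" and r: "rat_hom (G\<lparr>carrier := N\<rparr>) r" "r x \<noteq> 0" for x r
  proof -
    \<comment> \<open>A homomorphism to \<open>\<rat>\<close> kills the derived subgroup, so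
      \<open>x\<close> survives in the quotient and residuality applies to it.\<close>
    have "x \<notin> L" using E.GN.rat_hom_lower_central_2[OF r(1)] r(2) by (auto simp: L_def)
    then have "L #> x \<noteq> \<one>\<^bsub>G Mod L\<^esub>"
      using rcos_self[OF _ L.subgroup_axioms, of x] x by auto
    moreover have "L #> x \<in> carrier (G Mod L)" using x by (auto simp: carrier_FactGroup)
    ultimately obtain K where K: "K \<lhd> (G Mod L)" "L #> x \<notin> K"
      "torsion_free_group (G Mod L Mod K)" "nilpotent_group (G Mod L Mod K)"
      using assms(6) unfolding residually_torsion_free_nilpotent_def residually_def L_def by blast
    interpret K: normal K "G Mod L" by fact
    define \<pi> where "\<pi> g = K #>\<^bsub>G Mod L\<^esub> (L #> g)" for g
    have "(\<lambda>x. K #>\<^bsub>G Mod L\<^esub> x) \<circ> (\<lambda>g. L #> g) \<in> hom G (G Mod L Mod K)"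
      using L.r_coset_hom_Mod K.r_coset_hom_Mod by (rule Group.hom_compose)
    then have "\<pi> \<in> hom G (G Mod L Mod K)" by (simp add: \<pi>_def[abs_def] comp_def)
    then have hom: "group_hom G (G Mod L Mod K) \<pi>"
      using K.factorgroup_is_group by (simp add: group_hom_def group_hom_axioms_def)
    show ?thesis
    proof (rule E.poly_hom_from_quotient[OF hom K(3,4) _ x])
      show "\<pi> x \<noteq> \<one>\<^bsub>G Mod L Mod K\<^esub>"
        using GL.rcos_self[OF \<open>L #> x \<in> carrier (G Mod L)\<close> K.subgroup_axioms] K(2) by (auto simp: \<pi>_def)
    next
      fix y z assume y: "y \<in> N" and z: "z \<in> N"
      \<comment> \<open>The defining commutators begin with inverses; inserting \<open>inv y\<close>
        and \<open>inv z\<close> yields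
        \<open>y \<otimes> z \<otimes> inv y \<otimes> inv z\<close>.\<close>
      have "inv\<^bsub>E.GN\<^esub> (inv y) \<otimes>\<^bsub>E.GN\<^esub> inv\<^bsub>E.GN\<^esub> (inv z) \<otimes>\<^bsub>E.GN\<^esub> inv y \<otimes>\<^bsub>E.GN\<^esub> inv z \<in> L"
        unfolding L_def numeral_2_eq_2 lower_central.simps commutator_subgroup_def
        by (intro generate.incl CollectI exI conjI, rule refl) (use y z in auto)
      then have "y \<otimes> z \<otimes> inv y \<otimes> inv z \<in> L" using y z by simp
      then have "L #> (y \<otimes> z \<otimes> inv y \<otimes> inv z) = \<one>\<^bsub>G Mod L\<^esub>" using L.rcos_const[OF is_group] by simp
      then show "\<pi> (y \<otimes> z \<otimes> inv y \<otimes> inv z) = \<one>\<^bsub>G Mod L Mod K\<^esub>"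
        using K.rcos_const[OF GL.is_group K.one_closed] by (simp add: \<pi>_def)
    qed
  qed
  then interpret unipotent_free_extension G N t \<epsilon> S B
    by unfold_locales (use S B in auto)
  show ?thesis by (rule residually_torsion_free_nilpotent)
qed

theorem theorem6:
  fixes G :: "('a, 'b) monoid_scheme" and N :: "'a set"
  assumes "group G"
    and "finitely_generated G"
    and "N \<lhd> G"
    and "free_group (G\<lparr>carrier := N\<rparr>)"
    and "cyclic_group (G Mod N)" and "infinite (carrier (G Mod N))"
    and "residually_torsion_free_nilpotent (G Mod lower_central (G\<lparr>carrier := N\<rparr>) 2)"
  shows "residually_torsion_free_nilpotent G"
  using group.residually_torsion_free_nilpotent_extension[OF assms] .

end
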